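(* Let $N\ge1$ and let $a_1<a_2<\dots<a_N$ be real; let $I=[a_1,a_2]\cup\dots\cup[a_{N-1},a_N]$ if $N$ is even and $I=[a_1,a_2]\cup\dots\cup[a_{N-2},a_{N-1}]\cup[a_N,\infty)$ if $N$ is odd. Let $\widetilde K$ be the integral operator on $L^2(\gamma_L\cup\gamma_R)$ with kernel $$\widetilde K(\lambda,\mu)=\frac{\vec f^{T}(\lambda)\,\vec g(\mu)}{\lambda-\mu},$$ where $\vec f,\vec g$ are the $\mathbb C^{N+1}$-valued functions $$\vec f(\lambda)=\frac1{2\pi i}\Big(\big[e^{\lambda^3/6},0,\dots,0\big]^T\chi_{\gamma_R}(\lambda)+\big[0,e^{-\lambda^3/6+a_1\lambda},\dots,e^{-\lambda^3/6+a_N\lambda}\big]^T\chi_{\gamma_L}(\lambda)\Big),$$ $$\vec g(\lambda)=\big[0,e^{\lambda^3/6-a_1\lambda},-e^{\lambda^3/6-a_2\lambda},\dots,(-1)^{N+1}e^{\lambda^3/6-a_N\lambda}\big]^T\chi_{\gamma_R}(\lambda)+\big[e^{-\lambda^3/6},0,\dots,0\big]^T\chi_{\gamma_L}(\lambda).$$ Then $\widetilde K$ is a trace-class operator on $L^2(\gamma_L\cup\gamma_R)$ and $$\det(\mathrm{Id}-\widetilde K)=\det(\mathrm{Id}-K_{\mathrm{Ai}}\chi_I),$$ where $K_{\mathrm{Ai}}$ is the Airy kernel.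
   Context: Contours: $\gamma_R$ is a smooth curve in the open right half-plane, at positive distance from $i\mathbb R$, oriented from $e^{-i\pi/3}\infty$ to $e^{i\pi/3}\infty$ (asymptotic to the rays $\arg\lambda=\pm\pi/3$), and $\gamma_L=-\gamma_R$ is its image under $\lambda\mapsto-\lambda$ with the induced orientation. Integral operators on $L^2(\gamma_L\cup\gamma_R)$ act by $(\widetilde Kh)(\lambda)=\int_{\gamma_L\cup\gamma_R}\widetilde K(\lambda,\mu)h(\mu)\,d\mu$ (complex line element $d\mu$, with $\gamma_R$ oriented from $e^{-i\pi/3}\infty$ to $e^{i\pi/3}\infty$ and $\gamma_L$ oriented from $e^{2i\pi/3}\infty$ to $e^{-2i\pi/3}\infty$). $\chi_A$ is the characteristic function of $A$. Airy kernel: $$K_{\mathrm{Ai}}(x,y)=\frac1{(2\pi i)^2}\int_{\gamma_R}d\mu\int_{\gamma_L}d\lambda\,\frac{e^{\vartheta_x(\mu)-\vartheta_y(\lambda)}}{\lambda-\mu}=\frac{\mathrm{Ai}(x)\mathrm{Ai}'(y)-\mathrm{Ai}(y)\mathrm{Ai}'(x)}{x-y},\qquad \vartheta_x(\mu)=\frac{\mu^3}3-x\mu .$$ $\det(\mathrm{Id}-K_{\mathrm{Ai}}\chi_I)$ is the Fredholm determinant of the Airy kernel operator restricted to $I$ (i.e. acting on $L^2(I)$). *)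

theory Defs
  imports "HOL-Analysis.Analysis" "Jordan_Normal_Form.Determinant"
begin

section \<open>Operators on the Hilbert space of square-integrable functions\<close>

text \<open>Elements of \<open>L\<^sup>2(M)\<close> are represented by measurable square-integrable functions; identities
  in \<open>L\<^sup>2(M)\<close> hold almost everywhere.\<close>

definition l2 :: "'a measure \<Rightarrow> ('a \<Rightarrow> complex) set" where
  "l2 M = {h \<in> borel_measurable M. integrable M (\<lambda>x. (cmod (h x))\<^sup>2)}"

definition l2_inner :: "'a measure \<Rightarrow> ('a \<Rightarrow> complex) \<Rightarrow> ('a \<Rightarrow> complex) \<Rightarrow> complex" where
  "l2_inner M g h = (LINT x|M. cnj (g x) * h x)"

definition l2_norm :: "'a measure \<Rightarrow> ('a \<Rightarrow> complex) \<Rightarrow> real" where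
  "l2_norm M h = sqrt (LINT x|M. (cmod (h x))\<^sup>2)"

text \<open>Linearity and boundedness force a bounded operator to respect equality almost
  everywhere, so that it acts on \<open>L\<^sup>2(M)\<close> proper.\<close>

definition l2_bounded_operator ::
    "'a measure \<Rightarrow> (('a \<Rightarrow> complex) \<Rightarrow> ('a \<Rightarrow> complex)) \<Rightarrow> bool" where
  "l2_bounded_operator M T \<longleftrightarrow>
     (\<forall>h\<in>l2 M. T h \<in> l2 M) \<and>
     (\<forall>g\<in>l2 M. \<forall>h\<in>l2 M. \<forall>c. AE x in M. T (\<lambda>y. c * g y + h y) x = c * T g x + T h x) \<and>
     (\<exists>C. \<forall>h\<in>l2 M. l2_norm M (T h) \<le> C * l2_norm M h)"

definition l2_positive_operator ::
    "'a measure \<Rightarrow> (('a \<Rightarrow> complex) \<Rightarrow> ('a \<Rightarrow> complex)) \<Rightarrow> bool" where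
  "l2_positive_operator M P \<longleftrightarrow>
     l2_bounded_operator M P \<and>
     (\<forall>h\<in>l2 M. l2_inner M h (P h) \<in> \<real> \<and> 0 \<le> Re (l2_inner M h (P h)))"

text \<open>\<open>P = |T|\<close>, the positive square root of \<open>T\<^sup>* T\<close>. A positive operator on a complex Hilbert
  space is self-adjoint, so the last clause is \<open>P P = T\<^sup>* T\<close> in weak form.\<close>

definition l2_absolute_value ::
    "'a measure \<Rightarrow> (('a \<Rightarrow> complex) \<Rightarrow> ('a \<Rightarrow> complex)) \<Rightarrow>
     (('a \<Rightarrow> complex) \<Rightarrow> ('a \<Rightarrow> complex)) \<Rightarrow> bool" where
  "l2_absolute_value M T P \<longleftrightarrow>
     l2_positive_operator M P \<and>
     (\<forall>g\<in>l2 M. \<forall>h\<in>l2 M. l2_inner M (P g) (P h) = l2_inner M (T g) (T h))"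

text \<open>Distinct members of an orthonormal set differ on a set of positive measure, so no
  quotient by null functions is needed.\<close>

definition l2_orthonormal_basis :: "'a measure \<Rightarrow> ('a \<Rightarrow> complex) set \<Rightarrow> bool" where
  "l2_orthonormal_basis M E \<longleftrightarrow>
     E \<subseteq> l2 M \<and>
     (\<forall>e\<in>E. \<forall>e'\<in>E. l2_inner M e e' = (if e = e' then 1 else 0)) \<and>
     (\<forall>h\<in>l2 M. (\<forall>e\<in>E. l2_inner M e h = 0) \<longrightarrow> (AE x in M. h x = 0))"

text \<open>\<open>Tr |T| < \<infinity>\<close>; the trace of a positive operator does not depend on the orthonormal basis.\<close>

definition l2_trace_class ::
    "'a measure \<Rightarrow> (('a \<Rightarrow> complex) \<Rightarrow> ('a \<Rightarrow> complex)) \<Rightarrow> bool" where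
  "l2_trace_class M T \<longleftrightarrow>
     l2_bounded_operator M T \<and>
     (\<exists>P. l2_absolute_value M T P \<and>
          (\<forall>E. l2_orthonormal_basis M E \<longrightarrow> (\<lambda>e. Re (l2_inner M e (P e))) summable_on E))"

section \<open>Integral operators and Fredholm determinants\<close>

definition integral_operator ::
    "'a measure \<Rightarrow> ('a \<Rightarrow> 'a \<Rightarrow> complex) \<Rightarrow> ('a \<Rightarrow> complex) \<Rightarrow> ('a \<Rightarrow> complex)" where
  "integral_operator M K h = (\<lambda>x. LINT y|M. K x y * h y)"

definition fredholm_minor ::
    "('a \<Rightarrow> 'a \<Rightarrow> complex) \<Rightarrow> nat \<Rightarrow> (nat \<Rightarrow> 'a) \<Rightarrow> complex" where
  "fredholm_minor K n x = Determinant.det (Matrix.mat n n (\<lambda>(i, j). K (x i) (x j)))"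

definition fredholm_coeff ::
    "'a measure \<Rightarrow> ('a \<Rightarrow> 'a \<Rightarrow> complex) \<Rightarrow> nat \<Rightarrow> complex" where
  "fredholm_coeff M K n =
     (-1) ^ n / fact n * (LINT x|Pi\<^sub>M {..<n} (\<lambda>_. M). fredholm_minor K n x)"

text \<open>The Fredholm determinant \<open>det (Id - K)\<close> of the integral operator with kernel \<open>K\<close> on
  \<open>L\<^sup>2(M)\<close>, given by Fredholm's expansion, and the condition that this expansion is meaningful.\<close>

definition fredholm_det :: "'a measure \<Rightarrow> ('a \<Rightarrow> 'a \<Rightarrow> complex) \<Rightarrow> complex" where
  "fredholm_det M K = (\<Sum>n. fredholm_coeff M K n)"

definition fredholm_det_exists :: "'a measure \<Rightarrow> ('a \<Rightarrow> 'a \<Rightarrow> complex) \<Rightarrow> bool" where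
  "fredholm_det_exists M K \<longleftrightarrow>
     (\<forall>n. integrable (Pi\<^sub>M {..<n} (\<lambda>_. M)) (fredholm_minor K n)) \<and>
     summable (fredholm_coeff M K)"

section \<open>The contours\<close>

text \<open>\<open>\<gamma>\<close> parametrises \<open>\<gamma>\<^sub>R\<close>; the contour \<open>\<gamma>\<^sub>L = -\<gamma>\<^sub>R\<close> is parametrised by \<open>\<lambda>t. - \<gamma> t\<close>.
  Being asymptotic to a ray means that both the position and the tangent approach its direction;
  without control of the tangent the arc length near infinity could grow without bound.\<close>

definition right_contour :: "(real \<Rightarrow> complex) \<Rightarrow> bool" where
  "right_contour \<gamma> \<longleftrightarrow>
     \<gamma> C1_differentiable_on UNIV \<and> inj \<gamma> \<and> (\<forall>t. vector_derivative \<gamma> (at t) \<noteq> 0) \<and>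
     (\<exists>\<delta>>0. \<forall>t. \<delta> \<le> Re (\<gamma> t)) \<and>
     filterlim \<gamma> at_infinity at_bot \<and> filterlim \<gamma> at_infinity at_top \<and>
     ((\<lambda>t. sgn (\<gamma> t)) \<longlongrightarrow> cis (- pi / 3)) at_bot \<and>
     ((\<lambda>t. sgn (\<gamma> t)) \<longlongrightarrow> cis (pi / 3)) at_top \<and>
     ((\<lambda>t. sgn (vector_derivative \<gamma> (at t))) \<longlongrightarrow> - cis (- pi / 3)) at_bot \<and>
     ((\<lambda>t. sgn (vector_derivative \<gamma> (at t))) \<longlongrightarrow> cis (pi / 3)) at_top"

definition line_integral :: "(real \<Rightarrow> complex) \<Rightarrow> (complex \<Rightarrow> complex) \<Rightarrow> complex" where
  "line_integral \<gamma> F = (LINT t|lborel. F (\<gamma> t) * vector_derivative \<gamma> (at t))"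

text \<open>The arc length measure \<open>|d\<mu>|\<close> on \<open>\<gamma>\<^sub>L \<union> \<gamma>\<^sub>R\<close>, as a measure on the plane: the sign \<open>s\<close>
  selects the contour.\<close>

definition arc_length_measure :: "(real \<Rightarrow> complex) \<Rightarrow> complex measure" where
  "arc_length_measure \<gamma> =
     distr (density (count_space {1, -1} \<Otimes>\<^sub>M lborel)
              (\<lambda>(s, t). ennreal (cmod (vector_derivative \<gamma> (at t)))))
       borel (\<lambda>(s, t). s * \<gamma> t)"

text \<open>The unit tangent of the oriented contours, so that \<open>d\<mu> = unit_tangent \<gamma> \<mu> |d\<mu>|\<close>.\<close>

definition unit_tangent :: "(real \<Rightarrow> complex) \<Rightarrow> complex \<Rightarrow> complex" where
  "unit_tangent \<gamma> \<mu> =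
     (if \<mu> \<in> range \<gamma> then sgn (vector_derivative \<gamma> (at (the_inv \<gamma> \<mu>)))
      else if - \<mu> \<in> range \<gamma> then - sgn (vector_derivative \<gamma> (at (the_inv \<gamma> (- \<mu>))))
      else 0)"

lemma right_contour_continuous:
  assumes "right_contour \<gamma>"
  shows "continuous_on UNIV \<gamma>" "continuous_on UNIV (\<lambda>t. vector_derivative \<gamma> (at t))" "inj \<gamma>"
  using assms C1_differentiable_imp_continuous_on
  unfolding right_contour_def C1_differentiable_on_eq by (auto intro: differentiable_imp_continuous_within simp: continuous_on_eq_continuous_at)

lemma measurable_the_inv_contour:
  fixes \<gamma> :: "real \<Rightarrow> complex"
  assumes cont: "continuous_on UNIV \<gamma>" and inj: "inj \<gamma>"
  shows "range \<gamma> \<in> sets borel" "the_inv \<gamma> \<in> borel_measurable (restrict_space borel (range \<gamma>))"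
proof -
  have im: "\<gamma> ` A \<in> sets borel" if "closed A" for A
  proof -
    have "\<gamma> ` A = (\<Union>n::nat. \<gamma> ` (A \<inter> {- real n..real n}))"
    proof -
      have "A = (\<Union>n::nat. A \<inter> {- real n..real n})"
      proof (intro equalityI subsetI)
        fix x assume "x \<in> A"
        obtain n :: nat where "\<bar>x\<bar> \<le> real n" using real_arch_simple by blast
        then show "x \<in> (\<Union>n::nat. A \<inter> {- real n..real n})" using \<open>x \<in> A\<close> by (intro UN_I[of n]) (auto simp: abs_le_iff)
      qed auto
      then show ?thesis by (metis image_UN)
    qed
    moreover have "compact (\<gamma> ` (A \<inter> {- real n..real n}))" for n :: nat
      using that by (intro compact_continuous_image continuous_on_subset[OF cont])
        (auto intro: closed_Int_compact)
    then have "(\<Union>n::nat. \<gamma> ` (A \<inter> {- real n..real n})) \<in> sets borel"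
      by (intro sets.countable_UN) (auto intro: borel_compact)
    ultimately show ?thesis by simp
  qed
  show *: "range \<gamma> \<in> sets borel" using im[of UNIV] by simp
  show "the_inv \<gamma> \<in> borel_measurable (restrict_space borel (range \<gamma>))"
  proof (rule borel_measurableI_le)
    fix a :: real
    have "{z \<in> space (restrict_space borel (range \<gamma>)). the_inv \<gamma> z \<le> a} = \<gamma> ` {..a}"
      using inj by (auto simp: space_restrict_space the_inv_f_f)
    then show "{z \<in> space (restrict_space borel (range \<gamma>)). the_inv \<gamma> z \<le> a}
        \<in> sets (restrict_space borel (range \<gamma>))"
      using im[of "{..a}"] * by (auto simp: sets_restrict_space_iff)
  qed
qed

lemma unit_tangent_measurable:
  assumes "right_contour \<gamma>"
  shows "unit_tangent \<gamma> \<in> borel_measurable borel"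
proof -
  note c = right_contour_continuous[OF assms]
  note m = measurable_the_inv_contour[OF c(1,3)]
  define d where "d = (\<lambda>t. sgn (vector_derivative \<gamma> (at t)))"
  have d: "d \<in> borel_measurable borel"
    using borel_measurable_continuous_onI[OF c(2)] unfolding d_def by simp
  define e where "e = (\<lambda>z. if z \<in> range \<gamma> then d (the_inv \<gamma> z) else 0)"
  have e: "e \<in> borel_measurable borel"
    unfolding e_def
    by (rule iffD1[OF measurable_restrict_space_iff[of "range \<gamma>"]])
       (use m d in \<open>auto intro: measurable_compose\<close>)
  have "unit_tangent \<gamma> = (\<lambda>z. if z \<in> range \<gamma> then e z else - e (- z))"
    by (auto simp: unit_tangent_def e_def d_def)
  also have "\<dots> \<in> borel_measurable borel"
    using e m(1) by measurable
  finally show ?thesis .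
qed

text \<open>Integration of \<open>unit_tangent \<gamma>\<close> against arc length is the contour integral over
  \<open>\<gamma>\<^sub>L \<union> \<gamma>\<^sub>R\<close> with the stated orientations.\<close>

lemma line_integral_conv_arc_length:
  assumes \<gamma>: "right_contour \<gamma>" and F: "F \<in> borel_measurable borel"
    and R: "integrable lborel (\<lambda>t. F (\<gamma> t) * vector_derivative \<gamma> (at t))"
    and L: "integrable lborel (\<lambda>t. F (- \<gamma> t) * vector_derivative \<gamma> (at t))"
  shows "(LINT \<mu>|arc_length_measure \<gamma>. F \<mu> * unit_tangent \<gamma> \<mu>) =
         line_integral \<gamma> F + line_integral (\<lambda>t. - \<gamma> t) F"
proof -
  note c = right_contour_continuous[OF \<gamma>]
  note [measurable] = unit_tangent_measurable[OF \<gamma>] F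
  define D where "D = (\<lambda>t. vector_derivative \<gamma> (at t))"
  have [measurable]: "\<gamma> \<in> borel_measurable borel" "D \<in> borel_measurable borel"
    using c(1,2) by (auto intro: borel_measurable_continuous_onI simp: D_def)
  obtain \<delta> where \<delta>: "\<delta> > 0" "\<And>t. \<delta> \<le> Re (\<gamma> t)" using \<gamma> unfolding right_contour_def by blast
  have neg: "- \<gamma> t \<notin> range \<gamma>" for t
  proof
    assume "- \<gamma> t \<in> range \<gamma>"
    then obtain u where "- \<gamma> t = \<gamma> u" by auto
    then have "Re (\<gamma> u) = - Re (\<gamma> t)" by (metis uminus_complex.sel(1))
    with \<delta>(1) \<delta>(2)[of t] \<delta>(2)[of u] show False by linarith
  qed
  have sg: "of_real (cmod z) * sgn z = z" for z :: complex
    by (simp add: sgn_eq)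
  have tR: "cmod (D t) *\<^sub>R (F (\<gamma> t) * unit_tangent \<gamma> (\<gamma> t)) = F (\<gamma> t) * D t" for t
    using sg[of "D t"] c(3) by (simp add: unit_tangent_def D_def the_inv_f_f scaleR_conv_of_real mult.left_commute)
  have tL: "cmod (D t) *\<^sub>R (F (- \<gamma> t) * unit_tangent \<gamma> (- \<gamma> t)) = F (- \<gamma> t) * (- D t)" for t
    using sg[of "D t"] c(3) neg[of t] by (simp add: unit_tangent_def D_def the_inv_f_f scaleR_conv_of_real mult.left_commute)
  have R': "integrable lborel (\<lambda>t. F (\<gamma> t) * D t)" and L': "integrable lborel (\<lambda>t. F (- \<gamma> t) * D t)"
    using R L by (simp_all add: D_def)
  let ?C = "count_space {1, -1 :: complex}"
  let ?G = "\<lambda>(s, t). cmod (D t) *\<^sub>R (F (s * \<gamma> t) * unit_tangent \<gamma> (s * \<gamma> t))"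
  interpret C: sigma_finite_measure ?C by (rule sigma_finite_measure_count_space_finite) simp
  interpret P: pair_sigma_finite ?C lborel ..
  have [measurable]: "(\<lambda>x. fst x) \<in> borel_measurable (?C \<Otimes>\<^sub>M lborel)"
    by (rule measurable_compose[OF measurable_fst]) simp
  have pm[measurable]: "(\<lambda>(s, t). s * \<gamma> t) \<in> borel_measurable (?C \<Otimes>\<^sub>M lborel)"
    unfolding split_def by measurable
  have nm: "(\<lambda>(s, t). cmod (D t)) \<in> borel_measurable (?C \<Otimes>\<^sub>M lborel)" by measurable
  have Gm: "?G \<in> borel_measurable (?C \<Otimes>\<^sub>M lborel)" unfolding split_def by measurable
  have sec: "integrable lborel (\<lambda>t. ?G (s, t))" if "s \<in> {1, -1}" for s
    using that R' L' by (auto simp: tR tL)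
  have Gi: "integrable (?C \<Otimes>\<^sub>M lborel) ?G"
    using Gm sec by (subst P.Fubini_integrable) (auto simp: AE_count_space integrable_count_space)
  have "(LINT \<mu>|arc_length_measure \<gamma>. F \<mu> * unit_tangent \<gamma> \<mu>) =
        (LINT x|density (?C \<Otimes>\<^sub>M lborel) (\<lambda>x. ennreal (case x of (s, t) \<Rightarrow> cmod (D t))).
           F (case x of (s, t) \<Rightarrow> s * \<gamma> t) * unit_tangent \<gamma> (case x of (s, t) \<Rightarrow> s * \<gamma> t))"
    unfolding arc_length_measure_def D_def
    by (subst integral_distr) (use pm in \<open>auto simp: split_def\<close>)
  also have "\<dots> = (LINT x|(?C \<Otimes>\<^sub>M lborel). ?G x)"
    by (subst integral_density) (use nm in \<open>auto simp: split_def\<close>)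
  also have "\<dots> = (LINT s|?C. LINT t|lborel. ?G (s, t))"
    using P.integral_fst'[OF Gi] by simp
  also have "\<dots> = (LINT t|lborel. ?G (1, t)) + (LINT t|lborel. ?G (-1, t))"
    by (subst lebesgue_integral_count_space_finite) auto
  also have "(LINT t|lborel. ?G (1, t)) = line_integral \<gamma> F"
    by (simp add: tR line_integral_def) (simp add: D_def)
  also have "(LINT t|lborel. ?G (-1, t)) = line_integral (\<lambda>t. - \<gamma> t) F"
  proof -
    have "vector_derivative (\<lambda>t. - \<gamma> t) (at t) = - D t" for t
      using \<gamma> unfolding D_def right_contour_def C1_differentiable_on_eq
      by (intro vector_derivative_at has_vector_derivative_minus) (simp add: vector_derivative_works[symmetric])
    then show ?thesis by (simp add: tL line_integral_def)
  qed
  finally show ?thesis .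
qed

text \<open>The kernel with respect to \<open>|d\<mu>|\<close> that corresponds to the kernel \<open>K\<close> with respect to the
  complex line element \<open>d\<mu>\<close>.\<close>

definition line_element_kernel ::
    "(real \<Rightarrow> complex) \<Rightarrow> (complex \<Rightarrow> complex \<Rightarrow> complex) \<Rightarrow> complex \<Rightarrow> complex \<Rightarrow> complex" where
  "line_element_kernel \<gamma> K \<zeta> \<mu> = K \<zeta> \<mu> * unit_tangent \<gamma> \<mu>"

section \<open>The kernels of the theorem\<close>

text \<open>Vectors in \<open>\<complex>\<^sup>N\<^sup>+\<^sup>1\<close> are functions of an index \<open>j \<in> {0..N}\<close>; the exponential with
  parameter \<open>a j\<close>, for \<open>1 \<le> j \<le> N\<close>, sits in component \<open>j\<close>.\<close>

definition f_vec :: "(real \<Rightarrow> complex) \<Rightarrow> (nat \<Rightarrow> real) \<Rightarrow> complex \<Rightarrow> nat \<Rightarrow> complex" where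
  "f_vec \<gamma> a \<zeta> j = 1 / (2 * of_real pi * \<i>) *
     (if j = 0 then exp (\<zeta> ^ 3 / 6) * indicator (range \<gamma>) \<zeta>
      else exp (- (\<zeta> ^ 3) / 6 + of_real (a j) * \<zeta>) * indicator (range (\<lambda>t. - \<gamma> t)) \<zeta>)"

definition g_vec :: "(real \<Rightarrow> complex) \<Rightarrow> (nat \<Rightarrow> real) \<Rightarrow> complex \<Rightarrow> nat \<Rightarrow> complex" where
  "g_vec \<gamma> a \<zeta> j =
     (if j = 0 then exp (- (\<zeta> ^ 3) / 6) * indicator (range (\<lambda>t. - \<gamma> t)) \<zeta>
      else (-1) ^ (j + 1) * exp (\<zeta> ^ 3 / 6 - of_real (a j) * \<zeta>) * indicator (range \<gamma>) \<zeta>)"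

text \<open>On the diagonal the numerator vanishes, and so does the kernel by \<open>x / 0 = 0\<close>; this is also
  the continuous extension, as the numerator vanishes on \<open>\<gamma>\<^sub>R \<times> \<gamma>\<^sub>R\<close> and on \<open>\<gamma>\<^sub>L \<times> \<gamma>\<^sub>L\<close>.\<close>

definition K_tilde ::
    "(real \<Rightarrow> complex) \<Rightarrow> nat \<Rightarrow> (nat \<Rightarrow> real) \<Rightarrow> complex \<Rightarrow> complex \<Rightarrow> complex" where
  "K_tilde \<gamma> N a \<zeta> \<mu> = (\<Sum>j\<le>N. f_vec \<gamma> a \<zeta> j * g_vec \<gamma> a \<mu> j) / (\<zeta> - \<mu>)"

definition airy_phase :: "real \<Rightarrow> complex \<Rightarrow> complex" where
  "airy_phase x \<mu> = \<mu> ^ 3 / 3 - of_real x * \<mu>"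

definition airy_kernel :: "(real \<Rightarrow> complex) \<Rightarrow> real \<Rightarrow> real \<Rightarrow> complex" where
  "airy_kernel \<gamma> x y = 1 / (2 * of_real pi * \<i>)\<^sup>2 *
     line_integral \<gamma> (\<lambda>\<mu>. line_integral (\<lambda>t. - \<gamma> t)
       (\<lambda>\<zeta>. exp (airy_phase x \<mu> - airy_phase y \<zeta>) / (\<zeta> - \<mu>)))"

definition interval_union :: "nat \<Rightarrow> (nat \<Rightarrow> real) \<Rightarrow> real set" where
  "interval_union N a =
     (\<Union>k\<in>{1..N div 2}. {a (2 * k - 1)..a (2 * k)}) \<union> (if odd N then {a N..} else {})"

end

theory Submission
  imports Defs "Jordan_Normal_Form.Schur_Decomposition"
begin

text \<open>With respect to the decomposition of the contour into \<open>\<gamma>\<^sub>R\<close> and \<open>\<gamma>\<^sub>L\<close> the kernel is antidiagonal,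
  \<open>K = (0 A; B 0)\<close>, so \<open>det (Id - K) = det (Id - A B)\<close>. The identity
  \<open>(\<Sum>j. (-1)^(j + 1) * exp (a j * z)) / z = - (\<integral>s\<in>I. exp (s * z))\<close>, valid for \<open>Re z < 0\<close>, factors \<open>B = G F\<close> through
  \<open>L\<^sup>2(I)\<close>, and \<open>det (Id - A G F) = det (Id - F A G)\<close>, where \<open>F A G\<close> is the Airy kernel on \<open>I\<close>. Both
  determinant identities hold coefficientwise in Fredholm's expansion, the second one by Andreief's
  formula; Hadamard's inequality makes the expansions converge. Since \<open>1 / (\<lambda> - \<mu>)\<close> is also an integral
  of exponentials over a half-line when \<open>Re (\<lambda> - \<mu>) > 0\<close>, the whole kernel is a product of two
  Hilbert-Schmidt kernels, which gives the trace class property.\<close>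

section \<open>Determinants\<close>

text \<open>The contours have infinite length, so bounded kernels would not do: every kernel is
  controlled by a pointwise majorant \<open>f x * g y\<close> with square-integrable factors
  (\<open>dominates\<close>). This condition survives composition and restriction, justifies the use
  of Fubini's theorem, makes the operators bounded, and by Hadamard's inequality bounds the n-th
  minor by n^(n/2) times a product of values of f g, which the 1/n! in Fredholm's expansion absorbs.
  On the contours the majorant comes from the cubic decay of the exponentials, in the auxiliary real
  variable s from the distance of the contours to the imaginary axis. The trace class property
  speaks of |T|, whose existence is part of the claim. It is built without spectral theory: after
  rescaling, X = 1 - \<kappa> T' T with T' the adjoint of T is a contraction, and the power series
  of 1 - sqrt (1 - x) has nonnegative coefficients of sum at most 1, so it converges at X even if
  the norm of X is 1. Likewise only a finite piece of the polar decomposition is formed, enough to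
  test |T| on finitely many basis vectors at a time.\<close>

definition mdet :: "nat \<Rightarrow> (nat \<Rightarrow> nat \<Rightarrow> complex) \<Rightarrow> complex" where
  "mdet n c = Determinant.det (Matrix.mat n n (\<lambda>(i, j). c i j))"

lemma fredholm_minor_mdet: "fredholm_minor K n x = mdet n (\<lambda>i j. K (x i) (x j))"
  by (simp add: fredholm_minor_def mdet_def)

lemma mdet_leibniz:
  "mdet n c = (\<Sum>p | p permutes {..<n}. of_int (sign p) * (\<Prod>i<n. c i (p i)))"
proof -
  have "mdet n c = (\<Sum>p | p permutes {0..<n}. of_int (sign p) * (\<Prod>i = 0..<n. (Matrix.mat n n (\<lambda>(i, j). c i j)) $$ (i, p i)))"
    unfolding mdet_def by (rule det_def') simp
  also have "\<dots> = (\<Sum>p | p permutes {0..<n}. of_int (sign p) * (\<Prod>i = 0..<n. c i (p i)))"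
    by (intro sum.cong refl arg_cong2[where f="(*)"] prod.cong) (auto simp: permutes_in_image)
  finally show ?thesis by (simp add: atLeast0LessThan)
qed

lemma mdet_cong:
  assumes "\<And>i j. i < n \<Longrightarrow> j < n \<Longrightarrow> c i j = d i j"
  shows "mdet n c = mdet n d"
  unfolding mdet_def by (intro arg_cong[where f=Determinant.det] cong_mat) (use assms in auto)

lemma mdet_transpose: "mdet n (\<lambda>i j. c j i) = mdet n c"
proof -
  have "Matrix.mat n n (\<lambda>(i, j). c j i) = transpose_mat (Matrix.mat n n (\<lambda>(i, j). c i j))"
    by (rule eq_matI) auto
  then show ?thesis
    unfolding mdet_def using Determinant.det_transpose[of "Matrix.mat n n (\<lambda>(i, j). c i j)" n] by simp
qed

lemma mdet_permute_rows:
  assumes "p permutes {..<n}"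
  shows "mdet n (\<lambda>i j. c (p i) j) = of_int (sign p) * mdet n c"
proof -
  have p: "p permutes {0..<n}" using assms by (simp add: atLeast0LessThan)
  have "Matrix.mat n n (\<lambda>(i, j). c (p i) j)
      = Matrix.mat n n (\<lambda>(i, j). (Matrix.mat n n (\<lambda>(i, j). c i j)) $$ (p i, j))"
    by (rule eq_matI) (use p in \<open>auto simp: permutes_in_image\<close>)
  then show ?thesis
    unfolding mdet_def using det_permute_rows[of "Matrix.mat n n (\<lambda>(i, j). c i j)" n p] p by simp
qed

lemma mdet_permute_cols:
  assumes "p permutes {..<n}"
  shows "mdet n (\<lambda>i j. c i (p j)) = of_int (sign p) * mdet n c"
  using mdet_permute_rows[OF assms, of "\<lambda>i j. c j i"] mdet_transpose[of n "\<lambda>i j. c i (p j)"]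
    mdet_transpose[of n c] by simp

lemma mdet_permute_both:
  assumes "p permutes {..<n}"
  shows "mdet n (\<lambda>i j. c (p i) (p j)) = mdet n c"
proof -
  have "mdet n (\<lambda>i j. c (p i) (p j)) = of_int (sign p) * (of_int (sign p) * mdet n c)"
    using mdet_permute_rows[OF assms, of "\<lambda>i j. c i (p j)"] mdet_permute_cols[OF assms, of c] by simp
  also have "\<dots> = mdet n c" by (simp add: sign_def)
  finally show ?thesis .
qed

lemma mdet_scale:
  "mdet n (\<lambda>i j. f i * c i j * g j) = (\<Prod>i<n. f i) * (\<Prod>i<n. g i) * mdet n c"
proof -
  have "(\<Prod>i<n. f i * c i (p i) * g (p i)) = (\<Prod>i<n. f i) * (\<Prod>i<n. g i) * (\<Prod>i<n. c i (p i))"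
    if "p permutes {..<n}" for p
  proof -
    have "(\<Prod>i<n. g (p i)) = (\<Prod>i<n. g i)"
      using prod.permute[OF that, of g] by (simp add: o_def)
    then show ?thesis by (simp add: prod.distrib mult_ac)
  qed
  then show ?thesis unfolding mdet_leibniz sum_distrib_left
    by (intro sum.cong) (auto simp: mult_ac)
qed

lemma mdet_zero_row:
  assumes "k < n" "\<And>j. j < n \<Longrightarrow> c k j = 0"
  shows "mdet n c = 0"
proof -
  have "(\<Prod>i<n. c i (p i)) = 0" if "p permutes {..<n}" for p
    using assms permutes_in_image[OF that, of k] by (intro prod_zero) (auto intro!: bexI[of _ k])
  then show ?thesis unfolding mdet_leibniz by (intro sum.neutral) auto
qed

lemma mdet_mult:
  "mdet n (\<lambda>i j. \<Sum>k<n. c i k * d k j) = mdet n c * mdet n d"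
proof -
  have "Matrix.mat n n (\<lambda>(i, j). \<Sum>k<n. c i k * d k j)
      = Matrix.mat n n (\<lambda>(i, j). c i j) * Matrix.mat n n (\<lambda>(i, j). d i j)"
    by (rule eq_matI) (auto simp: scalar_prod_def atLeast0LessThan)
  then show ?thesis
    unfolding mdet_def by (subst (asm) eq_commute) (metis mat_carrier Determinant.det_mult)
qed

text \<open>The determinant of a block matrix with blocks A, B, C, D is det (A D - B C) when C and D
  commute, as they do for D = 0. The sign is that of det (- B C) with m rows.\<close>

lemma mdet_antidiagonal_block:
  assumes "\<And>i j. i < m \<Longrightarrow> j < m \<Longrightarrow> c i j = 0" "\<And>i j. i < m \<Longrightarrow> j < m \<Longrightarrow> c (m + i) (m + j) = 0"
  shows "mdet (m + m) c = (-1) ^ m * (mdet m (\<lambda>i k. c i (m + k)) * mdet m (\<lambda>k j. c (m + k) j))"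
proof -
  let ?B = "Matrix.mat m m (\<lambda>(i, k). c i (m + k))" and ?C = "Matrix.mat m m (\<lambda>(k, j). c (m + k) j)"
  let ?Z = "0\<^sub>m m m :: complex Matrix.mat"
  have "Matrix.mat (m + m) (m + m) (\<lambda>(i, j). c i j) = four_block_mat ?Z ?B ?C ?Z"
    by (rule eq_matI) (use assms in \<open>auto simp: not_less dest!: le_Suc_ex\<close>)
  then have "mdet (m + m) c = Determinant.det (?Z * ?Z - ?B * ?C)"
    unfolding mdet_def by (simp add: det_four_block_mat[of _ m])
  also have "?Z * ?Z - ?B * ?C = (-1) \<cdot>\<^sub>m (?B * ?C)"
    by (rule eq_matI) auto
  also have "Determinant.det \<dots> = (-1) ^ m * (Determinant.det ?B * Determinant.det ?C)"
    by (simp add: Determinant.det_mult[of _ m])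
  finally show ?thesis by (simp add: mdet_def)
qed

text \<open>A nonvanishing term of the Leibniz expansion needs a permutation that exchanges S with
  its complement, and then both have the same cardinality.\<close>

lemma mdet_unbalanced_block:
  assumes "S \<subseteq> {..<n}" "n \<noteq> 2 * card S"
    and "\<And>i j. i < n \<Longrightarrow> j < n \<Longrightarrow> (i \<in> S \<longleftrightarrow> j \<in> S) \<Longrightarrow> c i j = 0"
  shows "mdet n c = 0"
proof -
  have "(\<Prod>i<n. c i (p i)) = 0" if p: "p permutes {..<n}" for p
  proof (rule ccontr)
    assume "(\<Prod>i<n. c i (p i)) \<noteq> 0"
    then have "c i (p i) \<noteq> 0" if "i < n" for i using that by auto
    then have *: "p i \<in> S \<longleftrightarrow> i \<notin> S" if "i < n" for i
      using assms(3)[of i "p i"] that permutes_in_image[OF p, of i] by auto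
    have "p ` S = {..<n} - S"
    proof (intro equalityI subsetI)
      fix x assume "x \<in> p ` S"
      then show "x \<in> {..<n} - S" using * assms(1) permutes_in_image[OF p] by auto
    next
      fix x assume x: "x \<in> {..<n} - S"
      then obtain i where "x = p i" "i < n" using permutes_image[OF p] by (metis DiffD1 imageE lessThan_iff)
      then show "x \<in> p ` S" using * x by auto
    qed
    moreover have "card (p ` S) = card S" using permutes_inj[OF p] by (intro card_image) (auto intro: inj_on_subset)
    moreover have "card ({..<n} - S) = n - card S" using assms(1) finite_subset by (subst card_Diff_subset) auto
    moreover have "card S \<le> n" using assms(1) card_mono[of "{..<n}" S] by simp
    ultimately have "card S = n - card S" by metis
    with \<open>card S \<le> n\<close> show False using assms(2) by linarith
  qed
  then show ?thesis unfolding mdet_leibniz by (intro sum.neutral) auto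
qed

section \<open>Hadamard's inequality for complex matrices\<close>

lemma similar_mat_trace:
  fixes A B :: "complex Matrix.mat"
  assumes "similar_mat A B" "A \<in> carrier_mat n n"
  shows "sum_list (diag_mat A) = sum_list (diag_mat B)"
proof -
  have tr: "sum_list (diag_mat A) = (\<Sum>i<n. A $$ (i, i))" if "A \<in> carrier_mat n n" for A :: "complex Matrix.mat"
    using that unfolding diag_mat_def by (auto simp: interv_sum_list_conv_sum_set_nat atLeast0LessThan)
  have comm: "(\<Sum>i<n. (X * Y) $$ (i, i)) = (\<Sum>i<n. (Y * X) $$ (i, i))"
    if "X \<in> carrier_mat n n" "Y \<in> carrier_mat n n" for X Y :: "complex Matrix.mat"
  proof -
    have "(\<Sum>i<n. (X * Y) $$ (i, i)) = (\<Sum>i<n. \<Sum>j<n. X $$ (i, j) * Y $$ (j, i))"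
      using that by (intro sum.cong) (auto simp: scalar_prod_def atLeast0LessThan)
    also have "\<dots> = (\<Sum>i<n. \<Sum>j<n. Y $$ (i, j) * X $$ (j, i))"
      by (subst sum.swap) (simp add: mult.commute)
    also have "\<dots> = (\<Sum>i<n. (Y * X) $$ (i, i))"
      using that by (intro sum.cong) (auto simp: scalar_prod_def atLeast0LessThan)
    finally show ?thesis .
  qed
  from assms obtain P Q where w: "similar_mat_wit A B P Q" unfolding similar_mat_def by blast
  have c: "P \<in> carrier_mat n n" "Q \<in> carrier_mat n n" "B \<in> carrier_mat n n"
    and e: "A = P * B * Q" "Q * P = 1\<^sub>m n"
    using w assms(2) unfolding similar_mat_wit_def Let_def by auto
  \<comment> \<open>The trace is invariant under cyclic permutation, which brings Q next to
    P.\<close>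
  have "(\<Sum>i<n. A $$ (i, i)) = (\<Sum>i<n. (Q * (P * B)) $$ (i, i))"
    unfolding e(1) using c by (intro comm) auto
  also have "Q * (P * B) = B" using c e(2)
    by (metis assoc_mult_mat left_mult_one_mat)
  finally show ?thesis using tr assms(2) c(3) by simp
qed

text \<open>The eigenvalues of \<open>A A\<^sup>*\<close> are nonnegative and sum up to at most \<open>n\<^sup>2\<close>; the arithmetic-geometric
  mean inequality bounds their product.\<close>

lemma mdet_hadamard_unit:
  assumes "\<And>i j. i < n \<Longrightarrow> j < n \<Longrightarrow> cmod (c i j) \<le> 1"
  shows "(cmod (mdet n c))\<^sup>2 \<le> real n ^ n"
proof (cases "n = 0")
  case True
  then show ?thesis by (simp add: mdet_leibniz)
next
  case False
  define A where "A = Matrix.mat n n (\<lambda>(i, j). c i j)"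
  define B where "B = Matrix.mat n n (\<lambda>(i, j). \<Sum>k<n. c i k * cnj (c j k))"
  have B: "B \<in> carrier_mat n n" by (simp add: B_def)
  have cnj_det: "mdet n (\<lambda>i j. cnj (c i j)) = cnj (mdet n c)"
    unfolding mdet_leibniz by simp
  have detB: "Determinant.det B = of_real ((cmod (mdet n c))\<^sup>2)"
  proof -
    have "Determinant.det B = mdet n (\<lambda>i j. \<Sum>k<n. c i k * (\<lambda>k j. cnj (c j k)) k j)"
      unfolding B_def mdet_def ..
    also have "\<dots> = mdet n c * cnj (mdet n c)"
      unfolding mdet_mult using mdet_transpose[of n "\<lambda>i j. cnj (c i j)"] cnj_det by simp
    finally show ?thesis by (metis complex_norm_square of_real_power)
  qed
  obtain es where es: "char_poly B = (\<Prod>e\<leftarrow>es. [:- e, 1:])" "length es = n"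
    using char_poly_factorized[OF B] by blast
  obtain T P Q where "schur_decomposition B es = (T, P, Q)" by (cases "schur_decomposition B es")
  note sd = schur_decomposition[OF B es(1) this]
  have sim: "similar_mat B T" using sd unfolding similar_mat_def by blast
  have T: "T \<in> carrier_mat n n" using sd B unfolding similar_mat_wit_def Let_def by auto
  have prod_es: "prod_list es = Determinant.det B"
    using det_similar[OF sim] det_upper_triangular[OF _ T] sd by simp
  have sum_es: "sum_list es = (\<Sum>i<n. \<Sum>k<n. of_real ((cmod (c i k))\<^sup>2))"
  proof -
    have "sum_list es = sum_list (diag_mat B)" using similar_mat_trace[OF sim B] sd by simp
    also have "\<dots> = (\<Sum>i<n. B $$ (i, i))"
      unfolding diag_mat_def using B by (auto simp: interv_sum_list_conv_sum_set_nat atLeast0LessThan)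
    also have "\<dots> = (\<Sum>i<n. \<Sum>k<n. of_real ((cmod (c i k))\<^sup>2))"
      by (intro sum.cong refl) (simp add: B_def complex_norm_square del: of_real_power)
    finally show ?thesis .
  qed
  \<comment> \<open>An eigenvector v of B = A A^* satisfies |A^* v|^2 = e |v|^2, that is,
    \<open>W\<close> = e \<open>N\<close>, so e is a quotient of nonnegative reals.\<close>
  have ev: "\<exists>r\<ge>0. e = of_real r" if "e \<in> set es" for e
  proof -
    have "poly (char_poly B) e = 0" using that unfolding es(1) poly_prod_list by (auto simp: prod_list_zero_iff image_iff)
    then have "eigenvalue B e" using eigenvalue_root_char_poly[OF B] by simp
    then obtain v where v: "v \<in> carrier_vec n" "v \<noteq> 0\<^sub>v n" "B *\<^sub>v v = e \<cdot>\<^sub>v v"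
      unfolding eigenvalue_def eigenvector_def using B by auto
    define N where "N = (\<Sum>i<n. (cmod (v $ i))\<^sup>2)"
    define W where "W = (\<Sum>k<n. (cmod (\<Sum>j<n. cnj (c j k) * v $ j))\<^sup>2)"
    have comp: "(\<Sum>j<n. (\<Sum>k<n. c i k * cnj (c j k)) * v $ j) = e * v $ i" if "i < n" for i
    proof -
      have "(B *\<^sub>v v) $ i = (\<Sum>j<n. (\<Sum>k<n. c i k * cnj (c j k)) * v $ j)"
        using that v(1) by (auto simp: B_def scalar_prod_def atLeast0LessThan)
      then show ?thesis using v that by simp
    qed
    have "of_real W = (\<Sum>k<n. (\<Sum>j<n. cnj (c j k) * v $ j) * cnj (\<Sum>j<n. cnj (c j k) * v $ j))"
      unfolding W_def of_real_sum by (intro sum.cong refl complex_norm_square)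
    also have "\<dots> = (\<Sum>k<n. \<Sum>i<n. \<Sum>j<n. cnj (v $ i) * ((c i k * cnj (c j k)) * v $ j))"
      by (simp add: sum_distrib_left sum_distrib_right mult_ac)
    also have "\<dots> = (\<Sum>i<n. \<Sum>k<n. \<Sum>j<n. cnj (v $ i) * ((c i k * cnj (c j k)) * v $ j))"
      by (rule sum.swap)
    also have "\<dots> = (\<Sum>i<n. cnj (v $ i) * (\<Sum>j<n. (\<Sum>k<n. c i k * cnj (c j k)) * v $ j))"
      by (intro sum.cong refl, subst sum.swap) (simp add: sum_distrib_left sum_distrib_right)
    also have "\<dots> = (\<Sum>i<n. cnj (v $ i) * (e * v $ i))" by (intro sum.cong) (auto simp: comp)
    also have "\<dots> = e * of_real N"
      unfolding N_def of_real_sum sum_distrib_left by (intro sum.cong refl) (simp add: complex_norm_square mult_ac del: of_real_power)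
    finally have eq: "of_real W = e * of_real N" .
    obtain i where "i < n" "v $ i \<noteq> 0" using v(1,2) by (metis carrier_vecD eq_vecI index_zero_vec(1) index_zero_vec(2))
    then have "N > 0" unfolding N_def by (intro sum_pos2[of _ i]) auto
    moreover have "W \<ge> 0" unfolding W_def by (intro sum_nonneg) auto
    ultimately have "W / N \<ge> 0" "e = of_real (W / N)" using eq by (auto simp: field_simps)
    then show ?thesis by blast
  qed
  have nn: "0 \<le> Re e" "of_real (Re e) = e" if "e \<in> set es" for e
    using ev[OF that] by auto
  \<comment> \<open>The arithmetic-geometric mean inequality in the form x \<le> exp (x - 1),
    applied to each eigenvalue divided by n. The exponents add up to at most 0 because the trace of
    B is at most n^2.\<close>
  have "prod_list (map (\<lambda>e. Re e / n) es) \<le> exp (\<Sum>e\<leftarrow>es. (Re e / n - 1))"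
    using nn(1)
  proof (induction es)
    case (Cons e es)
    have "Re e / n \<le> exp (Re e / n - 1)" using exp_ge_add_one_self[of "Re e / n - 1"] by simp
    moreover have "0 \<le> prod_list (map (\<lambda>e. Re e / n) es)" using Cons.prems by (intro prod_list_nonneg) auto
    ultimately have "Re e / n * prod_list (map (\<lambda>e. Re e / n) es)
        \<le> exp (Re e / n - 1) * exp (\<Sum>e\<leftarrow>es. (Re e / n - 1))"
      using Cons by (intro mult_mono) auto
    then show ?case unfolding exp_add[symmetric] by simp
  qed simp
  also have "(\<Sum>e\<leftarrow>es. (Re e / n - 1)) \<le> 0"
  proof -
    have "(\<Sum>e\<leftarrow>es. (Re e / n - 1)) = Re (sum_list es) / n - length es"
      by (induction es) (auto simp: add_divide_distrib)
    also have "Re (sum_list es) \<le> (\<Sum>i<n. \<Sum>k<n. 1)"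
      unfolding sum_es Re_sum using assms by (intro sum_mono) (auto simp: power_le_one)
    finally show ?thesis using False es(2) by (simp add: field_simps)
  qed
  finally have le1: "prod_list (map (\<lambda>e. Re e / n) es) \<le> 1" by simp
  have "of_real (prod_list (map (\<lambda>e. Re e / n) es)) = prod_list es / of_nat n ^ length es"
    using nn(2) by (induction es) (auto simp: field_simps)
  also have "\<dots> = of_real ((cmod (mdet n c))\<^sup>2 / real n ^ n)"
    using prod_es detB es(2) by simp
  finally have "prod_list (map (\<lambda>e. Re e / n) es) = (cmod (mdet n c))\<^sup>2 / real n ^ n"
    using of_real_eq_iff by blast
  then show ?thesis using le1 False by (simp add: divide_le_eq_1)
qed

text \<open>Row and column factors can be pulled out of a determinant, which reduces the claim to
  entries of modulus at most 1.\<close>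

lemma mdet_hadamard:
  assumes "\<And>i j. i < n \<Longrightarrow> j < n \<Longrightarrow> cmod (c i j) \<le> f i * g j"
    and "\<And>i. i < n \<Longrightarrow> 0 \<le> f i" "\<And>i. i < n \<Longrightarrow> 0 \<le> g i"
  shows "cmod (mdet n c) \<le> sqrt (real n ^ n) * ((\<Prod>i<n. f i) * (\<Prod>i<n. g i))"
proof -
  \<comment> \<open>Where f i or g j vanishes, so does c i j, and the convention x / 0 = 0 gives a
    consistent entry of \<open>d\<close>.\<close>
  define d where "d i j = c i j / of_real (f i * g j)" for i j
  have le: "cmod (d i j) \<le> 1" if "i < n" "j < n" for i j
    using assms(1)[OF that] assms(2)[OF that(1)] assms(3)[OF that(2)]
    by (auto simp: d_def norm_divide norm_mult divide_le_eq_1)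
  have "c i j = of_real (f i) * d i j * of_real (g j)" if "i < n" "j < n" for i j
    using assms(1)[OF that] by (cases "f i * g j = 0") (auto simp: d_def)
  then have "mdet n c = mdet n (\<lambda>i j. of_real (f i) * d i j * of_real (g j))"
    by (intro mdet_cong) auto
  also have "\<dots> = of_real ((\<Prod>i<n. f i) * (\<Prod>i<n. g i)) * mdet n d"
    unfolding mdet_scale by simp
  finally have eq: "mdet n c = of_real ((\<Prod>i<n. f i) * (\<Prod>i<n. g i)) * mdet n d" .
  have nn: "0 \<le> (\<Prod>i<n. f i)" "0 \<le> (\<Prod>i<n. g i)"
    using assms(2,3) by (auto intro!: prod_nonneg)
  have "cmod (mdet n c) = ((\<Prod>i<n. f i) * (\<Prod>i<n. g i)) * cmod (mdet n d)"
    unfolding eq using nn by (simp add: norm_mult abs_mult norm_of_real del: of_real_mult of_real_prod)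
  also have "\<dots> \<le> ((\<Prod>i<n. f i) * (\<Prod>i<n. g i)) * sqrt (real n ^ n)"
    by (intro mult_left_mono real_le_rsqrt mdet_hadamard_unit) (use le nn in auto)
  finally show ?thesis by (simp add: mult.commute)
qed

section \<open>Kernels dominated by a product of square-integrable functions\<close>

lemma integrable_mult_square_integrable:
  fixes f g :: "'a \<Rightarrow> real"
  assumes [measurable]: "f \<in> borel_measurable M" "g \<in> borel_measurable M"
    and "integrable M (\<lambda>x. (f x)\<^sup>2)" "integrable M (\<lambda>x. (g x)\<^sup>2)"
  shows "integrable M (\<lambda>x. f x * g x)"
proof (rule Bochner_Integration.integrable_bound)
  show "integrable M (\<lambda>x. (f x)\<^sup>2 + (g x)\<^sup>2)" using assms by simp
  have "\<bar>a * b\<bar> \<le> a\<^sup>2 + b\<^sup>2" for a b :: real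
  proof -
    have "0 \<le> (\<bar>a\<bar> - \<bar>b\<bar>)\<^sup>2 + a\<^sup>2 + b\<^sup>2" by simp
    then show ?thesis by (simp add: power2_diff abs_mult)
  qed
  then show "AE x in M. norm (f x * g x) \<le> norm ((f x)\<^sup>2 + (g x)\<^sup>2)" by simp
qed measurable

text \<open>The bound is pointwise rather than almost everywhere: it must hold at every tuple of
  points, where Hadamard's inequality is applied to the minors, and on every section of the
  kernel.\<close>

definition dominates :: "'a measure \<Rightarrow> 'b measure \<Rightarrow> ('a \<Rightarrow> real) \<Rightarrow> ('b \<Rightarrow> real) \<Rightarrow> ('a \<Rightarrow> 'b \<Rightarrow> complex) \<Rightarrow> bool" where
  "dominates M N f g K \<longleftrightarrow>
     f \<in> borel_measurable M \<and> g \<in> borel_measurable N \<and>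
     integrable M (\<lambda>x. (f x)\<^sup>2) \<and> integrable N (\<lambda>y. (g y)\<^sup>2) \<and> (\<forall>x. 0 \<le> f x) \<and> (\<forall>y. 0 \<le> g y) \<and>
     (\<lambda>(x, y). K x y) \<in> borel_measurable (M \<Otimes>\<^sub>M N) \<and>
     (\<forall>x\<in>space M. \<forall>y\<in>space N. cmod (K x y) \<le> f x * g y)"

definition dominated_kernel :: "'a measure \<Rightarrow> 'b measure \<Rightarrow> ('a \<Rightarrow> 'b \<Rightarrow> complex) \<Rightarrow> bool" where
  "dominated_kernel M N K \<longleftrightarrow> (\<exists>f g. dominates M N f g K)"

definition kernel_comp ::
  "'b measure \<Rightarrow> ('a \<Rightarrow> 'b \<Rightarrow> complex) \<Rightarrow> ('b \<Rightarrow> 'c \<Rightarrow> complex) \<Rightarrow> 'a \<Rightarrow> 'c \<Rightarrow> complex" where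
  "kernel_comp N F G x y = (LINT z|N. F x z * G z y)"

lemma dominatesD:
  assumes "dominates M N f g K"
  shows "f \<in> borel_measurable M" "g \<in> borel_measurable N"
    "integrable M (\<lambda>x. (f x)\<^sup>2)" "integrable N (\<lambda>y. (g y)\<^sup>2)" "0 \<le> f x" "0 \<le> g y"
    "(\<lambda>(x, y). K x y) \<in> borel_measurable (M \<Otimes>\<^sub>M N)"
    "x \<in> space M \<Longrightarrow> y \<in> space N \<Longrightarrow> cmod (K x y) \<le> f x * g y"
  using assms unfolding dominates_def by auto

lemma dominated_kernelI:
  assumes "f \<in> borel_measurable M" "g \<in> borel_measurable N"
    "integrable M (\<lambda>x. (f x)\<^sup>2)" "integrable N (\<lambda>y. (g y)\<^sup>2)" "\<And>x. 0 \<le> f x" "\<And>y. 0 \<le> g y"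
    "(\<lambda>(x, y). K x y) \<in> borel_measurable (M \<Otimes>\<^sub>M N)"
    "\<And>x y. x \<in> space M \<Longrightarrow> y \<in> space N \<Longrightarrow> cmod (K x y) \<le> f x * g y"
  shows "dominated_kernel M N K"
  using assms unfolding dominated_kernel_def dominates_def by metis

lemma dominated_kernel_measurable:
  "dominated_kernel M N K \<Longrightarrow> (\<lambda>(x, y). K x y) \<in> borel_measurable (M \<Otimes>\<^sub>M N)"
  by (auto simp: dominated_kernel_def dominates_def)

lemma dominated_kernel_cong:
  assumes "dominated_kernel M N K" "\<And>x y. x \<in> space M \<Longrightarrow> y \<in> space N \<Longrightarrow> K x y = K' x y"
  shows "dominated_kernel M N K'"
proof -
  obtain f g where "dominates M N f g K"
    using assms(1) unfolding dominated_kernel_def by blast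
  note * = dominatesD[OF this]
  have "(\<lambda>(x, y). K' x y) \<in> borel_measurable (M \<Otimes>\<^sub>M N)"
    by (rule measurable_cong[THEN iffD1, OF _ *(7)]) (auto simp: space_pair_measure assms(2))
  then show ?thesis using * assms(2) by (intro dominated_kernelI[of f M g N]) auto
qed

lemma dominated_kernel_indicator:
  assumes K: "dominated_kernel M N K" and R: "R \<in> sets M"
  shows "dominated_kernel M N (\<lambda>x y. indicator R x * K x y)"
proof -
  obtain f g where "dominates M N f g K"
    using K unfolding dominated_kernel_def by blast
  note * = dominatesD[OF this]
  note [measurable] = R *(1,2,7)
  have "(\<lambda>(x, y). indicator R x * K x y) = (\<lambda>p. indicator R (fst p) * (\<lambda>(x, y). K x y) p)" by auto
  also have "\<dots> \<in> borel_measurable (M \<Otimes>\<^sub>M N)" by measurable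
  finally show ?thesis using * by (intro dominated_kernelI[of f M g N]) (auto split: split_indicator)
qed

lemma kernel_comp_integrable:
  assumes F: "dominated_kernel M N F" and G: "dominated_kernel N P G"
    and x: "x \<in> space M" and y: "y \<in> space P"
  shows "integrable N (\<lambda>z. F x z * G z y)"
proof -
  obtain f f' where "dominates M N f f' F"
    using F unfolding dominated_kernel_def by blast
  note f = dominatesD[OF this]
  obtain g g' where "dominates N P g g' G"
    using G unfolding dominated_kernel_def by blast
  note g = dominatesD[OF this]
  note [measurable] = f(2) g(1)
  have [measurable]: "F x \<in> borel_measurable N" "(\<lambda>z. G z y) \<in> borel_measurable N"
    using measurable_compose[OF measurable_Pair1'[OF x] f(7)] measurable_compose[OF measurable_Pair2'[OF y] g(7)]
    by simp_all
  have int: "integrable N (\<lambda>z. (f x * g' y) * (f' z * g z))"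
    by (intro integrable_mult_right integrable_mult_square_integrable) (use f g in auto)
  have le: "cmod (F x z * G z y) \<le> (f x * g' y) * (f' z * g z)" if "z \<in> space N" for z
    using mult_mono[OF f(8)[OF x that] g(8)[OF that y]] f(5,6) g(5,6) by (simp add: norm_mult mult_ac)
  show ?thesis
    by (rule Bochner_Integration.integrable_bound[OF int])
       (use le in \<open>auto intro!: AE_I2 intro: order_trans[OF _ abs_ge_self] simp del: abs_mult\<close>)
qed

text \<open>The two inner majorants integrate to a constant, which is absorbed into the outer
  majorant on the right.\<close>

lemma dominated_kernel_comp:
  assumes F: "dominated_kernel M N F" and G: "dominated_kernel N P G" and N: "sigma_finite_measure N"
  shows "dominated_kernel M P (kernel_comp N F G)"
proof -
  interpret N: sigma_finite_measure N by (rule N)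
  obtain f f' where "dominates M N f f' F"
    using F unfolding dominated_kernel_def by blast
  note f = dominatesD[OF this]
  obtain g g' where "dominates N P g g' G"
    using G unfolding dominated_kernel_def by blast
  note g = dominatesD[OF this]
  define I where "I = (LINT z|N. f' z * g z)"
  have fg: "integrable N (\<lambda>z. f' z * g z)"
    by (intro integrable_mult_square_integrable) (use f g in auto)
  have I: "I \<ge> 0" unfolding I_def using f g by (intro integral_nonneg_AE) auto
  have mF: "(\<lambda>p. F (fst (fst p)) (snd p)) \<in> borel_measurable ((M \<Otimes>\<^sub>M P) \<Otimes>\<^sub>M N)"
    using measurable_compose[of "\<lambda>p. (fst (fst p), snd p)" "(M \<Otimes>\<^sub>M P) \<Otimes>\<^sub>M N" "M \<Otimes>\<^sub>M N" "\<lambda>(x, y). F x y" borel] f(7)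
    by simp
  have mG: "(\<lambda>p. G (snd p) (snd (fst p))) \<in> borel_measurable ((M \<Otimes>\<^sub>M P) \<Otimes>\<^sub>M N)"
    using measurable_compose[of "\<lambda>p. (snd p, snd (fst p))" "(M \<Otimes>\<^sub>M P) \<Otimes>\<^sub>M N" "N \<Otimes>\<^sub>M P" "\<lambda>(x, y). G x y" borel] g(7)
    by simp
  have "(\<lambda>q. LINT z|N. F (fst q) z * G z (snd q)) \<in> borel_measurable (M \<Otimes>\<^sub>M P)"
    using borel_measurable_times[OF mF mG]
    by (intro N.borel_measurable_lebesgue_integral) (simp add: split_def)
  then have m: "(\<lambda>(x, y). kernel_comp N F G x y) \<in> borel_measurable (M \<Otimes>\<^sub>M P)"
    by (simp add: kernel_comp_def split_def)
  show ?thesis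
  proof (rule dominated_kernelI[of f M "\<lambda>y. I * g' y" P])
    show "integrable P (\<lambda>y. (I * g' y)\<^sup>2)" using g(4) by (simp add: power_mult_distrib)
    fix x y assume x: "x \<in> space M" and y: "y \<in> space P"
    have "cmod (kernel_comp N F G x y) \<le> (LINT z|N. (f x * g' y) * (f' z * g z))"
      unfolding kernel_comp_def
    proof (rule order_trans[OF integral_norm_bound] , rule integral_mono)
      show "integrable N (\<lambda>z. cmod (F x z * G z y))"
        using kernel_comp_integrable[OF F G x y] by (rule integrable_norm)
      show "integrable N (\<lambda>z. (f x * g' y) * (f' z * g z))" using fg by simp
      fix z assume z: "z \<in> space N"
      show "cmod (F x z * G z y) \<le> (f x * g' y) * (f' z * g z)"
        using mult_mono[OF f(8)[OF x z] g(8)[OF z y]] f(5,6) g(5,6) by (simp add: norm_mult mult_ac)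
    qed
    also have "\<dots> = f x * (I * g' y)" unfolding I_def integral_mult_right_zero by (simp add: mult_ac)
    finally show "cmod (kernel_comp N F G x y) \<le> f x * (I * g' y)" .
  qed (use f g I m in auto)
qed

section \<open>Fredholm's expansion: convergence, Andreief's formula and exchange of two
  factors\<close>

lemma permutes_lessThan: "p permutes {..<n} \<Longrightarrow> p i < n \<longleftrightarrow> i < n"
  using permutes_in_image[of p "{..<n}" i] by simp

lemma mdet_measurable [measurable (raw)]:
  assumes "\<And>i j. i < n \<Longrightarrow> j < n \<Longrightarrow> (\<lambda>w. c w i j) \<in> borel_measurable W"
  shows "(\<lambda>w. mdet n (c w)) \<in> borel_measurable W"
  unfolding mdet_leibniz
  by (intro borel_measurable_sum borel_measurable_times borel_measurable_const borel_measurable_prod)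
     (use assms in \<open>auto simp: permutes_lessThan\<close>)

lemma kernel_component_measurable:
  assumes "(\<lambda>(x, y). K x y) \<in> borel_measurable (M \<Otimes>\<^sub>M N)" "i \<in> I" "j \<in> J"
  shows "(\<lambda>w. K (fst w i) (snd w j)) \<in> borel_measurable (Pi\<^sub>M I (\<lambda>_. M) \<Otimes>\<^sub>M Pi\<^sub>M J (\<lambda>_. N))"
proof -
  have "(\<lambda>w. (fst w i, snd w j)) \<in> measurable (Pi\<^sub>M I (\<lambda>_. M) \<Otimes>\<^sub>M Pi\<^sub>M J (\<lambda>_. N)) (M \<Otimes>\<^sub>M N)"
    using assms(2,3) by measurable
  from measurable_compose[OF this assms(1)] show ?thesis by simp
qed

lemma fredholm_minor_measurable:
  assumes "(\<lambda>(x, y). K x y) \<in> borel_measurable (M \<Otimes>\<^sub>M M)"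
  shows "fredholm_minor K n \<in> borel_measurable (Pi\<^sub>M {..<n} (\<lambda>_. M))"
proof -
  have "(\<lambda>x. K (x i) (x j)) \<in> borel_measurable (Pi\<^sub>M {..<n} (\<lambda>_. M))" if "i < n" "j < n" for i j
  proof -
    have "(\<lambda>x. (x i, x j)) \<in> measurable (Pi\<^sub>M {..<n} (\<lambda>_. M)) (M \<Otimes>\<^sub>M M)"
      using that by (intro measurable_Pair measurable_component_singleton) auto
    from measurable_compose[OF this assms] show ?thesis by simp
  qed
  then show ?thesis unfolding fredholm_minor_mdet by measurable
qed

text \<open>From n^n \<le> e^n n! the quotient n^(n/2) / n! is at most e^n / n^(n/2), which decays
  faster than any geometric sequence.\<close>

lemma fredholm_bound_summable:
  fixes m :: real
  assumes "m \<ge> 0"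
  shows "summable (\<lambda>n. sqrt (real n ^ n) / fact n * m ^ n)"
proof (rule summable_comparison_test_ev)
  show "summable (\<lambda>n. (1 / 2 :: real) ^ n)" by simp
  \<comment> \<open>Beyond this threshold sqrt n \<ge> 2 m e, so that the terms fall below 2^(-n);
    the summand 1 makes n positive.\<close>
  have "eventually (\<lambda>n::nat. real n \<ge> (2 * m * exp 1)\<^sup>2 + 1) sequentially"
    using filterlim_real_sequentially unfolding filterlim_at_top by blast
  then show "eventually (\<lambda>n. norm (sqrt (real n ^ n) / fact n * m ^ n) \<le> (1 / 2) ^ n) sequentially"
  proof eventually_elim
    case (elim n)
    have n: "real n > 0" using elim by (smt (verit) zero_le_power2)
    have "real n ^ n / fact n \<le> exp (real n)"
    proof -
      have "(\<Sum>k\<in>{n}. real n ^ k /\<^sub>R fact k) \<le> (\<Sum>k. real n ^ k /\<^sub>R fact k)"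
        by (rule sum_le_suminf) (use summable_exp[of "real n"] in auto)
      then show ?thesis by (simp add: exp_def field_simps)
    qed
    then have e: "real n ^ n \<le> exp 1 ^ n * fact n"
      by (simp add: field_simps exp_of_nat_mult[symmetric] flip: exp_of_nat_mult)
    have s: "2 * m * exp 1 \<le> sqrt (real n)" using elim assms by (intro real_le_rsqrt) auto
    have "sqrt (real n ^ n) * sqrt (real n) ^ n = real n ^ n"
      using n by (simp add: real_sqrt_power flip: power_mult_distrib)
    then have "sqrt (real n ^ n) * sqrt (real n) ^ n \<le> exp 1 ^ n * fact n" using e by simp
    moreover have "(2 * m * exp 1) ^ n \<le> sqrt (real n) ^ n" using s assms by (intro power_mono) auto
    ultimately have "sqrt (real n ^ n) * (2 * m * exp 1) ^ n \<le> exp 1 ^ n * fact n"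
      using n by (meson mult_left_mono order_trans real_sqrt_ge_zero zero_le_power of_nat_0_le_iff)
    then have "(sqrt (real n ^ n) * (2 * m) ^ n) * exp 1 ^ n \<le> fact n * exp 1 ^ n"
      by (simp add: power_mult_distrib mult_ac)
    then have "sqrt (real n ^ n) * (2 * m) ^ n \<le> fact n" by (rule mult_right_le_imp_le) simp
    then have "sqrt (real n ^ n) / fact n * m ^ n \<le> (1 / 2) ^ n"
      by (simp add: power_mult_distrib power_one_over field_simps)
    then show ?case using assms n by simp
  qed
qed

text \<open>By Hadamard's inequality the n-th minor is at most n^(n/2) times the product of the f (x
  i) g (x i), whose integral is the n-th power of the integral of f g.\<close>

lemma fredholm_det_exists_dominated:
  assumes M: "sigma_finite_measure M" and K: "dominated_kernel M M K"
  shows "fredholm_det_exists M K"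
proof -
  interpret P: product_sigma_finite "\<lambda>_::nat. M" by (simp add: product_sigma_finite_def M)
  obtain f g where "dominates M M f g K"
    using K unfolding dominated_kernel_def by blast
  note * = dominatesD[OF this]
  have fg: "integrable M (\<lambda>z. f z * g z)"
    by (intro integrable_mult_square_integrable) (use * in auto)
  have b: "cmod (fredholm_minor K n x) \<le> sqrt (real n ^ n) * (\<Prod>i<n. f (x i) * g (x i))"
    if "x \<in> space (Pi\<^sub>M {..<n} (\<lambda>_. M))" for n x
    unfolding fredholm_minor_mdet prod.distrib
    by (rule mdet_hadamard) (use that * in \<open>auto simp: space_PiM PiE_iff\<close>)
  have pi: "integrable (Pi\<^sub>M {..<n} (\<lambda>_. M)) (\<lambda>x. sqrt (real n ^ n) * (\<Prod>i<n. f (x i) * g (x i)))" for n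
    using fg by (intro integrable_mult_right P.product_integrable_prod) auto
  have int: "integrable (Pi\<^sub>M {..<n} (\<lambda>_. M)) (fredholm_minor K n)" for n
    by (rule Bochner_Integration.integrable_bound[OF pi[of n] fredholm_minor_measurable[OF *(7)]])
       (use b in \<open>auto intro!: AE_I2 intro: order_trans[OF _ abs_ge_self] simp del: abs_mult\<close>)
  have "cmod (LINT x|Pi\<^sub>M {..<n} (\<lambda>_. M). fredholm_minor K n x) \<le> sqrt (real n ^ n) * (LINT z|M. f z * g z) ^ n" for n
  proof -
    have "cmod (LINT x|Pi\<^sub>M {..<n} (\<lambda>_. M). fredholm_minor K n x)
        \<le> (LINT x|Pi\<^sub>M {..<n} (\<lambda>_. M). sqrt (real n ^ n) * (\<Prod>i<n. f (x i) * g (x i)))"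
      by (rule order_trans[OF integral_norm_bound], rule integral_mono[OF integrable_norm[OF int] pi b])
    also have "\<dots> = sqrt (real n ^ n) * (LINT z|M. f z * g z) ^ n"
      using P.product_integral_prod[of "{..<n}" "\<lambda>_ z. f z * g z"] fg by simp
    finally show ?thesis .
  qed
  then have "cmod (fredholm_coeff M K n) \<le> sqrt (real n ^ n) / fact n * (LINT z|M. f z * g z) ^ n" for n
    unfolding fredholm_coeff_def by (simp add: norm_mult norm_divide norm_power field_simps)
  moreover have "summable (\<lambda>n. sqrt (real n ^ n) / fact n * (LINT z|M. f z * g z) ^ n)"
    by (rule fredholm_bound_summable) (use * in \<open>auto intro!: integral_nonneg_AE\<close>)
  ultimately have "summable (fredholm_coeff M K)"
    by (intro summable_comparison_test[of "fredholm_coeff M K"]) auto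
  then show ?thesis unfolding fredholm_det_exists_def using int by blast
qed

text \<open>Both determinants are expanded over permutations p and q acting on the row indices, the
  first one after transposition. Each pair integrates to the product of the C (p k) (q k). The sum
  over q is the determinant of C with rows permuted by p; its sign cancels that of p, and all n!
  choices of p contribute det C.\<close>

lemma andreief:
  fixes F G :: "nat \<Rightarrow> 'z \<Rightarrow> complex"
  assumes Z: "sigma_finite_measure Z"
    and int: "\<And>i j. i < n \<Longrightarrow> j < n \<Longrightarrow> integrable Z (\<lambda>z. F i z * G j z)"
  shows "(LINT z|Pi\<^sub>M {..<n} (\<lambda>_. Z). mdet n (\<lambda>i k. F i (z k)) * mdet n (\<lambda>k j. G j (z k)))
       = fact n * mdet n (\<lambda>i j. LINT z|Z. F i z * G j z)"
proof -
  interpret P: product_sigma_finite "\<lambda>_::nat. Z" by (simp add: product_sigma_finite_def Z)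
  let ?P = "{p. p permutes {..<n}}"
  let ?s = "\<lambda>p. complex_of_int (sign p)"
  define C where "C i j = (LINT z|Z. F i z * G j z)" for i j
  have eq: "mdet n (\<lambda>i k. F i (z k)) * mdet n (\<lambda>k j. G j (z k))
      = (\<Sum>p\<in>?P. \<Sum>q\<in>?P. ?s p * ?s q * (\<Prod>k<n. F (p k) (z k) * G (q k) (z k)))" for z :: "nat \<Rightarrow> 'z"
    unfolding mdet_transpose[of n "\<lambda>i k. F i (z k)", symmetric]
    unfolding mdet_leibniz sum_product prod.distrib by (simp add: mult_ac)
  have i1: "integrable (Pi\<^sub>M {..<n} (\<lambda>_. Z)) (\<lambda>z. \<Prod>k<n. F (p k) (z k) * G (q k) (z k))"
    and i2: "(LINT z|Pi\<^sub>M {..<n} (\<lambda>_. Z). (\<Prod>k<n. F (p k) (z k) * G (q k) (z k))) = (\<Prod>k<n. C (p k) (q k))"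
    if "p \<in> ?P" "q \<in> ?P" for p q
  proof -
    have "integrable Z (\<lambda>z. F (p k) z * G (q k) z)" if "k \<in> {..<n}" for k
      using int that \<open>p \<in> ?P\<close> \<open>q \<in> ?P\<close> permutes_in_image[of p "{..<n}" k] permutes_in_image[of q "{..<n}" k] by auto
    then show "integrable (Pi\<^sub>M {..<n} (\<lambda>_. Z)) (\<lambda>z. \<Prod>k<n. F (p k) (z k) * G (q k) (z k))"
      and "(LINT z|Pi\<^sub>M {..<n} (\<lambda>_. Z). (\<Prod>k<n. F (p k) (z k) * G (q k) (z k))) = (\<Prod>k<n. C (p k) (q k))"
      using P.product_integrable_prod[of "{..<n}" "\<lambda>k z. F (p k) z * G (q k) z"]
        P.product_integral_prod[of "{..<n}" "\<lambda>k z. F (p k) z * G (q k) z"] by (auto simp: C_def)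
  qed
  have "(LINT z|Pi\<^sub>M {..<n} (\<lambda>_. Z). mdet n (\<lambda>i k. F i (z k)) * mdet n (\<lambda>k j. G j (z k)))
      = (\<Sum>p\<in>?P. \<Sum>q\<in>?P. ?s p * ?s q * (\<Prod>k<n. C (p k) (q k)))"
    unfolding eq
    by (subst Bochner_Integration.integral_sum,
        (intro Bochner_Integration.integrable_sum integrable_mult_right i1; assumption),
        intro sum.cong refl, subst Bochner_Integration.integral_sum,
        (intro integrable_mult_right i1; assumption),
        intro sum.cong refl, simp only: integral_mult_right_zero i2)
  also have "\<dots> = (\<Sum>p\<in>?P. ?s p * mdet n (\<lambda>k j. C (p k) j))"
    unfolding mdet_leibniz sum_distrib_left by (simp add: mult_ac)
  also have "\<dots> = (\<Sum>p\<in>?P. mdet n C)"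
    by (intro sum.cong refl) (simp add: mdet_permute_rows sign_def)
  also have "\<dots> = fact n * mdet n C" by (simp add: card_permutations)
  finally show ?thesis by (simp add: C_def[abs_def])
qed

lemma integrable_pair_mult:
  fixes u :: "'a \<Rightarrow> real" and v :: "'b \<Rightarrow> real"
  assumes "sigma_finite_measure A" "sigma_finite_measure B" "integrable A u" "integrable B v"
  shows "integrable (A \<Otimes>\<^sub>M B) (\<lambda>w. u (fst w) * v (snd w))"
proof -
  interpret A: sigma_finite_measure A by fact
  interpret B: sigma_finite_measure B by fact
  interpret pair_sigma_finite A B ..
  have [measurable]: "u \<in> borel_measurable A" "v \<in> borel_measurable B" using assms by auto
  show ?thesis using assms(3,4) by (intro Fubini_integrable) (auto simp: abs_mult)
qed

text \<open>Both sides are (-1)^n / (n!)^2 times the integral of \<open>h x z\<close> over all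
  n-tuples x and z: integrating out z first gives the minors of F G, integrating out x first those
  of G F, in both cases by \<open>andreief\<close>. Hadamard's inequality for each of the two
  determinants in \<open>h\<close> makes the double integral absolutely convergent.\<close>

lemma fredholm_coeff_swap:
  assumes M: "sigma_finite_measure M" and Z: "sigma_finite_measure Z"
    and F: "dominated_kernel M Z F" and G: "dominated_kernel Z M G"
  shows "fredholm_coeff M (kernel_comp Z F G) n = fredholm_coeff Z (kernel_comp M G F) n"
proof -
  interpret PM: product_sigma_finite "\<lambda>_::nat. M" by (simp add: product_sigma_finite_def M)
  interpret PZ: product_sigma_finite "\<lambda>_::nat. Z" by (simp add: product_sigma_finite_def Z)
  let ?M = "Pi\<^sub>M {..<n} (\<lambda>_. M)" and ?Z = "Pi\<^sub>M {..<n} (\<lambda>_. Z)"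
  have sM: "sigma_finite_measure ?M" and sZ: "sigma_finite_measure ?Z"
    by (simp_all add: PM.sigma_finite PZ.sigma_finite)
  interpret pair_sigma_finite ?M ?Z using sM sZ by (rule pair_sigma_finite.intro)
  obtain f f' where "dominates M Z f f' F"
    using F unfolding dominated_kernel_def by blast
  note f = dominatesD[OF this]
  obtain g g' where "dominates Z M g g' G"
    using G unfolding dominated_kernel_def by blast
  note g = dominatesD[OF this]
  define h where "h x z = mdet n (\<lambda>i k. F (x i) (z k)) * mdet n (\<lambda>k j. G (z k) (x j))" for x z
  define c where "c = sqrt (real n ^ n)"
  have c: "c \<ge> 0" by (simp add: c_def)
  have hint: "integrable (?M \<Otimes>\<^sub>M ?Z) (\<lambda>(x, z). h x z)"
  proof (rule Bochner_Integration.integrable_bound)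
    show "integrable (?M \<Otimes>\<^sub>M ?Z) (\<lambda>w. (c\<^sup>2 * (\<Prod>i<n. f (fst w i) * g' (fst w i))) * (\<Prod>i<n. f' (snd w i) * g (snd w i)))"
    proof (rule integrable_pair_mult[OF sM sZ])
      show "integrable ?M (\<lambda>x. c\<^sup>2 * (\<Prod>i<n. f (x i) * g' (x i)))"
        by (intro integrable_mult_right PM.product_integrable_prod integrable_mult_square_integrable) (use f g in auto)
      show "integrable ?Z (\<lambda>x. (\<Prod>i<n. f' (x i) * g (x i)))"
        by (intro PZ.product_integrable_prod integrable_mult_square_integrable) (use f g in auto)
    qed
    have "(\<lambda>w. mdet n (\<lambda>i k. F (fst w i) (snd w k))) \<in> borel_measurable (?M \<Otimes>\<^sub>M ?Z)"
      by (intro mdet_measurable kernel_component_measurable[OF f(7)]) auto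
    moreover have "(\<lambda>w. mdet n (\<lambda>k j. G (snd w k) (fst w j))) \<in> borel_measurable (?M \<Otimes>\<^sub>M ?Z)"
    proof (intro mdet_measurable)
      fix i j assume "i < n" "j < n"
      then have "i \<in> {..<n}" "j \<in> {..<n}" by simp_all
      then have "(\<lambda>w. (snd w i, fst w j)) \<in> measurable (?M \<Otimes>\<^sub>M ?Z) (Z \<Otimes>\<^sub>M M)" by measurable
      from measurable_compose[OF this g(7)]
      show "(\<lambda>w. G (snd w i) (fst w j)) \<in> borel_measurable (?M \<Otimes>\<^sub>M ?Z)" by simp
    qed
    ultimately show "(\<lambda>(x, z). h x z) \<in> borel_measurable (?M \<Otimes>\<^sub>M ?Z)"
      unfolding h_def split_def by (rule borel_measurable_times)
    have "cmod (h x z) \<le> (c\<^sup>2 * (\<Prod>i<n. f (x i) * g' (x i))) * (\<Prod>i<n. f' (z i) * g (z i))"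
      if x: "x \<in> space ?M" and z: "z \<in> space ?Z" for x z
    proof -
      have "cmod (h x z) \<le> (c * ((\<Prod>i<n. f (x i)) * (\<Prod>i<n. f' (z i)))) * (c * ((\<Prod>i<n. g (z i)) * (\<Prod>i<n. g' (x i))))"
        unfolding h_def norm_mult c_def
        by (intro mult_mono mdet_hadamard) (use x z f g in \<open>auto simp: space_PiM PiE_iff intro!: mult_nonneg_nonneg prod_nonneg\<close>)
      also have "\<dots> = (c\<^sup>2 * (\<Prod>i<n. f (x i) * g' (x i))) * (\<Prod>i<n. f' (z i) * g (z i))"
        by (simp add: prod.distrib power2_eq_square mult_ac)
      finally show ?thesis .
    qed
    then show "AE w in ?M \<Otimes>\<^sub>M ?Z. norm (case w of (x, z) \<Rightarrow> h x z)
        \<le> norm ((c\<^sup>2 * (\<Prod>i<n. f (fst w i) * g' (fst w i))) * (\<Prod>i<n. f' (snd w i) * g (snd w i)))"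
      by (intro AE_I2) (auto simp: space_pair_measure intro: order_trans[OF _ abs_ge_self])
  qed
  have inner1: "(LINT z|?Z. h x z) = fact n * fredholm_minor (kernel_comp Z F G) n x" if x: "x \<in> space ?M" for x
    unfolding h_def fredholm_minor_mdet kernel_comp_def
    by (rule andreief[OF Z], rule kernel_comp_integrable[OF F G]) (use x in \<open>auto simp: space_PiM PiE_iff\<close>)
  have h': "h x z = mdet n (\<lambda>k j. G (z k) (x j)) * mdet n (\<lambda>i k. F (x i) (z k))" for x z
    by (simp add: h_def mult.commute)
  have inner2: "(LINT x|?M. h x z) = fact n * fredholm_minor (kernel_comp M G F) n z" if z: "z \<in> space ?Z" for z
    unfolding h' fredholm_minor_mdet kernel_comp_def
    by (rule andreief[OF M], rule kernel_comp_integrable[OF G F]) (use z in \<open>auto simp: space_PiM PiE_iff\<close>)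
  have "fact n * (LINT x|?M. fredholm_minor (kernel_comp Z F G) n x) = (LINT x|?M. LINT z|?Z. h x z)"
    unfolding integral_mult_right_zero[symmetric] by (rule Bochner_Integration.integral_cong) (auto simp: inner1)
  also have "\<dots> = (LINT z|?Z. LINT x|?M. h x z)" using Fubini_integral[OF hint] by simp
  also have "\<dots> = fact n * (LINT x|?Z. fredholm_minor (kernel_comp M G F) n x)"
    unfolding integral_mult_right_zero[symmetric] by (rule Bochner_Integration.integral_cong) (auto simp: inner2)
  finally show ?thesis unfolding fredholm_coeff_def by simp
qed

section \<open>Square-integrable functions\<close>

lemma borel_measurable_cnj [measurable (raw)]:
  "f \<in> borel_measurable M \<Longrightarrow> (\<lambda>x. cnj (f x)) \<in> borel_measurable M"
  by (rule measurable_compose[OF _ borel_measurable_continuous_onI[OF continuous_on_cnj[OF continuous_on_id]]])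

lemma l2D:
  assumes "h \<in> l2 M"
  shows "h \<in> borel_measurable M" "integrable M (\<lambda>x. (cmod (h x))\<^sup>2)"
  using assms by (auto simp: l2_def)

lemma l2_norm_mult_integrable:
  assumes "g \<in> l2 M" "h \<in> l2 M"
  shows "integrable M (\<lambda>x. cmod (g x) * cmod (h x))"
  by (intro integrable_mult_square_integrable) (use assms in \<open>auto simp: l2_def\<close>)

lemma l2_inner_integrable:
  assumes "g \<in> l2 M" "h \<in> l2 M"
  shows "integrable M (\<lambda>x. cnj (g x) * h x)"
proof (rule Bochner_Integration.integrable_bound[OF l2_norm_mult_integrable[OF assms]])
  have [measurable]: "g \<in> borel_measurable M" "h \<in> borel_measurable M" using assms by (auto simp: l2_def)
  show "(\<lambda>x. cnj (g x) * h x) \<in> borel_measurable M" by measurable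
qed (simp add: norm_mult)

lemma l2_lincomb:
  assumes "g \<in> l2 M" "h \<in> l2 M"
  shows "(\<lambda>x. c * g x + h x) \<in> l2 M"
proof -
  have [measurable]: "g \<in> borel_measurable M" "h \<in> borel_measurable M" using assms by (auto simp: l2_def)
  have "integrable M (\<lambda>x. (cmod (c * g x + h x))\<^sup>2)"
  proof (rule Bochner_Integration.integrable_bound)
    show "integrable M (\<lambda>x. 2 * (cmod c)\<^sup>2 * (cmod (g x))\<^sup>2 + 2 * (cmod (h x))\<^sup>2)"
      using assms by (auto simp: l2_def)
    have le: "(cmod (a + b))\<^sup>2 \<le> 2 * (cmod a)\<^sup>2 + 2 * (cmod b)\<^sup>2" for a b
    proof -
      have "(cmod (a + b))\<^sup>2 \<le> (cmod a + cmod b)\<^sup>2" by (intro power_mono norm_triangle_ineq) simp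
      also have "\<dots> \<le> 2 * (cmod a)\<^sup>2 + 2 * (cmod b)\<^sup>2"
        using sum_squares_bound[of "cmod a" "cmod b"] by (simp add: power2_sum)
      finally show ?thesis .
    qed
    show "AE x in M. norm ((cmod (c * g x + h x))\<^sup>2) \<le> norm (2 * (cmod c)\<^sup>2 * (cmod (g x))\<^sup>2 + 2 * (cmod (h x))\<^sup>2)"
    proof (rule AE_I2)
      fix x
      show "norm ((cmod (c * g x + h x))\<^sup>2) \<le> norm (2 * (cmod c)\<^sup>2 * (cmod (g x))\<^sup>2 + 2 * (cmod (h x))\<^sup>2)"
        using le[of "c * g x" "h x"] by (simp add: norm_mult power_mult_distrib)
    qed
  qed measurable
  then show ?thesis by (simp add: l2_def)
qed

lemma l2_zero: "(\<lambda>x. 0) \<in> l2 M"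
  by (simp add: l2_def)

lemma l2_scale: "h \<in> l2 M \<Longrightarrow> (\<lambda>x. c * h x) \<in> l2 M"
  using l2_lincomb[OF _ l2_zero] by simp

lemma l2_diff: "g \<in> l2 M \<Longrightarrow> h \<in> l2 M \<Longrightarrow> (\<lambda>x. g x - h x) \<in> l2 M"
  using l2_lincomb[of h M g "-1"] by (simp add: algebra_simps)

lemma l2_sum:
  assumes "finite I" "\<And>i. i \<in> I \<Longrightarrow> u i \<in> l2 M"
  shows "(\<lambda>x. \<Sum>i\<in>I. c i * u i x) \<in> l2 M"
  using assms
proof (induction I)
  case (insert i I)
  then show ?case using l2_lincomb[of "u i" M "\<lambda>x. \<Sum>i\<in>I. c i * u i x" "c i"] by simp
qed (simp add: l2_zero)

lemma l2_inner_cong_AE: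
  assumes "g \<in> l2 M" "g' \<in> l2 M" "h \<in> l2 M" "h' \<in> l2 M"
    "AE x in M. g x = g' x" "AE x in M. h x = h' x"
  shows "l2_inner M g h = l2_inner M g' h'"
  unfolding l2_inner_def
  by (rule integral_cong_AE) (use assms in \<open>auto dest: l2D l2_inner_integrable\<close>)

lemma l2_inner_cnj: "cnj (l2_inner M g h) = l2_inner M h g"
  unfolding l2_inner_def by (subst Bochner_Integration.integral_cnj[symmetric]) (simp add: mult.commute)

lemma l2_inner_right:
  assumes "u \<in> l2 M" "g \<in> l2 M" "h \<in> l2 M"
  shows "l2_inner M u (\<lambda>x. c * g x + h x) = c * l2_inner M u g + l2_inner M u h"
proof -
  have "l2_inner M u (\<lambda>x. c * g x + h x) = (LINT x|M. c * (cnj (u x) * g x) + cnj (u x) * h x)"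
    unfolding l2_inner_def by (intro Bochner_Integration.integral_cong) (auto simp: algebra_simps)
  then show ?thesis using assms by (simp add: l2_inner_def l2_inner_integrable)
qed

lemma l2_inner_left:
  assumes "u \<in> l2 M" "g \<in> l2 M" "h \<in> l2 M"
  shows "l2_inner M (\<lambda>x. c * g x + h x) u = cnj c * l2_inner M g u + l2_inner M h u"
proof -
  have "l2_inner M (\<lambda>x. c * g x + h x) u = cnj (l2_inner M u (\<lambda>x. c * g x + h x))"
    by (rule l2_inner_cnj[symmetric])
  then show ?thesis unfolding l2_inner_right[OF assms] by (simp add: l2_inner_cnj)
qed

lemma l2_inner_zero [simp]: "l2_inner M u (\<lambda>x. 0) = 0" "l2_inner M (\<lambda>x. 0) u = 0"
  by (simp_all add: l2_inner_def)

lemma l2_inner_scale_right: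
  "u \<in> l2 M \<Longrightarrow> h \<in> l2 M \<Longrightarrow> l2_inner M u (\<lambda>x. c * h x) = c * l2_inner M u h"
  by (simp add: l2_inner_def mult.left_commute)

lemma l2_inner_scale_left:
  "u \<in> l2 M \<Longrightarrow> h \<in> l2 M \<Longrightarrow> l2_inner M (\<lambda>x. c * h x) u = cnj c * l2_inner M h u"
  by (simp add: l2_inner_def mult.assoc)

lemma l2_inner_diff_right:
  assumes "u \<in> l2 M" "g \<in> l2 M" "h \<in> l2 M"
  shows "l2_inner M u (\<lambda>x. g x - h x) = l2_inner M u g - l2_inner M u h"
  using l2_inner_right[OF assms(1,3,2), of "-1"] by (simp add: algebra_simps)

lemma l2_inner_diff_left:
  assumes "u \<in> l2 M" "g \<in> l2 M" "h \<in> l2 M"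
  shows "l2_inner M (\<lambda>x. g x - h x) u = l2_inner M g u - l2_inner M h u"
  using l2_inner_left[OF assms(1,3,2), of "-1"] by (simp add: algebra_simps)

lemma l2_inner_sum_right:
  assumes "finite I" "\<And>i. i \<in> I \<Longrightarrow> u i \<in> l2 M" "v \<in> l2 M"
  shows "l2_inner M v (\<lambda>x. \<Sum>i\<in>I. c i * u i x) = (\<Sum>i\<in>I. c i * l2_inner M v (u i))"
  using assms
proof (induction I)
  case (insert i I)
  then show ?case using l2_inner_right[of v M "u i" "\<lambda>x. \<Sum>i\<in>I. c i * u i x" "c i"] by (simp add: l2_sum)
qed simp

lemma l2_inner_sum_left:
  assumes "finite I" "\<And>i. i \<in> I \<Longrightarrow> u i \<in> l2 M" "v \<in> l2 M"
  shows "l2_inner M (\<lambda>x. \<Sum>i\<in>I. c i * u i x) v = (\<Sum>i\<in>I. cnj (c i) * l2_inner M (u i) v)"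
proof -
  have "l2_inner M (\<lambda>x. \<Sum>i\<in>I. c i * u i x) v = cnj (l2_inner M v (\<lambda>x. \<Sum>i\<in>I. c i * u i x))"
    by (rule l2_inner_cnj[symmetric])
  also have "\<dots> = cnj (\<Sum>i\<in>I. c i * l2_inner M v (u i))"
    by (subst l2_inner_sum_right[OF assms]) auto
  finally show ?thesis by (simp add: l2_inner_cnj)
qed

lemma l2_inner_self: "l2_inner M h h = of_real ((l2_norm M h)\<^sup>2)"
proof -
  have "l2_inner M h h = (LINT x|M. complex_of_real ((cmod (h x))\<^sup>2))"
    unfolding l2_inner_def by (intro Bochner_Integration.integral_cong refl) (simp only: complex_norm_square mult.commute)
  also have "\<dots> = of_real (LINT x|M. (cmod (h x))\<^sup>2)" by (rule integral_complex_of_real)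
  finally show ?thesis by (simp add: l2_norm_def)
qed

lemma l2_norm_nonneg [simp]: "0 \<le> l2_norm M h"
  by (simp add: l2_norm_def)

lemma l2_norm_eq_0:
  assumes "h \<in> l2 M" "l2_norm M h = 0"
  shows "AE x in M. h x = 0"
proof -
  have "(LINT x|M. (cmod (h x))\<^sup>2) = 0" using assms(2) by (simp add: l2_norm_def)
  then have "AE x in M. (cmod (h x))\<^sup>2 = 0"
    using integral_nonneg_eq_0_iff_AE[of M "\<lambda>x. (cmod (h x))\<^sup>2"] l2D[OF assms(1)] by simp
  then show ?thesis by simp
qed

section \<open>The Cauchy-Schwarz inequality, completeness, and Bessel's inequality\<close>

lemma l2_cauchy_schwarz_norm:
  assumes g: "g \<in> l2 M" and h: "h \<in> l2 M"
  shows "(LINT x|M. cmod (g x) * cmod (h x)) \<le> l2_norm M g * l2_norm M h"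
proof -
  define a b L where "a = l2_norm M g" "b = l2_norm M h" "L = (LINT x|M. cmod (g x) * cmod (h x))"
  have a2: "a\<^sup>2 = (LINT x|M. (cmod (g x))\<^sup>2)" and b2: "b\<^sup>2 = (LINT x|M. (cmod (h x))\<^sup>2)"
    by (simp_all add: a_b_L_def l2_norm_def)
  have ab: "a \<ge> 0" "b \<ge> 0" by (simp_all add: a_b_L_def)
  have key: "2 * L \<le> t * a\<^sup>2 + b\<^sup>2 / t" if "t > 0" for t
  proof -
    have "2 * L = (LINT x|M. 2 * (cmod (g x) * cmod (h x)))" by (simp add: a_b_L_def)
    also have "\<dots> \<le> (LINT x|M. t * (cmod (g x))\<^sup>2 + (cmod (h x))\<^sup>2 / t)"
    proof (rule integral_mono)
      show "integrable M (\<lambda>x. 2 * (cmod (g x) * cmod (h x)))" using l2_norm_mult_integrable[OF g h] by simp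
      show "integrable M (\<lambda>x. t * (cmod (g x))\<^sup>2 + (cmod (h x))\<^sup>2 / t)" using g h by (auto simp: l2_def)
      fix x
      have "0 \<le> (t * cmod (g x) - cmod (h x))\<^sup>2 / t" using that by simp
      also have "\<dots> = t * (cmod (g x))\<^sup>2 - 2 * (cmod (g x) * cmod (h x)) + (cmod (h x))\<^sup>2 / t"
        using that by (simp add: power2_diff field_simps power2_eq_square)
      finally show "2 * (cmod (g x) * cmod (h x)) \<le> t * (cmod (g x))\<^sup>2 + (cmod (h x))\<^sup>2 / t" by simp
    qed
    also have "\<dots> = t * a\<^sup>2 + b\<^sup>2 / t" using g h by (simp add: l2_def a2 b2)
    finally show ?thesis .
  qed
  \<comment> \<open>The optimal weight t = b / a in \<open>key\<close> is undefined or zero when a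
    norm vanishes; both norms are therefore shifted by e, which tends to 0 afterwards.\<close>
  have eps: "L \<le> (a + e) * (b + e)" if e: "e > 0" for e
  proof -
    have "2 * L \<le> (b + e) / (a + e) * a\<^sup>2 + b\<^sup>2 / ((b + e) / (a + e))" using ab e by (intro key) auto
    also have "(b + e) / (a + e) * a\<^sup>2 \<le> (b + e) / (a + e) * (a + e)\<^sup>2"
      using ab e by (intro mult_left_mono power_mono) auto
    also have "b\<^sup>2 / ((b + e) / (a + e)) \<le> (b + e)\<^sup>2 / ((b + e) / (a + e))"
      using ab e by (intro divide_right_mono power_mono) auto
    also have "(b + e) / (a + e) * (a + e)\<^sup>2 + (b + e)\<^sup>2 / ((b + e) / (a + e)) = 2 * ((a + e) * (b + e))"
      using ab e by (simp add: power2_eq_square)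
    finally show ?thesis by simp
  qed
  have "((\<lambda>e. (a + e) * (b + e)) \<longlongrightarrow> (a + 0) * (b + 0)) (at_right 0)" by (intro tendsto_intros)
  then have "L \<le> (a + 0) * (b + 0)"
    by (rule tendsto_lowerbound) (auto simp: eventually_at_filter eps)
  then show ?thesis by (simp add: a_b_L_def)
qed

lemma l2_cauchy_schwarz:
  assumes "g \<in> l2 M" "h \<in> l2 M"
  shows "cmod (l2_inner M g h) \<le> l2_norm M g * l2_norm M h"
  using integral_norm_bound[of M "\<lambda>x. cnj (g x) * h x"] l2_cauchy_schwarz_norm[OF assms]
  by (simp add: l2_inner_def norm_mult)

lemma l2_eq_weak:
  assumes "f \<in> l2 M" "g \<in> l2 M" "\<And>u. u \<in> l2 M \<Longrightarrow> l2_inner M u f = l2_inner M u g"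
  shows "AE x in M. f x = g x"
proof -
  define r where "r = (\<lambda>x. f x - g x)"
  have r: "r \<in> l2 M" unfolding r_def using assms by (intro l2_diff)
  have "l2_inner M r r = 0"
    using assms(3)[OF r] l2_inner_diff_right[OF r assms(1,2)] by (simp add: r_def)
  then have "l2_norm M r = 0" by (simp add: l2_inner_self)
  from l2_norm_eq_0[OF r this] show ?thesis by (simp add: r_def)
qed

lemma l2_norm_scale: "l2_norm M (\<lambda>x. c * h x) = cmod c * l2_norm M h"
  by (simp add: l2_norm_def norm_mult power_mult_distrib real_sqrt_mult)

text \<open>Completeness in the weak form in which it is used later. The partial sums
  \<open>W n\<close> of the moduli have norm at most \<open>B\<close>, so by monotone convergence
  they are bounded at almost every point; there the series converges absolutely, and the bound
  dominates its sum.\<close>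

lemma l2_series:
  assumes u: "\<And>k. u k \<in> l2 M" and S: "summable (\<lambda>k. l2_norm M (u k))"
  obtains s where "s \<in> l2 M" "\<And>g. g \<in> l2 M \<Longrightarrow> (\<lambda>k. l2_inner M g (u k)) sums l2_inner M g s"
proof -
  have [measurable]: "u k \<in> borel_measurable M" for k using u by (auto dest: l2D)
  define B where "B = (\<Sum>k. l2_norm M (u k))"
  define W where "W n x = (\<Sum>k<n. cmod (u k x))" for n x
  have W0: "0 \<le> W n x" for n x by (auto simp: W_def intro: sum_nonneg)
  have [measurable]: "W n \<in> borel_measurable M" for n unfolding W_def by measurable
  have W2: "(W n x)\<^sup>2 = (\<Sum>i<n. \<Sum>j<n. cmod (u i x) * cmod (u j x))" for n x
    by (simp add: W_def power2_eq_square sum_product)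
  have Wint: "integrable M (\<lambda>x. (W n x)\<^sup>2)" for n
    unfolding W2 by (intro Bochner_Integration.integrable_sum l2_norm_mult_integrable u)
  have WB: "(LINT x|M. (W n x)\<^sup>2) \<le> B\<^sup>2" for n
  proof -
    have "(LINT x|M. (W n x)\<^sup>2) = (\<Sum>i<n. \<Sum>j<n. LINT x|M. cmod (u i x) * cmod (u j x))"
      unfolding W2 by (simp add: l2_norm_mult_integrable u)
    also have "\<dots> \<le> (\<Sum>i<n. \<Sum>j<n. l2_norm M (u i) * l2_norm M (u j))"
      by (intro sum_mono l2_cauchy_schwarz_norm u)
    also have "\<dots> = (\<Sum>i<n. l2_norm M (u i))\<^sup>2" by (simp add: power2_eq_square sum_product)
    also have "\<dots> \<le> B\<^sup>2" unfolding B_def by (intro power_mono sum_le_suminf S) (auto intro: sum_nonneg)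
    finally show ?thesis .
  qed
  have nnW: "(\<integral>\<^sup>+ x. ennreal ((W n x)\<^sup>2) \<partial>M) \<le> ennreal (B\<^sup>2)" for n
    using WB[of n] by (subst nn_integral_eq_integral[OF Wint]) (auto intro: ennreal_leI)
  define V where "V x = (SUP n. ennreal ((W n x)\<^sup>2))" for x
  have [measurable]: "V \<in> borel_measurable M" unfolding V_def by measurable
  have "incseq (\<lambda>n x. ennreal ((W n x)\<^sup>2))"
    by (intro incseq_SucI le_funI ennreal_leI power_mono W0) (simp add: W_def)
  then have "(\<integral>\<^sup>+ x. V x \<partial>M) = (SUP n. \<integral>\<^sup>+ x. ennreal ((W n x)\<^sup>2) \<partial>M)"
    unfolding V_def by (intro nn_integral_monotone_convergence_SUP) auto
  also have "\<dots> \<le> ennreal (B\<^sup>2)" by (intro SUP_least nnW)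
  finally have V: "(\<integral>\<^sup>+ x. V x \<partial>M) \<le> ennreal (B\<^sup>2)" .
  then have "(\<integral>\<^sup>+ x. V x \<partial>M) \<noteq> \<infinity>" using ennreal_less_top[of "B\<^sup>2"] by (auto simp: top_unique)
  then have AEV: "AE x in M. V x \<noteq> \<infinity>" by (intro nn_integral_PInf_AE) auto
  have partial_le: "(\<Sum>k<n. cmod (u k x)) \<le> sqrt (enn2real (V x))" if "V x \<noteq> \<infinity>" for n x
  proof -
    have "ennreal ((W n x)\<^sup>2) \<le> V x" unfolding V_def by (rule SUP_upper) simp
    then have "(W n x)\<^sup>2 \<le> enn2real (V x)" using that by (cases "V x") (auto simp: top_ennreal_def)
    then show ?thesis by (simp add: W_def real_le_rsqrt)
  qed
  have summ: "summable (\<lambda>k. cmod (u k x))" if "V x \<noteq> \<infinity>" for x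
    by (rule summableI_nonneg_bounded[OF _ partial_le[OF that]]) simp
  define s where "s x = (\<Sum>k. u k x)" for x
  have [measurable]: "s \<in> borel_measurable M" unfolding s_def by measurable
  have sV: "ennreal ((cmod (s x))\<^sup>2) \<le> V x" if "V x \<noteq> \<infinity>" for x
  proof -
    note sm = summ[OF that]
    have "cmod (s x) \<le> (\<Sum>k. cmod (u k x))" unfolding s_def by (rule summable_norm[OF sm])
    also have "\<dots> \<le> sqrt (enn2real (V x))"
      by (rule suminf_le_const[OF sm partial_le[OF that]])
    finally have "(cmod (s x))\<^sup>2 \<le> (sqrt (enn2real (V x)))\<^sup>2" by (intro power_mono) auto
    then have "(cmod (s x))\<^sup>2 \<le> enn2real (V x)" by simp
    then show ?thesis using that by (metis ennreal_enn2real ennreal_leI infinity_ennreal_def top.not_eq_extremum)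
  qed
  have "(\<integral>\<^sup>+ x. ennreal (norm ((cmod (s x))\<^sup>2)) \<partial>M) \<le> (\<integral>\<^sup>+ x. V x \<partial>M)"
    using AEV by (intro nn_integral_mono_AE) (use sV in \<open>auto elim!: eventually_mono\<close>)
  also have "\<dots> < \<infinity>" using V ennreal_less_top[of "B\<^sup>2"] by (simp add: order.strict_trans1)
  finally have "integrable M (\<lambda>x. (cmod (s x))\<^sup>2)" by (intro integrableI_bounded) auto
  then have s: "s \<in> l2 M" by (simp add: l2_def)
  have "(\<lambda>k. l2_inner M g (u k)) sums l2_inner M g s" if g: "g \<in> l2 M" for g
  proof -
    have [measurable]: "g \<in> borel_measurable M" using g by (auto dest: l2D)
    have "(\<lambda>k. LINT x|M. cnj (g x) * u k x) sums (LINT x|M. (\<Sum>k. cnj (g x) * u k x))"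
    proof (rule sums_integral)
      show "AE x in M. summable (\<lambda>k. norm (cnj (g x) * u k x))"
        using AEV by eventually_elim (auto simp: norm_mult intro: summable_mult summ)
      show "summable (\<lambda>k. LINT x|M. norm (cnj (g x) * u k x))"
        by (rule summable_comparison_test'[OF summable_mult[OF S, of "l2_norm M g"]])
           (use l2_cauchy_schwarz_norm[OF g u] in \<open>auto simp: norm_mult\<close>)
    qed (rule l2_inner_integrable[OF g u])
    also have "(LINT x|M. (\<Sum>k. cnj (g x) * u k x)) = (LINT x|M. cnj (g x) * s x)"
    proof (rule integral_cong_AE)
      show "AE x in M. (\<Sum>k. cnj (g x) * u k x) = cnj (g x) * s x"
        using AEV by eventually_elim (auto simp: s_def intro!: suminf_mult summable_norm_cancel[OF summ])
    qed measurable
    finally show ?thesis by (simp add: l2_inner_def)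
  qed
  with s show ?thesis by (rule that)
qed

text \<open>One step of Gram-Schmidt: \<open>r\<close> is h minus its projection to the span. The
  third fact is Pythagoras' theorem and yields Bessel's inequality; the fourth gives the coefficient
  of h along the normalised residual.\<close>

lemma l2_orthonormal_residual:
  assumes "finite I" "\<And>i. i \<in> I \<Longrightarrow> e i \<in> l2 M" "h \<in> l2 M"
    and on: "\<And>i j. i \<in> I \<Longrightarrow> j \<in> I \<Longrightarrow> l2_inner M (e i) (e j) = (if i = j then 1 else 0)"
  defines "r \<equiv> \<lambda>x. h x - (\<Sum>i\<in>I. l2_inner M (e i) h * e i x)"
  shows "r \<in> l2 M" "\<And>j. j \<in> I \<Longrightarrow> l2_inner M (e j) r = 0"
    "l2_inner M r r = of_real ((l2_norm M h)\<^sup>2 - (\<Sum>i\<in>I. (cmod (l2_inner M (e i) h))\<^sup>2))"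
    "l2_inner M r h = l2_inner M r r"
proof -
  let ?p = "\<lambda>x. \<Sum>i\<in>I. l2_inner M (e i) h * e i x"
  have p: "?p \<in> l2 M" using assms by (intro l2_sum) auto
  show r: "r \<in> l2 M" unfolding r_def using p assms by (intro l2_diff) auto
  show rj: "l2_inner M (e j) r = 0" if "j \<in> I" for j
  proof -
    have "l2_inner M (e j) ?p = (\<Sum>i\<in>I. l2_inner M (e i) h * l2_inner M (e j) (e i))"
      using assms that by (intro l2_inner_sum_right) auto
    also have "\<dots> = (\<Sum>i\<in>I. if i = j then l2_inner M (e j) h else 0)"
      using that on by (intro sum.cong) auto
    finally have "l2_inner M (e j) ?p = l2_inner M (e j) h" using that assms(1) by simp
    then show ?thesis unfolding r_def using l2_inner_diff_right[of "e j" M h ?p] assms that p by simp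
  qed
  have "l2_inner M r ?p = (\<Sum>i\<in>I. l2_inner M (e i) h * l2_inner M r (e i))"
    using assms r by (intro l2_inner_sum_right) auto
  also have "\<dots> = 0"
  proof (intro sum.neutral ballI)
    fix i assume "i \<in> I"
    then have "l2_inner M r (e i) = 0" using rj[of i] l2_inner_cnj[of M "e i" r] by simp
    then show "l2_inner M (e i) h * l2_inner M r (e i) = 0" by simp
  qed
  finally have rp: "l2_inner M r ?p = 0" .
  have "l2_inner M r r = l2_inner M r h - l2_inner M r ?p"
    using l2_inner_diff_right[OF r assms(3) p] by (simp add: r_def)
  with rp show rh: "l2_inner M r h = l2_inner M r r" by simp
  have "l2_inner M r h = l2_inner M h h - l2_inner M ?p h"
    using l2_inner_diff_left[OF assms(3) assms(3) p] by (simp add: r_def)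
  also have "l2_inner M ?p h = (\<Sum>i\<in>I. cnj (l2_inner M (e i) h) * l2_inner M (e i) h)"
    using assms by (intro l2_inner_sum_left) auto
  also have "\<dots> = of_real (\<Sum>i\<in>I. (cmod (l2_inner M (e i) h))\<^sup>2)"
    unfolding of_real_sum by (intro sum.cong refl) (simp only: complex_norm_square mult.commute)
  finally show "l2_inner M r r = of_real ((l2_norm M h)\<^sup>2 - (\<Sum>i\<in>I. (cmod (l2_inner M (e i) h))\<^sup>2))"
    using rh by (simp add: l2_inner_self)
qed

lemma l2_bessel:
  assumes "finite I" "\<And>i. i \<in> I \<Longrightarrow> e i \<in> l2 M" "h \<in> l2 M"
    and on: "\<And>i j. i \<in> I \<Longrightarrow> j \<in> I \<Longrightarrow> l2_inner M (e i) (e j) = (if i = j then 1 else 0)"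
  shows "(\<Sum>i\<in>I. (cmod (l2_inner M (e i) h))\<^sup>2) \<le> (l2_norm M h)\<^sup>2"
proof -
  have "of_real ((l2_norm M h)\<^sup>2 - (\<Sum>i\<in>I. (cmod (l2_inner M (e i) h))\<^sup>2))
      = complex_of_real ((l2_norm M (\<lambda>x. h x - (\<Sum>i\<in>I. l2_inner M (e i) h * e i x)))\<^sup>2)"
    using l2_orthonormal_residual(3)[OF assms] by (simp only: l2_inner_self)
  then have "(l2_norm M h)\<^sup>2 - (\<Sum>i\<in>I. (cmod (l2_inner M (e i) h))\<^sup>2)
      = (l2_norm M (\<lambda>x. h x - (\<Sum>i\<in>I. l2_inner M (e i) h * e i x)))\<^sup>2"
    by (simp only: of_real_eq_iff)
  then show ?thesis by (smt (verit) zero_le_power2)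
qed

lemma l2_norm_orthonormal_sum:
  assumes "finite I" "\<And>i. i \<in> I \<Longrightarrow> e i \<in> l2 M"
    and on: "\<And>i j. i \<in> I \<Longrightarrow> j \<in> I \<Longrightarrow> l2_inner M (e i) (e j) = (if i = j then 1 else 0)"
  shows "(l2_norm M (\<lambda>x. \<Sum>i\<in>I. c i * e i x))\<^sup>2 = (\<Sum>i\<in>I. (cmod (c i))\<^sup>2)"
proof -
  let ?p = "\<lambda>x. \<Sum>i\<in>I. c i * e i x"
  have p: "?p \<in> l2 M" using assms by (intro l2_sum) auto
  have *: "l2_inner M (e i) ?p = c i" if "i \<in> I" for i
  proof -
    have "l2_inner M (e i) ?p = (\<Sum>j\<in>I. c j * l2_inner M (e i) (e j))"
      using assms that by (intro l2_inner_sum_right) auto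
    also have "\<dots> = (\<Sum>j\<in>I. if j = i then c i else 0)" using that on by (intro sum.cong) auto
    finally show ?thesis using that assms(1) by simp
  qed
  have "l2_inner M ?p ?p = (\<Sum>i\<in>I. cnj (c i) * l2_inner M (e i) ?p)"
    using assms p by (intro l2_inner_sum_left) auto
  also have "\<dots> = of_real (\<Sum>i\<in>I. (cmod (c i))\<^sup>2)"
    unfolding of_real_sum using * by (intro sum.cong refl) (simp only: complex_norm_square mult.commute)
  finally show ?thesis unfolding l2_inner_self using of_real_eq_iff by blast
qed

section \<open>Operators with dominated kernels\<close>

lemma kernel_section_l2:
  assumes "dominated_kernel M N K" "x \<in> space M"
  shows "(\<lambda>y. cnj (K x y)) \<in> l2 N" "K x \<in> l2 N"
proof -
  obtain f g where "dominates M N f g K"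
    using assms(1) unfolding dominated_kernel_def by blast
  note d = dominatesD[OF this]
  have [measurable]: "K x \<in> borel_measurable N" "g \<in> borel_measurable N"
    using measurable_compose[OF measurable_Pair1'[OF assms(2)] d(7)] d(2) by simp_all
  have int: "integrable N (\<lambda>y. (f x)\<^sup>2 * (g y)\<^sup>2)" using d(4) by simp
  have "integrable N (\<lambda>y. (cmod (K x y))\<^sup>2)"
  proof (rule Bochner_Integration.integrable_bound[OF int])
    show "AE y in N. norm ((cmod (K x y))\<^sup>2) \<le> norm ((f x)\<^sup>2 * (g y)\<^sup>2)"
    proof (rule AE_I2)
      fix y assume "y \<in> space N"
      then have "(cmod (K x y))\<^sup>2 \<le> (f x * g y)\<^sup>2" using d(8) assms(2) by (intro power_mono) auto
      then show "norm ((cmod (K x y))\<^sup>2) \<le> norm ((f x)\<^sup>2 * (g y)\<^sup>2)" by (simp add: power_mult_distrib)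
    qed
  qed measurable
  then show "(\<lambda>y. cnj (K x y)) \<in> l2 N" "K x \<in> l2 N" by (auto simp: l2_def)
qed

lemma kernel_integrable_l2:
  assumes "dominated_kernel M N K" "x \<in> space M" "h \<in> l2 N"
  shows "integrable N (\<lambda>y. K x y * h y)"
  using l2_inner_integrable[OF kernel_section_l2(1)[OF assms(1,2)] assms(3)] by simp

text \<open>The map \<open>integral_operator\<close> between two possibly different spaces, so that
  the factors through the auxiliary space can be treated alone.\<close>

definition kernel_apply :: "'b measure \<Rightarrow> ('a \<Rightarrow> 'b \<Rightarrow> complex) \<Rightarrow> ('b \<Rightarrow> complex) \<Rightarrow> 'a \<Rightarrow> complex" where
  "kernel_apply N K h x = (LINT y|N. K x y * h y)"

lemma kernel_apply_bound:
  assumes K: "dominates M N f g K" and h: "h \<in> l2 N" and x: "x \<in> space M"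
  shows "cmod (kernel_apply N K h x) \<le> f x * (sqrt (LINT y|N. (g y)\<^sup>2) * l2_norm N h)"
proof -
  note d = dominatesD[OF K]
  have gl2: "(\<lambda>y. complex_of_real (g y)) \<in> l2 N"
    using d(2,4) by (auto simp: l2_def d(6))
  have "cmod (kernel_apply N K h x) \<le> (LINT y|N. cmod (K x y * h y))"
    unfolding kernel_apply_def by (rule integral_norm_bound)
  also have "\<dots> \<le> (LINT y|N. f x * (cmod (complex_of_real (g y)) * cmod (h y)))"
  proof (rule integral_mono)
    show "integrable N (\<lambda>y. cmod (K x y * h y))"
      using K by (intro integrable_norm kernel_integrable_l2[OF _ x h]) (auto simp: dominated_kernel_def)
    show "integrable N (\<lambda>y. f x * (cmod (complex_of_real (g y)) * cmod (h y)))"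
      using l2_norm_mult_integrable[OF gl2 h] by (intro integrable_mult_right)
    fix y assume "y \<in> space N"
    then show "cmod (K x y * h y) \<le> f x * (cmod (complex_of_real (g y)) * cmod (h y))"
      using mult_right_mono[OF d(8)[OF x, of y], of "cmod (h y)"] d(6)[of y] by (simp add: norm_mult mult_ac)
  qed
  also have "\<dots> = f x * (LINT y|N. cmod (complex_of_real (g y)) * cmod (h y))" by simp
  also have "\<dots> \<le> f x * (l2_norm N (\<lambda>y. complex_of_real (g y)) * l2_norm N h)"
    by (intro mult_left_mono l2_cauchy_schwarz_norm gl2 h d(5))
  finally show ?thesis by (simp add: l2_norm_def)
qed

lemma kernel_apply_measurable:
  assumes N: "sigma_finite_measure N" and K: "dominated_kernel M N K" and h: "h \<in> l2 N"
  shows "kernel_apply N K h \<in> borel_measurable M"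
proof -
  interpret sigma_finite_measure N by (rule N)
  have [measurable]: "(\<lambda>(x, y). K x y) \<in> borel_measurable (M \<Otimes>\<^sub>M N)" "h \<in> borel_measurable N"
    using dominated_kernel_measurable[OF K] h by (auto simp: l2_def)
  show ?thesis unfolding kernel_apply_def by measurable
qed

lemma kernel_apply_l2:
  assumes N: "sigma_finite_measure N" and K: "dominates M N f g K" and h: "h \<in> l2 N"
  shows "kernel_apply N K h \<in> l2 M"
    "l2_norm M (kernel_apply N K h) \<le> sqrt (LINT x|M. (f x)\<^sup>2) * sqrt (LINT y|N. (g y)\<^sup>2) * l2_norm N h"
proof -
  note d = dominatesD[OF K]
  have dom: "dominated_kernel M N K" using K by (auto simp: dominated_kernel_def)
  have [measurable]: "kernel_apply N K h \<in> borel_measurable M" by (rule kernel_apply_measurable[OF N dom h])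
  define C where "C = sqrt (LINT y|N. (g y)\<^sup>2) * l2_norm N h"
  have C: "C \<ge> 0" by (simp add: C_def)
  have le: "(cmod (kernel_apply N K h x))\<^sup>2 \<le> C\<^sup>2 * (f x)\<^sup>2" if "x \<in> space M" for x
    using power_mono[OF kernel_apply_bound[OF K h that], of 2] by (simp add: C_def power_mult_distrib mult_ac)
  have int: "integrable M (\<lambda>x. C\<^sup>2 * (f x)\<^sup>2)" using d(3) by simp
  have int2: "integrable M (\<lambda>x. (cmod (kernel_apply N K h x))\<^sup>2)"
    by (rule Bochner_Integration.integrable_bound[OF int]) (use le in auto)
  then show "kernel_apply N K h \<in> l2 M" by (simp add: l2_def)
  have "(LINT x|M. (cmod (kernel_apply N K h x))\<^sup>2) \<le> (LINT x|M. C\<^sup>2 * (f x)\<^sup>2)"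
    by (rule integral_mono[OF int2 int le])
  also have "\<dots> = C\<^sup>2 * (LINT x|M. (f x)\<^sup>2)" by simp
  finally have "l2_norm M (kernel_apply N K h) \<le> sqrt (C\<^sup>2 * (LINT x|M. (f x)\<^sup>2))"
    unfolding l2_norm_def by (rule real_sqrt_le_mono)
  then show "l2_norm M (kernel_apply N K h) \<le> sqrt (LINT x|M. (f x)\<^sup>2) * sqrt (LINT y|N. (g y)\<^sup>2) * l2_norm N h"
    using C by (simp add: real_sqrt_mult C_def mult_ac)
qed

lemma kernel_apply_linear:
  assumes K: "dominated_kernel M N K" and g: "g \<in> l2 N" and h: "h \<in> l2 N" and x: "x \<in> space M"
  shows "kernel_apply N K (\<lambda>y. c * g y + h y) x = c * kernel_apply N K g x + kernel_apply N K h x"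
proof -
  have "kernel_apply N K (\<lambda>y. c * g y + h y) x = (LINT y|N. c * (K x y * g y) + K x y * h y)"
    unfolding kernel_apply_def by (intro Bochner_Integration.integral_cong) (auto simp: algebra_simps)
  then show ?thesis
    using kernel_integrable_l2[OF K x g] kernel_integrable_l2[OF K x h] by (simp add: kernel_apply_def)
qed

lemma kernel_apply_adjoint_integrable:
  assumes M: "sigma_finite_measure M" and N: "sigma_finite_measure N" and K: "dominated_kernel M N K"
    and g: "g \<in> l2 M" and h: "h \<in> l2 N"
  shows "integrable (M \<Otimes>\<^sub>M N) (\<lambda>(x, y). cnj (g x) * (K x y * h y))"
proof -
  obtain a b where "dominates M N a b K"
    using K unfolding dominated_kernel_def by blast
  note d = dominatesD[OF this]
  have [measurable]: "(\<lambda>(x, y). K x y) \<in> borel_measurable (M \<Otimes>\<^sub>M N)" "g \<in> borel_measurable M" "h \<in> borel_measurable N"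
    "a \<in> borel_measurable M" "b \<in> borel_measurable N"
    using d g h by (auto simp: l2_def)
  have "integrable (M \<Otimes>\<^sub>M N) (\<lambda>w. (cmod (g (fst w)) * a (fst w)) * (b (snd w) * cmod (h (snd w))))"
    by (intro integrable_pair_mult[OF M N, of "\<lambda>x. cmod (g x) * a x" "\<lambda>y. b y * cmod (h y)"]
        integrable_mult_square_integrable) (use d g h in \<open>auto simp: l2_def\<close>)
  then show ?thesis
  proof (rule Bochner_Integration.integrable_bound)
    have "(\<lambda>w. cnj (g (fst w)) * ((\<lambda>(x, y). K x y) w * h (snd w))) \<in> borel_measurable (M \<Otimes>\<^sub>M N)"
      by measurable
    then show "(\<lambda>(x, y). cnj (g x) * (K x y * h y)) \<in> borel_measurable (M \<Otimes>\<^sub>M N)" by (simp add: split_def)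
    show "AE w in M \<Otimes>\<^sub>M N. norm (case w of (x, y) \<Rightarrow> cnj (g x) * (K x y * h y))
        \<le> norm ((cmod (g (fst w)) * a (fst w)) * (b (snd w) * cmod (h (snd w))))"
    proof (rule AE_I2)
      fix w assume "w \<in> space (M \<Otimes>\<^sub>M N)"
      then obtain x y where w: "w = (x, y)" "x \<in> space M" "y \<in> space N" by (auto simp: space_pair_measure)
      have "cmod (g x) * cmod (h y) * cmod (K x y) \<le> cmod (g x) * cmod (h y) * (a x * b y)"
        using d(8)[OF w(2,3)] by (intro mult_left_mono) auto
      then show "norm (case w of (x, y) \<Rightarrow> cnj (g x) * (K x y * h y))
        \<le> norm ((cmod (g (fst w)) * a (fst w)) * (b (snd w) * cmod (h (snd w))))"
        using d(5)[of x] d(6)[of y] by (simp add: w norm_mult abs_mult mult_ac)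
    qed
  qed
qed

lemma kernel_apply_adjoint:
  assumes M: "sigma_finite_measure M" and N: "sigma_finite_measure N" and K: "dominated_kernel M N K"
    and g: "g \<in> l2 M" and h: "h \<in> l2 N"
  shows "l2_inner M g (kernel_apply N K h) = l2_inner N (kernel_apply M (\<lambda>y x. cnj (K x y)) g) h"
proof -
  interpret pair_sigma_finite M N using M N by (rule pair_sigma_finite.intro)
  have "l2_inner M g (kernel_apply N K h) = (LINT x|M. LINT y|N. cnj (g x) * (K x y * h y))"
    unfolding l2_inner_def kernel_apply_def by simp
  also have "\<dots> = (LINT y|N. LINT x|M. cnj (g x) * (K x y * h y))"
    by (rule Fubini_integral[symmetric]) (rule kernel_apply_adjoint_integrable[OF assms])
  also have "\<dots> = (LINT y|N. cnj (LINT x|M. cnj (K x y) * g x) * h y)"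
  proof (rule Bochner_Integration.integral_cong[OF refl])
    fix y
    have "(LINT x|M. cnj (g x) * (K x y * h y)) = (LINT x|M. cnj (cnj (K x y) * g x) * h y)"
      by (intro Bochner_Integration.integral_cong) auto
    also have "\<dots> = cnj (LINT x|M. cnj (K x y) * g x) * h y"
      by (simp only: integral_mult_left_zero Bochner_Integration.integral_cnj)
    finally show "(LINT x|M. cnj (g x) * (K x y * h y)) = cnj (LINT x|M. cnj (K x y) * g x) * h y" .
  qed
  finally show ?thesis by (simp add: l2_inner_def kernel_apply_def)
qed

lemma dominates_adjoint:
  assumes "dominates M N f g K"
  shows "dominates N M g f (\<lambda>y x. cnj (K x y))"
proof -
  note d = dominatesD[OF assms]
  have "(\<lambda>w. (snd w, fst w)) \<in> measurable (N \<Otimes>\<^sub>M M) (M \<Otimes>\<^sub>M N)" by measurable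
  from measurable_compose[OF this d(7)]
  have "(\<lambda>w. cnj (K (snd w) (fst w))) \<in> borel_measurable (N \<Otimes>\<^sub>M M)" by simp
  then have "(\<lambda>(y, x). cnj (K x y)) \<in> borel_measurable (N \<Otimes>\<^sub>M M)" by (simp add: split_def)
  then show ?thesis using d unfolding dominates_def by (auto simp: mult.commute)
qed

text \<open>The coefficients of \<open>1 - sqrt (1 - x) = (\<Sum>k. sqrt_coeff k * x ^ k)\<close>.\<close>

definition sqrt_coeff :: "nat \<Rightarrow> real" where
  "sqrt_coeff k = (if k = 0 then 1 else 0) - (-1) ^ k * ((1 / 2) gchoose k)"

text \<open>The signed binomial coefficient starts at -1/2 for k = 1, and passing from k to k + 1
  multiplies it by (k - 1/2) / (k + 1) > 0, so it stays negative.\<close>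

lemma sqrt_coeff_nonneg: "sqrt_coeff k \<ge> 0"
proof (cases k)
  case (Suc n)
  have "(-1) ^ Suc n * ((1 / 2 :: real) gchoose Suc n) \<le> 0"
  proof (induction n)
    case (Suc n)
    have rec: "((1 / 2 :: real) gchoose Suc (Suc n)) = ((1 / 2) gchoose Suc n) * ((1 / 2 - real (Suc n)) / real (Suc (Suc n)))"
      using gbinomial_mult_1[of "1 / 2 :: real" "Suc n"] by (simp add: field_simps)
    have "(-1) ^ Suc (Suc n) * ((1 / 2 :: real) gchoose Suc (Suc n))
        = ((-1) ^ Suc n * ((1 / 2) gchoose Suc n)) * ((real (Suc n) - 1 / 2) / real (Suc (Suc n)))"
      unfolding rec by (simp add: field_simps)
    also have "\<dots> \<le> 0" by (intro mult_nonpos_nonneg Suc) auto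
    finally show ?case .
  qed simp
  then show ?thesis by (simp add: sqrt_coeff_def Suc)
qed (simp add: sqrt_coeff_def)

text \<open>The alternating partial sums of the coefficients of (1 - x)^(1/2) collapse to a single
  signed coefficient of (1 - x)^(-1/2), which is a product of positive factors. The bound 1 is what
  makes 1 - S a positive operator later.\<close>

lemma sqrt_coeff_sum_le: "(\<Sum>k\<le>m. sqrt_coeff k) \<le> 1"
proof -
  have "0 \<le> (-1) ^ m * ((1 / 2 - 1 :: real) gchoose m)"
  proof -
    have "(-1) ^ m * ((1 / 2 - 1 :: real) gchoose m) = (\<Prod>i = 0..<m. 1 / 2 + real i) / fact m"
    proof -
      have "(\<Prod>i = 0..<m. 1 / 2 + real i) = (\<Prod>i = 0..<m. (-1) * (1 / 2 - 1 - real i))"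
        by (intro prod.cong) auto
      also have "\<dots> = (-1) ^ m * (\<Prod>i = 0..<m. 1 / 2 - 1 - real i)" by (subst prod.distrib) simp
      finally show ?thesis by (simp add: gbinomial_prod_rev)
    qed
    also have "\<dots> \<ge> 0" by (intro divide_nonneg_nonneg prod_nonneg) auto
    finally show ?thesis .
  qed
  moreover have "(\<Sum>k\<le>m. sqrt_coeff k) = 1 - (\<Sum>k\<le>m. ((1 / 2) gchoose k) * (-1) ^ k)"
    unfolding sqrt_coeff_def sum_subtractf by (simp add: mult.commute)
  ultimately show ?thesis using gbinomial_sum_lower_neg[of "1 / 2 :: real" m] by simp
qed

lemma sqrt_coeff_summable: "summable sqrt_coeff" and sqrt_coeff_suminf_le: "suminf sqrt_coeff \<le> 1"
proof -
  have le: "(\<Sum>k<n. sqrt_coeff k) \<le> 1" for n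
    by (rule order_trans[OF sum_mono2 sqrt_coeff_sum_le[of n]]) (auto simp: sqrt_coeff_nonneg)
  show s: "summable sqrt_coeff"
    by (rule summableI_nonneg_bounded[of _ 1]) (auto simp: sqrt_coeff_nonneg le)
  show "suminf sqrt_coeff \<le> 1" by (rule suminf_le_const[OF s le])
qed

text \<open>The series s = 1 - sqrt (1 - x) satisfies s^2 = 2 s - x; this is the identity between
  coefficients. The square of sqrt (1 - x) is computed by Vandermonde's identity with both upper
  arguments 1/2.\<close>

lemma sqrt_coeff_convolution:
  "(\<Sum>i\<le>n. sqrt_coeff i * sqrt_coeff (n - i)) = 2 * sqrt_coeff n - (if n = 1 then 1 else 0)"
proof -
  define a :: "nat \<Rightarrow> real" where "a k = (-1) ^ k * ((1 / 2) gchoose k)" for k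
  define e :: "nat \<Rightarrow> real" where "e k = (if k = 0 then 1 else 0)" for k
  have aa: "(\<Sum>i\<le>n. a i * a (n - i)) = (-1) ^ n * (1 gchoose n)"
  proof -
    have "(\<Sum>i\<le>n. a i * a (n - i)) = (\<Sum>i\<le>n. (-1) ^ n * (((1 / 2) gchoose i) * ((1 / 2) gchoose (n - i))))"
    proof (intro sum.cong refl)
      fix i assume "i \<in> {..n}"
      then have "(-1 :: real) ^ n = (-1) ^ i * (-1) ^ (n - i)" by (simp flip: power_add)
      then show "a i * a (n - i) = (-1) ^ n * (((1 / 2) gchoose i) * ((1 / 2) gchoose (n - i)))" by (simp add: a_def)
    qed
    also have "\<dots> = (-1) ^ n * ((1 / 2 + 1 / 2) gchoose n)"
      unfolding sum_distrib_left[symmetric] using gbinomial_Vandermonde[of "1 / 2 :: real" "1 / 2" n]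
      by (simp add: atLeast0AtMost)
    finally show ?thesis by simp
  qed
  have one: "(-1) ^ n * (1 gchoose n :: real) = e n - (if n = 1 then 1 else 0)"
  proof -
    have "(1 gchoose n :: real) = of_nat (1 choose n)" using binomial_gbinomial[of 1 n, where 'a=real] by simp
    then show ?thesis by (cases n; cases "n - 1") (auto simp: e_def)
  qed
  have ee: "(\<Sum>i\<le>n. e i * f (n - i)) = f n" "(\<Sum>i\<le>n. f i * e (n - i)) = f n" for f :: "nat \<Rightarrow> real"
  proof -
    have "(\<Sum>i\<le>n. e i * f (n - i)) = (\<Sum>i\<le>n. if i = 0 then f n else 0)" by (intro sum.cong) (auto simp: e_def)
    then show "(\<Sum>i\<le>n. e i * f (n - i)) = f n" by simp
    have "(\<Sum>i\<le>n. f i * e (n - i)) = (\<Sum>i\<le>n. if i = n then f n else 0)" by (intro sum.cong) (auto simp: e_def)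
    then show "(\<Sum>i\<le>n. f i * e (n - i)) = f n" by simp
  qed
  have "(\<Sum>i\<le>n. sqrt_coeff i * sqrt_coeff (n - i))
      = (\<Sum>i\<le>n. e i * e (n - i)) - (\<Sum>i\<le>n. e i * a (n - i)) - (\<Sum>i\<le>n. a i * e (n - i)) + (\<Sum>i\<le>n. a i * a (n - i))"
    unfolding sqrt_coeff_def a_def[symmetric] e_def[symmetric]
    by (simp add: algebra_simps sum.distrib sum_subtractf)
  also have "\<dots> = 2 * (e n - a n) - (if n = 1 then 1 else 0)" unfolding ee aa one by simp
  finally show ?thesis by (simp add: sqrt_coeff_def a_def e_def)
qed

text \<open>A Cauchy product adapted to \<langle>S u, S h\<rangle>, where S is a power series in a
  symmetric X and m k = \<langle>u, X^k h\<rangle>: the term with indices i and j involves only m (i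
  + j). The double family is dominated by b j b i C, hence may be regrouped by n = i + j.\<close>

lemma weighted_cauchy_product_sums:
  fixes b :: "nat \<Rightarrow> real" and m :: "nat \<Rightarrow> complex"
  assumes b: "\<And>k. b k \<ge> 0" "summable b" and m: "\<And>k. cmod (m k) \<le> C"
  shows "(\<lambda>n. of_real (\<Sum>i\<le>n. b i * b (n - i)) * m n) sums
    (\<Sum>j. of_real (b j) * (\<Sum>i. of_real (b i) * m (i + j)))"
proof -
  define f where "f = (\<lambda>(j, i). of_real (b j) * (of_real (b i) * m (i + j)))"
  have C: "C \<ge> 0" using m[of 0] norm_ge_zero order_trans by blast
  have bs: "(b has_sum suminf b) UNIV"
    using norm_summable_imp_has_sum[of b "suminf b"] b by (simp add: summable_sums)
  have dom: "(\<lambda>p. norm ((\<lambda>(j, i). b j * (b i * C)) p)) summable_on (UNIV \<times> UNIV)"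
  proof (subst Infinite_Sum.abs_summable_on_Sigma_iff, intro conjI ballI)
    fix j :: nat
    have "((\<lambda>i. b j * (b i * C)) has_sum (b j * (suminf b * C))) UNIV"
      by (intro has_sum_cmult_right has_sum_cmult_left bs)
    then have hs: "((\<lambda>i. norm (b j * (b i * C))) has_sum (b j * (suminf b * C))) UNIV"
      using b(1) C by (simp add: abs_mult)
    then show "(\<lambda>i. norm (case (j, i) of (j, i) \<Rightarrow> b j * (b i * C))) summable_on UNIV"
      by (auto simp: summable_on_def)
  next
    have "infsum (\<lambda>i. norm (case (j, i) of (j, i) \<Rightarrow> b j * (b i * C))) UNIV = b j * (suminf b * C)" for j
    proof -
      have "((\<lambda>i. b j * (b i * C)) has_sum (b j * (suminf b * C))) UNIV"
        by (intro has_sum_cmult_right has_sum_cmult_left bs)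
      then show ?thesis using b(1) C by (intro infsumI) (simp add: abs_mult)
    qed
    moreover have "((\<lambda>j. b j * (suminf b * C)) has_sum (suminf b * (suminf b * C))) UNIV"
      by (intro has_sum_cmult_left bs)
    moreover have "suminf b \<ge> 0" using b by (intro suminf_nonneg) auto
    ultimately show "(\<lambda>j. norm (infsum (\<lambda>i. norm (case (j, i) of (j, i) \<Rightarrow> b j * (b i * C))) UNIV)) summable_on UNIV"
      using b(1) C by (auto simp: summable_on_def abs_mult)
  qed
  have "(\<lambda>p. norm (f p)) summable_on (UNIV \<times> UNIV)"
    by (rule Infinite_Sum.abs_summable_on_comparison_test[OF dom])
       (use b(1) C m in \<open>auto simp: f_def norm_mult abs_mult intro!: mult_left_mono\<close>)
  then have fs: "f summable_on (UNIV \<times> UNIV)" by (rule abs_summable_summable)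
  define \<phi> :: "nat \<times> nat \<Rightarrow> nat \<times> nat" where "\<phi> = (\<lambda>(n, i). (n - i, i))"
  have bij: "bij_betw \<phi> (Sigma UNIV (\<lambda>n. {..n})) (UNIV \<times> UNIV)"
    by (rule bij_betwI[of _ _ _ "\<lambda>(j, i). (j + i, i)"]) (auto simp: \<phi>_def)
  define T where "T = (\<Sum>j. of_real (b j) * (\<Sum>i. of_real (b i) * m (i + j)))"
  have inner: "infsum (\<lambda>i. f (j, i)) UNIV = of_real (b j) * (\<Sum>i. of_real (b i) * m (i + j))"
    and inner_bound: "cmod (\<Sum>i. of_real (b i) * m (i + j)) \<le> suminf b * C" for j
  proof -
    have s: "summable (\<lambda>i. norm (of_real (b i) * m (i + j)))"
      by (rule summable_comparison_test'[OF summable_mult2[OF b(2), of C]])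
         (use b(1) m in \<open>auto simp: norm_mult intro!: mult_left_mono\<close>)
    have "((\<lambda>i. of_real (b i) * m (i + j)) has_sum (\<Sum>i. of_real (b i) * m (i + j))) UNIV"
      by (rule norm_summable_imp_has_sum[OF s summable_sums[OF summable_norm_cancel[OF s]]])
    then have "((\<lambda>i. f (j, i)) has_sum of_real (b j) * (\<Sum>i. of_real (b i) * m (i + j))) UNIV"
      unfolding f_def by (simp add: has_sum_cmult_right)
    then show "infsum (\<lambda>i. f (j, i)) UNIV = of_real (b j) * (\<Sum>i. of_real (b i) * m (i + j))" by (rule infsumI)
    have "cmod (\<Sum>i. of_real (b i) * m (i + j)) \<le> (\<Sum>i. norm (of_real (b i) * m (i + j)))" by (rule summable_norm[OF s])
    also have "\<dots> \<le> (\<Sum>i. b i * C)"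
      by (rule suminf_le[OF _ s summable_mult2[OF b(2)]]) (use b(1) m in \<open>auto simp: norm_mult intro!: mult_left_mono\<close>)
    also have "\<dots> = suminf b * C" by (rule suminf_mult2[OF b(2), symmetric])
    finally show "cmod (\<Sum>i. of_real (b i) * m (i + j)) \<le> suminf b * C" .
  qed
  have s2: "summable (\<lambda>j. norm (of_real (b j) * (\<Sum>i. of_real (b i) * m (i + j))))"
    by (rule summable_comparison_test'[OF summable_mult2[OF b(2), of "suminf b * C"]])
       (use b(1) inner_bound in \<open>auto simp: norm_mult intro!: mult_left_mono\<close>)
  have "infsum f (UNIV \<times> UNIV) = infsum (\<lambda>j. infsum (\<lambda>i. f (j, i)) UNIV) UNIV"
    using infsum_Sigma_banach[of f UNIV "\<lambda>_. UNIV"] fs by simp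
  also have "\<dots> = T"
    unfolding inner T_def
    by (rule infsumI[OF norm_summable_imp_has_sum[OF s2 summable_sums[OF summable_norm_cancel[OF s2]]]])
  finally have T: "infsum f (UNIV \<times> UNIV) = T" .
  have gs: "(\<lambda>p. f (\<phi> p)) summable_on (Sigma UNIV (\<lambda>n. {..n}))"
    using summable_on_reindex_bij_betw[OF bij, of f] fs by simp
  have gi: "infsum (\<lambda>p. f (\<phi> p)) (Sigma UNIV (\<lambda>n. {..n})) = T"
    using infsum_reindex_bij_betw[OF bij, of f] T by simp
  have row: "infsum (\<lambda>i. f (\<phi> (n, i))) {..n} = of_real (\<Sum>i\<le>n. b i * b (n - i)) * m n" for n
    by (simp add: \<phi>_def f_def sum_distrib_right sum_distrib_left mult_ac)
  have "(\<lambda>n. infsum (\<lambda>i. f (\<phi> (n, i))) {..n}) summable_on UNIV"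
    using summable_on_Sigma_banach[of "\<lambda>n i. f (\<phi> (n, i))" UNIV "\<lambda>n. {..n}"] gs
    by (simp add: case_prod_unfold)
  then have "((\<lambda>n. infsum (\<lambda>i. f (\<phi> (n, i))) {..n}) has_sum infsum (\<lambda>n. infsum (\<lambda>i. f (\<phi> (n, i))) {..n}) UNIV) UNIV"
    by (rule has_sum_infsum)
  also have "infsum (\<lambda>n. infsum (\<lambda>i. f (\<phi> (n, i))) {..n}) UNIV = T"
    using infsum_Sigma_banach[OF gs] gi by (rule trans)
  finally have "((\<lambda>n. infsum (\<lambda>i. f (\<phi> (n, i))) {..n}) has_sum T) UNIV" .
  then show ?thesis unfolding row T_def by (rule has_sum_imp_sums)
qed

section \<open>Absolute values\<close>

lemma integral_operator_kernel_apply: "integral_operator M K = kernel_apply M K"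
  by (simp add: integral_operator_def kernel_apply_def fun_eq_iff)

lemma l2_bounded_operator_kernel_apply:
  assumes M: "sigma_finite_measure M" and K: "dominated_kernel M M K"
  shows "l2_bounded_operator M (kernel_apply M K)"
proof -
  obtain f g where d: "dominates M M f g K" using K unfolding dominated_kernel_def by blast
  show ?thesis
    unfolding l2_bounded_operator_def
    using kernel_apply_l2[OF M d] kernel_apply_linear[OF K] by (auto intro!: AE_I2)
qed

text \<open>With S the weak sum of the \<open>sqrt_coeff k\<close> X^k, formally S = 1 - sqrt (1 -
  X) for X = 1 - \<kappa> T' T, so r (1 - S) is the square root of T' T when r = \<kappa>^(-1/2).
  All identities are verified through inner products, since the vectors S h are determined only up
  to null functions.\<close>

lemma l2_absolute_value_exists:
  assumes M: "sigma_finite_measure M" and K: "dominated_kernel M M K"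
  shows "\<exists>P. l2_absolute_value M (kernel_apply M K) P"
proof -
  obtain f g where d: "dominates M M f g K" using K unfolding dominated_kernel_def by blast
  define T where "T = kernel_apply M K"
  define T' where "T' = kernel_apply M (\<lambda>y x. cnj (K x y))"
  note d' = dominates_adjoint[OF d]
  have K': "dominated_kernel M M (\<lambda>y x. cnj (K x y))" using d' by (auto simp: dominated_kernel_def)
  define C where "C = sqrt (LINT x|M. (f x)\<^sup>2) * sqrt (LINT y|M. (g y)\<^sup>2)"
  have C: "C \<ge> 0" by (simp add: C_def)
  have T: "T h \<in> l2 M" "l2_norm M (T h) \<le> C * l2_norm M h" if "h \<in> l2 M" for h
    using kernel_apply_l2[OF M d that] by (simp_all add: T_def C_def)
  have T': "T' h \<in> l2 M" "l2_norm M (T' h) \<le> C * l2_norm M h" if "h \<in> l2 M" for h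
    using kernel_apply_l2[OF M d' that] by (simp_all add: T'_def C_def mult_ac)
  have adj: "l2_inner M u (T h) = l2_inner M (T' u) h" if "u \<in> l2 M" "h \<in> l2 M" for u h
    using kernel_apply_adjoint[OF M M K that] by (simp add: T_def T'_def)
  have adj': "l2_inner M u (T' h) = l2_inner M (T u) h" if "u \<in> l2 M" "h \<in> l2 M" for u h
    using adj[OF that(2,1)] l2_inner_cnj by metis
  \<comment> \<open>Scaled so that \<kappa> C^2 \<le> 1; the summand 1 covers C = 0.\<close>
  define \<kappa> where "\<kappa> = 1 / (C\<^sup>2 + 1)"
  have kpos: "0 < C\<^sup>2 + 1" using zero_le_power2[of C] by linarith
  have \<kappa>: "\<kappa> > 0" "\<kappa> * C\<^sup>2 \<le> 1" using kpos by (auto simp: \<kappa>_def field_simps)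
  define X where "X h = (\<lambda>x. of_real (- \<kappa>) * T' (T h) x + h x)" for h
  have Xl2: "X h \<in> l2 M" if "h \<in> l2 M" for h unfolding X_def using that T T' by (intro l2_lincomb) auto
  have Xr: "l2_inner M u (X h) = l2_inner M u h - of_real \<kappa> * l2_inner M (T u) (T h)"
    if "u \<in> l2 M" "h \<in> l2 M" for u h
    unfolding X_def using l2_inner_right[of u M "T' (T h)" h "of_real (- \<kappa>)"] that T T' adj'[of u "T h"] by simp
  have Xs: "l2_inner M (X u) h = l2_inner M u (X h)" if "u \<in> l2 M" "h \<in> l2 M" for u h
  proof -
    have "l2_inner M (X u) h = cnj (l2_inner M h (X u))" by (rule l2_inner_cnj[symmetric])
    also have "\<dots> = l2_inner M u (X h)" using that by (simp add: Xr l2_inner_cnj)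
    finally show ?thesis .
  qed
  \<comment> \<open>Expanding, |X h|^2 = |h|^2 - 2 \<kappa> |T h|^2 + \<kappa>^2 |T' T h|^2, and the
    last term is at most \<kappa> |T h|^2 because |T' T h| \<le> C |T h| and \<kappa> C^2 \<le>
    1.\<close>
  have Xn: "l2_norm M (X h) \<le> l2_norm M h" if h: "h \<in> l2 M" for h
  proof -
    have Th: "T h \<in> l2 M" "T' (T h) \<in> l2 M" using h T T' by auto
    have "l2_inner M (X h) (X h) = l2_inner M (X h) h - of_real \<kappa> * l2_inner M (T (X h)) (T h)"
      using Xr[OF Xl2[OF h] h] .
    also have "l2_inner M (X h) h = l2_inner M h h - of_real \<kappa> * l2_inner M (T h) (T h)"
      using Xs[OF h h] Xr[OF h h] by simp
    also have "l2_inner M (T (X h)) (T h) = l2_inner M (X h) (T' (T h))"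
      using adj'[OF Xl2[OF h] Th(1)] by simp
    also have "\<dots> = l2_inner M h (X (T' (T h)))" by (rule Xs[OF h Th(2)])
    also have "\<dots> = l2_inner M (T h) (T h) - of_real \<kappa> * l2_inner M (T' (T h)) (T' (T h))"
      using Xr[OF h Th(2)] adj'[OF h Th(1)] adj[OF Th(1) Th(2)] by simp
    finally have "(l2_norm M (X h))\<^sup>2
        = (l2_norm M h)\<^sup>2 - 2 * \<kappa> * (l2_norm M (T h))\<^sup>2 + \<kappa>\<^sup>2 * (l2_norm M (T' (T h)))\<^sup>2"
      unfolding l2_inner_self
      by (subst of_real_eq_iff[where 'a=complex, symmetric]) (simp add: algebra_simps power2_eq_square)
    also have "\<kappa>\<^sup>2 * (l2_norm M (T' (T h)))\<^sup>2 \<le> \<kappa>\<^sup>2 * (C * l2_norm M (T h))\<^sup>2"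
      by (intro mult_left_mono power_mono T' Th) auto
    also have "\<dots> = \<kappa> * (\<kappa> * C\<^sup>2) * (l2_norm M (T h))\<^sup>2" by (simp add: power2_eq_square)
    also have "\<dots> \<le> \<kappa> * 1 * (l2_norm M (T h))\<^sup>2" using \<kappa> by (intro mult_right_mono mult_left_mono) auto
    finally have "(l2_norm M (X h))\<^sup>2 \<le> (l2_norm M h)\<^sup>2 - \<kappa> * (l2_norm M (T h))\<^sup>2"
      by simp
    moreover have "0 \<le> \<kappa> * (l2_norm M (T h))\<^sup>2" using \<kappa> by simp
    ultimately have "(l2_norm M (X h))\<^sup>2 \<le> (l2_norm M h)\<^sup>2" by linarith
    then show ?thesis by (rule power2_le_imp_le) simp
  qed
  have Yl2: "(X ^^ k) h \<in> l2 M" if "h \<in> l2 M" for k h using that by (induction k) (auto intro: Xl2)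
  have Yn: "l2_norm M ((X ^^ k) h) \<le> l2_norm M h" if "h \<in> l2 M" for k h
  proof (induction k)
    case (Suc k)
    then show ?case using Xn[OF Yl2[OF that, of k]] by simp
  qed simp
  have Ys: "l2_inner M ((X ^^ k) u) h = l2_inner M u ((X ^^ k) h)" if "u \<in> l2 M" "h \<in> l2 M" for k u h
    using that
  proof (induction k arbitrary: h)
    case (Suc k)
    show ?case
      using Suc.IH[OF Suc.prems(1) Xl2[OF Suc.prems(2)]] Xs[OF Yl2[OF Suc.prems(1), of k] Suc.prems(2)]
      by (simp add: funpow_swap1[of X k h])
  qed simp
  let ?b = "\<lambda>k. complex_of_real (sqrt_coeff k)"
  have "\<exists>s\<in>l2 M. \<forall>u\<in>l2 M. (\<lambda>k. ?b k * l2_inner M u ((X ^^ k) h)) sums l2_inner M u s" if h: "h \<in> l2 M" for h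
  proof -
    have sm: "summable (\<lambda>k. l2_norm M (\<lambda>x. ?b k * (X ^^ k) h x))"
      by (rule summable_comparison_test'[OF summable_mult2[OF sqrt_coeff_summable, of "l2_norm M h"]])
         (use Yn[OF h] in \<open>auto simp: l2_norm_scale sqrt_coeff_nonneg intro!: mult_left_mono\<close>)
    obtain s where s: "s \<in> l2 M"
      "\<And>u. u \<in> l2 M \<Longrightarrow> (\<lambda>k. l2_inner M u (\<lambda>x. ?b k * (X ^^ k) h x)) sums l2_inner M u s"
      by (rule l2_series[OF l2_scale[OF Yl2[OF h]] sm]) blast
    then show ?thesis using l2_inner_scale_right[OF _ Yl2[OF h]] by auto
  qed
  then obtain S where S: "\<And>h. h \<in> l2 M \<Longrightarrow> S h \<in> l2 M"
    "\<And>u h. u \<in> l2 M \<Longrightarrow> h \<in> l2 M \<Longrightarrow> (\<lambda>k. ?b k * l2_inner M u ((X ^^ k) h)) sums l2_inner M u (S h)"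
    by metis
  define r where "r = 1 / sqrt \<kappa>"
  have r: "r > 0" "r * r * \<kappa> = 1" using \<kappa> by (auto simp: r_def field_simps)
  define P where "P h = (\<lambda>x. of_real r * (h x - S h x))" for h
  have Pl2: "P h \<in> l2 M" if "h \<in> l2 M" for h
    unfolding P_def using that S by (intro l2_scale l2_diff) auto
  have Pr: "l2_inner M u (P h) = of_real r * (l2_inner M u h - l2_inner M u (S h))" if "u \<in> l2 M" "h \<in> l2 M" for u h
    unfolding P_def
    using l2_inner_scale_right[of u M "\<lambda>x. h x - S h x" "of_real r"] l2_inner_diff_right[of u M h "S h"] that S l2_diff[of h M "S h"]
    by simp
  have Pl: "l2_inner M (P u) h = of_real r * (l2_inner M u h - l2_inner M (S u) h)" if "u \<in> l2 M" "h \<in> l2 M" for u h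
    unfolding P_def
    using l2_inner_scale_left[of h M "\<lambda>x. u x - S u x" "of_real r"] l2_inner_diff_left[of h M u "S u"] that S l2_diff[of u M "S u"]
    by simp
  have Ssym: "l2_inner M (S u) h = l2_inner M u (S h)" if u: "u \<in> l2 M" and h: "h \<in> l2 M" for u h
  proof -
    have "(\<lambda>k. cnj (?b k * l2_inner M h ((X ^^ k) u))) sums cnj (l2_inner M h (S u))"
      by (subst sums_cnj) (rule S(2)[OF h u])
    then have "(\<lambda>k. ?b k * l2_inner M u ((X ^^ k) h)) sums l2_inner M (S u) h"
      using Ys[OF u h] by (simp add: l2_inner_cnj)
    with S(2)[OF u h] show ?thesis using sums_unique2 by blast
  qed
  \<comment> \<open>The operator identity S S = 2 S - X in weak form. Its right side is the
    convolution identity for the coefficients, whose exceptional term n = 1 contributes - X.\<close>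
  have SS: "l2_inner M (S u) (S h) = 2 * l2_inner M u (S h) - l2_inner M u (X h)" if u: "u \<in> l2 M" and h: "h \<in> l2 M" for u h
  proof -
    define m where "m k = l2_inner M u ((X ^^ k) h)" for k
    have mb: "cmod (m k) \<le> l2_norm M u * l2_norm M h" for k
      unfolding m_def
      by (rule order_trans[OF l2_cauchy_schwarz[OF u Yl2[OF h]] mult_left_mono[OF Yn[OF h]]]) simp
    have in1: "(\<Sum>i. ?b i * m (i + j)) = l2_inner M (S u) ((X ^^ j) h)" for j
    proof -
      have "(\<lambda>i. ?b i * l2_inner M u ((X ^^ i) ((X ^^ j) h))) sums l2_inner M u (S ((X ^^ j) h))"
        by (rule S(2)[OF u Yl2[OF h]])
      then show ?thesis using Ssym[OF u Yl2[OF h]] by (simp add: m_def funpow_add sums_iff)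
    qed
    have "(\<lambda>j. ?b j * l2_inner M (S u) ((X ^^ j) h)) sums l2_inner M (S u) (S h)"
      by (rule S(2)[OF S(1)[OF u] h])
    then have "(\<Sum>j. ?b j * (\<Sum>i. ?b i * m (i + j))) = l2_inner M (S u) (S h)"
      unfolding in1 by (rule sums_unique[symmetric])
    then have "(\<lambda>n. of_real (\<Sum>i\<le>n. sqrt_coeff i * sqrt_coeff (n - i)) * m n) sums l2_inner M (S u) (S h)"
      using weighted_cauchy_product_sums[of sqrt_coeff m, OF sqrt_coeff_nonneg sqrt_coeff_summable mb] by simp
    moreover have "(\<lambda>n. of_real (\<Sum>i\<le>n. sqrt_coeff i * sqrt_coeff (n - i)) * m n) sums
        (2 * l2_inner M u (S h) - m 1)"
    proof -
      have "(\<lambda>n. 2 * (?b n * m n) - (if n = 1 then m 1 else 0)) sums (2 * l2_inner M u (S h) - m 1)"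
        using S(2)[OF u h] sums_single[of 1 "\<lambda>_. m 1"] by (intro sums_diff sums_mult) (auto simp: m_def)
      then show ?thesis unfolding sqrt_coeff_convolution
        by (rule sums_cong[THEN iffD1, rotated]) (auto simp: algebra_simps)
    qed
    ultimately show ?thesis using sums_unique2 by (fastforce simp: m_def)
  qed
  \<comment> \<open>With S S = 2 S - X the square of r (1 - S) is r^2 (1 - X) = r^2 \<kappa> T' T =
    T' T.\<close>
  have PP: "l2_inner M (P u) (P h) = l2_inner M (T u) (T h)" if u: "u \<in> l2 M" and h: "h \<in> l2 M" for u h
  proof -
    have "l2_inner M (P u) (P h) = of_real (r * r) * (l2_inner M u h - l2_inner M u (S h)
        - (l2_inner M (S u) h - l2_inner M (S u) (S h)))"
      using Pr[OF Pl2[OF u] h] Pl[OF u h] Pl[OF u S(1)[OF h]] by (simp add: algebra_simps)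
    also have "\<dots> = of_real (r * r) * (l2_inner M u h - l2_inner M u (X h))"
      using Ssym[OF u h] SS[OF u h] by simp
    also have "\<dots> = of_real (r * r * \<kappa>) * l2_inner M (T u) (T h)" by (simp add: Xr[OF u h])
    finally show ?thesis using r by simp
  qed
  \<comment> \<open>The map \<open>S\<close> was obtained by choice, so only linearity almost
    everywhere can be expected; it follows by moving the symmetric P to the test function.\<close>
  have lin: "AE x in M. P (\<lambda>y. c * u y + h y) x = c * P u x + P h x" if u: "u \<in> l2 M" and h: "h \<in> l2 M" for u h c
  proof (rule l2_eq_weak)
    have uh: "(\<lambda>y. c * u y + h y) \<in> l2 M" using u h by (rule l2_lincomb)
    show "P (\<lambda>y. c * u y + h y) \<in> l2 M" by (rule Pl2[OF uh])
    show "(\<lambda>x. c * P u x + P h x) \<in> l2 M" using Pl2 u h by (intro l2_lincomb)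
    fix v assume v: "v \<in> l2 M"
    have Psym: "l2_inner M v (P w) = l2_inner M (P v) w" if "w \<in> l2 M" for w
      using Pr[OF v that] Pl[OF v that] Ssym[OF v that] by simp
    show "l2_inner M v (P (\<lambda>y. c * u y + h y)) = l2_inner M v (\<lambda>x. c * P u x + P h x)"
      unfolding Psym[OF uh] l2_inner_right[OF Pl2[OF v] u h] l2_inner_right[OF v Pl2[OF u] Pl2[OF h]]
      using Psym u h by simp
  qed
  have "l2_norm M (P h) = l2_norm M (T h)" if "h \<in> l2 M" for h
  proof -
    have "(l2_norm M (P h))\<^sup>2 = (l2_norm M (T h))\<^sup>2"
      using PP[OF that that] unfolding l2_inner_self of_real_eq_iff .
    then show ?thesis by simp
  qed
  then have bnd: "\<exists>C. \<forall>h\<in>l2 M. l2_norm M (P h) \<le> C * l2_norm M h" using T(2) by metis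
  \<comment> \<open>The moments \<langle>h, X^k h\<rangle> are real by symmetry and at most |h|^2 by
    contraction, so \<langle>h, S h\<rangle> is at most |h|^2 times the sum of the coefficients,
    which does not exceed 1.\<close>
  have pos: "l2_inner M h (P h) \<in> \<real> \<and> 0 \<le> Re (l2_inner M h (P h))" if h: "h \<in> l2 M" for h
  proof -
    define m where "m k = Re (l2_inner M h ((X ^^ k) h))" for k
    have mr: "l2_inner M h ((X ^^ k) h) = of_real (m k)" for k
    proof -
      have "cnj (l2_inner M h ((X ^^ k) h)) = l2_inner M h ((X ^^ k) h)"
        using Ys[OF h h, of k] by (simp add: l2_inner_cnj)
      then show ?thesis unfolding m_def by (metis Reals_cnj_iff of_real_Re)
    qed
    have mb: "m k \<le> (l2_norm M h)\<^sup>2" for k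
    proof -
      have "m k \<le> cmod (l2_inner M h ((X ^^ k) h))" unfolding m_def by (rule complex_Re_le_cmod)
      also have "\<dots> \<le> l2_norm M h * l2_norm M h"
        by (rule order_trans[OF l2_cauchy_schwarz[OF h Yl2[OF h]] mult_left_mono[OF Yn[OF h]]]) simp
      finally show ?thesis by (simp add: power2_eq_square)
    qed
    have sumsm: "(\<lambda>k. complex_of_real (sqrt_coeff k * m k)) sums l2_inner M h (S h)"
      using S(2)[OF h h] by (simp add: mr)
    then have reS: "(\<lambda>k. sqrt_coeff k * m k) sums Re (l2_inner M h (S h))" using sums_Re by fastforce
    have "(\<lambda>k. Im (complex_of_real (sqrt_coeff k * m k))) sums Im (l2_inner M h (S h))"
      by (rule sums_Im[OF sumsm])
    then have im0: "Im (l2_inner M h (S h)) = 0" using sums_unique2[OF _ sums_zero] by fastforce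
    have "Re (l2_inner M h (S h)) \<le> suminf sqrt_coeff * (l2_norm M h)\<^sup>2"
      by (rule sums_le[OF _ reS sums_mult2[OF summable_sums[OF sqrt_coeff_summable]]])
         (auto intro!: mult_left_mono mb sqrt_coeff_nonneg)
    also have "\<dots> \<le> 1 * (l2_norm M h)\<^sup>2" by (intro mult_right_mono sqrt_coeff_suminf_le) simp
    finally have "Re (l2_inner M h (S h)) \<le> (l2_norm M h)\<^sup>2" by simp
    moreover have "l2_inner M h (P h) = of_real (r * ((l2_norm M h)\<^sup>2 - Re (l2_inner M h (S h))))"
      using Pr[OF h h] im0 by (simp add: l2_inner_self complex_eq_iff)
    ultimately show ?thesis using r by simp
  qed
  have "l2_absolute_value M T P"
    unfolding l2_absolute_value_def l2_positive_operator_def l2_bounded_operator_def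
    using Pl2 lin bnd pos PP by blast
  then show ?thesis unfolding T_def by blast
qed

text \<open>Gram-Schmidt on the first components of a linear relation, while the second components
  undergo the same linear combinations; it is applied to the pairs (P u, T u). The last conclusion,
  equality in Bessel's inequality, says that up to null functions the first components of
  \<open>F\<close> lie in the span of the \<open>ws\<close>.\<close>

lemma l2_gram_schmidt:
  fixes D :: "(('a \<Rightarrow> complex) \<times> ('b \<Rightarrow> complex)) set"
  assumes l2: "\<And>w z. (w, z) \<in> D \<Longrightarrow> w \<in> l2 M"
    and lin: "\<And>w z w' z' c. (w, z) \<in> D \<Longrightarrow> (w', z') \<in> D \<Longrightarrow> (\<lambda>x. c * w x + w' x, \<lambda>x. c * z x + z' x) \<in> D"
    and F: "finite F" "F \<subseteq> D"
  obtains n :: nat and ws :: "nat \<Rightarrow> 'a \<Rightarrow> complex" and zs :: "nat \<Rightarrow> 'b \<Rightarrow> complex"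
  where "\<And>k. k < n \<Longrightarrow> (ws k, zs k) \<in> D"
    "\<And>k l. k < n \<Longrightarrow> l < n \<Longrightarrow> l2_inner M (ws k) (ws l) = (if k = l then 1 else 0)"
    "\<And>w z. (w, z) \<in> F \<Longrightarrow> (l2_norm M w)\<^sup>2 = (\<Sum>k<n. (cmod (l2_inner M (ws k) w))\<^sup>2)"
proof -
  have "\<exists>(n::nat) ws zs. (\<forall>k<n. (ws k, zs k) \<in> D) \<and>
      (\<forall>k<n. \<forall>l<n. l2_inner M (ws k) (ws l) = (if k = l then 1 else 0)) \<and>
      (\<forall>(w, z)\<in>F. (l2_norm M w)\<^sup>2 = (\<Sum>k<n. (cmod (l2_inner M (ws k) w))\<^sup>2))"
    using F
  proof (induction F)
    case empty
    show ?case by (intro exI[of _ "0::nat"]) auto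
  next
    case (insert d F)
    obtain n :: nat and ws zs where IH': "(\<forall>k<n. (ws k, zs k) \<in> D) \<and>
      (\<forall>k<n. \<forall>l<n. l2_inner M (ws k) (ws l) = (if k = l then 1 else 0)) \<and>
      (\<forall>(w, z)\<in>F. (l2_norm M w)\<^sup>2 = (\<Sum>k<n. (cmod (l2_inner M (ws k) w))\<^sup>2))"
      using insert.IH insert.prems by auto
    have IH: "(ws k, zs k) \<in> D" "l < n \<Longrightarrow> l2_inner M (ws k) (ws l) = (if k = l then 1 else 0)" if "k < n" for k l
      using IH' that by simp_all
    have IH3: "(l2_norm M w)\<^sup>2 = (\<Sum>k<n. (cmod (l2_inner M (ws k) w))\<^sup>2)" if "(w, z) \<in> F" for w z
      using IH' that by fast
    obtain w z where d: "d = (w, z)" by (cases d)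
    have wD: "(w, z) \<in> D" using insert.prems d by auto
    note w = l2[OF wD]
    have wsl2: "ws k \<in> l2 M" if "k < n" for k using l2[OF IH(1)[OF that]] .
    define r where "r = (\<lambda>x. w x - (\<Sum>k<n. l2_inner M (ws k) w * ws k x))"
    define q where "q = (\<lambda>x. z x - (\<Sum>k<n. l2_inner M (ws k) w * zs k x))"
    have rD: "(r, q) \<in> D"
    proof -
      have "(\<lambda>x. w x - (\<Sum>k<m. l2_inner M (ws k) w * ws k x), \<lambda>x. z x - (\<Sum>k<m. l2_inner M (ws k) w * zs k x)) \<in> D"
        if "m \<le> n" for m
        using that
      proof (induction m)
        case (Suc m)
        then show ?case
          using lin[OF IH(1)[of m] Suc.IH, of "- l2_inner M (ws m) w"] by (simp add: algebra_simps)
      qed (simp add: wD)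
      then show ?thesis unfolding r_def q_def by blast
    qed
    note res = l2_orthonormal_residual[of "{..<n}" ws M w, folded r_def, OF finite_lessThan _ w]
    have res2: "l2_inner M (ws j) r = 0" if "j < n" for j using res(2) wsl2 IH(2) that by auto
    have res3: "l2_inner M r r = of_real ((l2_norm M w)\<^sup>2 - (\<Sum>k<n. (cmod (l2_inner M (ws k) w))\<^sup>2))"
      and res4: "l2_inner M r w = l2_inner M r r" using res(3,4) wsl2 IH(2) by auto
    define \<rho> where "\<rho> = l2_norm M r"
    have \<rho>2: "\<rho>\<^sup>2 = (l2_norm M w)\<^sup>2 - (\<Sum>k<n. (cmod (l2_inner M (ws k) w))\<^sup>2)"
      using res3 unfolding l2_inner_self \<rho>_def of_real_eq_iff .
    show ?case
    proof (cases "\<rho> = 0")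
      case True
      then have "(l2_norm M w)\<^sup>2 = (\<Sum>k<n. (cmod (l2_inner M (ws k) w))\<^sup>2)" using \<rho>2 by simp
      then show ?thesis using IH' d by (intro exI[of _ n] exI[of _ ws] exI[of _ zs]) simp
    next
      case False
      then have \<rho>: "\<rho> > 0" unfolding \<rho>_def using l2_norm_nonneg[of M r] by linarith
      define w' where "w' = (\<lambda>x. of_real (1 / \<rho>) * r x)"
      define z' where "z' = (\<lambda>x. of_real (1 / \<rho>) * q x)"
      have rl2: "r \<in> l2 M" using l2[OF rD] .
      \<comment> \<open>Closure under c w + w' is applied with w = w' = r and c = 1/\<rho> - 1,
        which amounts to scaling by 1/\<rho>.\<close>
      have w'D: "(w', z') \<in> D"
        using lin[OF rD rD, of "of_real (1 / \<rho>) - 1"] by (simp add: w'_def z'_def algebra_simps)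
      have w'1: "l2_inner M w' w' = 1"
      proof -
        have "l2_inner M w' w' = of_real (1 / \<rho>) * (of_real (1 / \<rho>) * l2_inner M r r)"
          unfolding w'_def l2_inner_scale_left[OF l2_scale[OF rl2] rl2] l2_inner_scale_right[OF rl2 rl2] by simp
        then show ?thesis using \<rho> by (simp add: l2_inner_self \<rho>_def[symmetric] power2_eq_square)
      qed
      have w'0: "l2_inner M (ws k) w' = 0" "l2_inner M w' (ws k) = 0" if "k < n" for k
      proof -
        show *: "l2_inner M (ws k) w' = 0"
          unfolding w'_def l2_inner_scale_right[OF wsl2[OF that] rl2] res2[OF that] by simp
        then show "l2_inner M w' (ws k) = 0" using l2_inner_cnj[of M "ws k" w'] by simp
      qed
      let ?ws = "ws(n := w')" and ?zs = "zs(n := z')"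
      have D': "(?ws k, ?zs k) \<in> D" if "k < Suc n" for k using that IH(1) w'D by (auto simp: less_Suc_eq)
      have on': "l2_inner M (?ws k) (?ws l) = (if k = l then 1 else 0)" if "k < Suc n" "l < Suc n" for k l
        using that IH(2) w'1 w'0 by (auto simp: less_Suc_eq)
      have sum': "(\<Sum>k<Suc n. (cmod (l2_inner M (?ws k) v))\<^sup>2)
          = (\<Sum>k<n. (cmod (l2_inner M (ws k) v))\<^sup>2) + (cmod (l2_inner M w' v))\<^sup>2" for v
        by simp
      have bess: "(\<Sum>k<Suc n. (cmod (l2_inner M (?ws k) v))\<^sup>2) \<le> (l2_norm M v)\<^sup>2" if "v \<in> l2 M" for v
        by (rule l2_bessel) (use that l2[OF D'] on' in auto)
      have "(l2_norm M v)\<^sup>2 = (\<Sum>k<Suc n. (cmod (l2_inner M (?ws k) v))\<^sup>2)" if "(v, y) \<in> insert d F" for v y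
      proof (cases "(v, y) \<in> F")
        case True
        have "v \<in> l2 M" using True insert.prems l2 by blast
        \<comment> \<open>The additional vector can only enlarge a sum that already equals |v|^2,
          and Bessel's inequality forbids a strict increase.\<close>
        from bess[OF this] show ?thesis using IH3[OF True] unfolding sum' by (smt (verit) zero_le_power2)
      next
        case False
        then have v: "v = w" using that d by auto
        have "l2_inner M w' w = of_real (1 / \<rho>) * of_real (\<rho>\<^sup>2)"
          unfolding w'_def l2_inner_scale_left[OF w rl2] res4 by (simp add: l2_inner_self \<rho>_def)
        then have "cmod (l2_inner M w' w) = \<rho>" using \<rho> by (simp add: power2_eq_square norm_mult norm_divide)
        then show ?thesis unfolding v sum' using \<rho>2 by simp
      qed
      then show ?thesis using D' on'
        by (intro exI[of _ "Suc n"] exI[of _ ?ws] exI[of _ ?zs]) (auto simp del: fun_upd_apply sum.lessThan_Suc)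
    qed
  qed
  then obtain n :: nat and ws zs where *: "(\<forall>k<n. (ws k, zs k) \<in> D) \<and>
      (\<forall>k<n. \<forall>l<n. l2_inner M (ws k) (ws l) = (if k = l then 1 else 0)) \<and>
      (\<forall>(w, z)\<in>F. (l2_norm M w)\<^sup>2 = (\<Sum>k<n. (cmod (l2_inner M (ws k) w))\<^sup>2))"
    by blast
  show ?thesis by (rule that[of n ws zs]) (use * in \<open>simp; fast\<close>)+
qed

section \<open>Trace class operators\<close>

lemma l2_norm_cnj: "l2_norm M (\<lambda>x. cnj (h x)) = l2_norm M h"
  by (simp add: l2_norm_def)

lemma l2_bounded_operatorD:
  assumes "l2_bounded_operator M T"
  shows "h \<in> l2 M \<Longrightarrow> T h \<in> l2 M"
    "g \<in> l2 M \<Longrightarrow> h \<in> l2 M \<Longrightarrow> AE x in M. T (\<lambda>y. c * g y + h y) x = c * T g x + T h x"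
  using assms unfolding l2_bounded_operator_def by auto

text \<open>On the span of the \<open>P e\<close> the map \<open>P e \<mapsto> T e\<close> is isometric. Applied to the projection of \<open>e\<close>
  to this span it gives a vector \<open>y e\<close> with \<open>\<langle>e, P e\<rangle> = \<langle>y e, T e\<rangle>\<close>, as in the polar decomposition.\<close>

lemma l2_absolute_value_polar:
  assumes T: "l2_bounded_operator M T" and P: "l2_absolute_value M T P"
    and E: "finite E" "E \<subseteq> l2 M"
  obtains n :: nat and ws zs where
    "\<And>k. k < n \<Longrightarrow> ws k \<in> l2 M" "\<And>k. k < n \<Longrightarrow> zs k \<in> l2 M"
    "\<And>k l. k < n \<Longrightarrow> l < n \<Longrightarrow> l2_inner M (ws k) (ws l) = (if k = l then 1 else 0)"
    "\<And>k l. k < n \<Longrightarrow> l < n \<Longrightarrow> l2_inner M (zs k) (zs l) = (if k = l then 1 else 0)"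
    "\<And>e. e \<in> E \<Longrightarrow> l2_inner M e (P e) = l2_inner M (\<lambda>x. \<Sum>k<n. l2_inner M (ws k) e * zs k x) (T e)"
proof -
  have Pb: "l2_bounded_operator M P"
    and iso: "\<And>g h. g \<in> l2 M \<Longrightarrow> h \<in> l2 M \<Longrightarrow> l2_inner M (P g) (P h) = l2_inner M (T g) (T h)"
    using P unfolding l2_absolute_value_def l2_positive_operator_def by auto
  note Pd = l2_bounded_operatorD[OF Pb] and Td = l2_bounded_operatorD[OF T]
  \<comment> \<open>Pairs that agree almost everywhere with some (P u, T u). Since P and T are
    linear only almost everywhere, the pairs (P u, T u) themselves need not be closed under linear
    combinations.\<close>
  define D where "D = {(w, z). w \<in> l2 M \<and> z \<in> l2 M \<and>
    (\<exists>u\<in>l2 M. (AE x in M. w x = P u x) \<and> (AE x in M. z x = T u x))}"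
  have Dl2: "w \<in> l2 M" "z \<in> l2 M" if "(w, z) \<in> D" for w z using that by (auto simp: D_def)
  have Diso: "l2_inner M w w' = l2_inner M z z'" if d: "(w, z) \<in> D" and d': "(w', z') \<in> D" for w z w' z'
  proof -
    obtain u where u: "u \<in> l2 M" "AE x in M. w x = P u x" "AE x in M. z x = T u x"
      using d by (auto simp: D_def)
    obtain u' where u': "u' \<in> l2 M" "AE x in M. w' x = P u' x" "AE x in M. z' x = T u' x"
      using d' by (auto simp: D_def)
    have "l2_inner M w w' = l2_inner M (P u) (P u')"
      using Dl2 d d' Pd(1) u u' by (intro l2_inner_cong_AE) auto
    also have "\<dots> = l2_inner M (T u) (T u')" by (rule iso[OF u(1) u'(1)])
    also have "\<dots> = l2_inner M z z'"
      using Dl2 d d' Td(1) u u' by (intro l2_inner_cong_AE) (auto elim: eventually_mono)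
    finally show ?thesis .
  qed
  have Dlin: "(\<lambda>x. c * w x + w' x, \<lambda>x. c * z x + z' x) \<in> D" if d: "(w, z) \<in> D" and d': "(w', z') \<in> D" for w z w' z' c
  proof -
    obtain u where u: "u \<in> l2 M" "AE x in M. w x = P u x" "AE x in M. z x = T u x"
      using d by (auto simp: D_def)
    obtain u' where u': "u' \<in> l2 M" "AE x in M. w' x = P u' x" "AE x in M. z' x = T u' x"
      using d' by (auto simp: D_def)
    have "AE x in M. c * w x + w' x = P (\<lambda>y. c * u y + u' y) x"
      using Pd(2)[OF u(1) u'(1), of c] u(2) u'(2) by eventually_elim simp
    moreover have "AE x in M. c * z x + z' x = T (\<lambda>y. c * u y + u' y) x"
      using Td(2)[OF u(1) u'(1), of c] u(3) u'(3) by eventually_elim simp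
    moreover have "(\<lambda>y. c * u y + u' y) \<in> l2 M" using u u' by (intro l2_lincomb)
    ultimately show ?thesis
      unfolding D_def using Dl2[OF d] Dl2[OF d'] by (auto intro!: l2_lincomb)
  qed
  let ?F = "(\<lambda>e. (P e, T e)) ` E"
  have F: "finite ?F" "?F \<subseteq> D" using E Pd(1) Td(1) by (auto simp: D_def)
  obtain n :: nat and ws zs where gs: "\<And>k. k < n \<Longrightarrow> (ws k, zs k) \<in> D"
    "\<And>k l. k < n \<Longrightarrow> l < n \<Longrightarrow> l2_inner M (ws k) (ws l) = (if k = l then 1 else 0)"
    "\<And>w z. (w, z) \<in> ?F \<Longrightarrow> (l2_norm M w)\<^sup>2 = (\<Sum>k<n. (cmod (l2_inner M (ws k) w))\<^sup>2)"
    by (rule l2_gram_schmidt[OF Dl2(1) Dlin F]) blast+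
  note wz = Dl2[OF gs(1)]
  have "l2_inner M e (P e) = l2_inner M (\<lambda>x. \<Sum>k<n. l2_inner M (ws k) e * zs k x) (T e)" if e: "e \<in> E" for e
  proof -
    have el2: "e \<in> l2 M" using e E by auto
    define p where "p = (\<lambda>x. \<Sum>k<n. l2_inner M (ws k) (P e) * ws k x)"
    define r where "r = (\<lambda>x. P e x - (\<Sum>k<n. l2_inner M (ws k) (P e) * ws k x))"
    note res = l2_orthonormal_residual[of "{..<n}" ws M "P e", folded r_def]
    have r: "r \<in> l2 M" and rr: "l2_inner M r r = 0"
      using res(1,3) wz(1) gs(2) Pd(1)[OF el2] gs(3)[of "P e" "T e"] e by auto
    have pl2: "p \<in> l2 M" unfolding p_def using wz(1) by (intro l2_sum) auto
    have "AE x in M. r x = 0" using rr by (intro l2_norm_eq_0[OF r]) (simp add: l2_inner_self)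
    then have "AE x in M. P e x = p x" by (simp add: r_def p_def)
    then have "l2_inner M e (P e) = l2_inner M e p"
      using el2 Pd(1)[OF el2] pl2 by (intro l2_inner_cong_AE) auto
    also have "\<dots> = (\<Sum>k<n. l2_inner M (ws k) (P e) * l2_inner M e (ws k))"
      unfolding p_def using wz(1) el2 by (intro l2_inner_sum_right) auto
    \<comment> \<open>Here the isometry P u \<mapsto> T u enters: it sends the pair ws k, P e to zs
      k, T e.\<close>
    also have "\<dots> = (\<Sum>k<n. cnj (l2_inner M (ws k) e) * l2_inner M (zs k) (T e))"
      using Diso[OF gs(1)] F(2) e by (intro sum.cong refl) (auto simp: l2_inner_cnj mult.commute)
    also have "\<dots> = l2_inner M (\<lambda>x. \<Sum>k<n. l2_inner M (ws k) e * zs k x) (T e)"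
      by (rule l2_inner_sum_left[symmetric]) (use wz(2) Td(1)[OF el2] in auto)
    finally show ?thesis .
  qed
  moreover have "l2_inner M (zs k) (zs l) = (if k = l then 1 else 0)" if "k < n" "l < n" for k l
    using Diso[OF gs(1)[OF that(1)] gs(1)[OF that(2)]] gs(2)[OF that] by simp
  ultimately show ?thesis using that[of n ws zs] wz gs(2) by blast
qed

lemma kernel_apply_comp:
  assumes M: "sigma_finite_measure M" and Z: "sigma_finite_measure Z"
    and G: "dominated_kernel X Z G" and F: "dominated_kernel Z M F"
    and h: "h \<in> l2 M" and x: "x \<in> space X"
  shows "kernel_apply M (kernel_comp Z G F) h x = kernel_apply Z G (kernel_apply M F h) x"
proof -
  have Gx: "(\<lambda>z. cnj (G x z)) \<in> l2 Z" by (rule kernel_section_l2(1)[OF G x])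
  interpret pair_sigma_finite Z M using Z M by (rule pair_sigma_finite.intro)
  have int: "integrable (Z \<Otimes>\<^sub>M M) (\<lambda>(z, y). G x z * (F z y * h y))"
    using kernel_apply_adjoint_integrable[OF Z M F Gx h] by simp
  have "kernel_apply M (kernel_comp Z G F) h x = (LINT y|M. LINT z|Z. G x z * (F z y * h y))"
    unfolding kernel_apply_def kernel_comp_def by (simp add: mult.assoc flip: integral_mult_left_zero)
  also have "\<dots> = (LINT z|Z. LINT y|M. G x z * (F z y * h y))"
    by (rule Fubini_integral[OF int])
  also have "\<dots> = kernel_apply Z G (kernel_apply M F h) x" by (simp add: kernel_apply_def)
  finally show ?thesis .
qed

text \<open>For T = G F the vectors y e of the polar decomposition give \<langle>e, |T| e\<rangle> =
  \<langle>p e, q e\<rangle>, where q e = F e and p e is the adjoint of G applied to y e. At each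
  point s of Z the product of their moduli is at most half the sum of the squares, and Bessel's
  inequality, summed over e, bounds these by the squared norms of the sections of F and G at s. The
  integral over s does not depend on the finite orthonormal set, so the nonnegative diagonal terms
  are summable.\<close>

lemma l2_trace_class_comp:
  assumes M: "sigma_finite_measure M" and Z: "sigma_finite_measure Z"
    and G: "dominated_kernel M Z G" and F: "dominated_kernel Z M F"
  shows "l2_trace_class M (kernel_apply M (kernel_comp Z G F))"
proof -
  define K where "K = kernel_comp Z G F"
  define T where "T = kernel_apply M K"
  have K: "dominated_kernel M M K" unfolding K_def by (rule dominated_kernel_comp[OF G F Z])
  have T: "l2_bounded_operator M T" unfolding T_def by (rule l2_bounded_operator_kernel_apply[OF M K])
  obtain P where P: "l2_absolute_value M T P" using l2_absolute_value_exists[OF M K] unfolding T_def by blast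
  obtain f f' where df: "dominates Z M f f' F" using F unfolding dominated_kernel_def by blast
  obtain g g' where dg: "dominates M Z g g' G" using G unfolding dominated_kernel_def by blast
  define B where "B s = ((g' s)\<^sup>2 * (LINT x|M. (g x)\<^sup>2) + (f s)\<^sup>2 * (LINT y|M. (f' y)\<^sup>2)) / 2" for s
  have Bint: "integrable Z B" unfolding B_def using dominatesD(4)[OF dg] dominatesD(3)[OF df] by simp
  have secF: "(l2_norm M (F s))\<^sup>2 \<le> (f s)\<^sup>2 * (LINT y|M. (f' y)\<^sup>2)" if s: "s \<in> space Z" for s
  proof -
    have "(l2_norm M (F s))\<^sup>2 = (LINT y|M. (cmod (F s y))\<^sup>2)" by (simp add: l2_norm_def)
    also have "\<dots> \<le> (LINT y|M. (f s)\<^sup>2 * (f' y)\<^sup>2)"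
    proof (rule integral_mono)
      show "integrable M (\<lambda>y. (cmod (F s y))\<^sup>2)" using kernel_section_l2(2)[OF F s] by (rule l2D)
      show "integrable M (\<lambda>y. (f s)\<^sup>2 * (f' y)\<^sup>2)" using dominatesD(4)[OF df] by simp
      show "(cmod (F s y))\<^sup>2 \<le> (f s)\<^sup>2 * (f' y)\<^sup>2" if "y \<in> space M" for y
        using power_mono[OF dominatesD(8)[OF df s that], of 2] by (simp add: power_mult_distrib)
    qed
    finally show ?thesis by simp
  qed
  have dG': "dominates Z M g' g (\<lambda>s x. cnj (G x s))" by (rule dominates_adjoint[OF dg])
  then have G': "dominated_kernel Z M (\<lambda>s x. cnj (G x s))" by (auto simp: dominated_kernel_def)
  have secG: "(l2_norm M (\<lambda>x. G x s))\<^sup>2 \<le> (g' s)\<^sup>2 * (LINT y|M. (g y)\<^sup>2)" if s: "s \<in> space Z" for s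
  proof -
    have "(l2_norm M (\<lambda>x. G x s))\<^sup>2 = (LINT y|M. (cmod (G y s))\<^sup>2)" by (simp add: l2_norm_def)
    also have "\<dots> \<le> (LINT y|M. (g' s)\<^sup>2 * (g y)\<^sup>2)"
    proof (rule integral_mono)
      show "integrable M (\<lambda>y. (cmod (G y s))\<^sup>2)" using kernel_section_l2(1)[OF G' s] l2D(2) by force
      show "integrable M (\<lambda>y. (g' s)\<^sup>2 * (g y)\<^sup>2)" using dominatesD(3)[OF dg] by simp
      show "(cmod (G y s))\<^sup>2 \<le> (g' s)\<^sup>2 * (g y)\<^sup>2" if "y \<in> space M" for y
        using power_mono[OF dominatesD(8)[OF dg that s], of 2] by (simp add: power_mult_distrib mult.commute)
    qed
    finally show ?thesis by simp
  qed
  have bound: "(\<Sum>e\<in>E0. Re (l2_inner M e (P e))) \<le> (LINT s|Z. B s)"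
    if E: "finite E0" "E0 \<subseteq> l2 M" and on: "\<And>e e'. e \<in> E0 \<Longrightarrow> e' \<in> E0 \<Longrightarrow> l2_inner M e e' = (if e = e' then 1 else 0)" for E0
  proof -
    obtain n :: nat and ws zs where wz: "\<And>k. k < n \<Longrightarrow> ws k \<in> l2 M" "\<And>k. k < n \<Longrightarrow> zs k \<in> l2 M"
      "\<And>k l. k < n \<Longrightarrow> l < n \<Longrightarrow> l2_inner M (ws k) (ws l) = (if k = l then 1 else 0)"
      "\<And>k l. k < n \<Longrightarrow> l < n \<Longrightarrow> l2_inner M (zs k) (zs l) = (if k = l then 1 else 0)"
      "\<And>e. e \<in> E0 \<Longrightarrow> l2_inner M e (P e) = l2_inner M (\<lambda>x. \<Sum>k<n. l2_inner M (ws k) e * zs k x) (T e)"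
      by (rule l2_absolute_value_polar[OF T P E]) blast
    define y where "y e = (\<lambda>x. \<Sum>k<n. l2_inner M (ws k) e * zs k x)" for e
    define q where "q e = kernel_apply M F e" for e
    define p where "p e = kernel_apply M (\<lambda>s x. cnj (G x s)) (y e)" for e
    have el2: "e \<in> l2 M" if "e \<in> E0" for e using that E by auto
    have yl2: "y e \<in> l2 M" for e unfolding y_def using wz(2) by (intro l2_sum) auto
    have ql2: "q e \<in> l2 Z" if "e \<in> E0" for e
      unfolding q_def by (rule kernel_apply_l2(1)[OF M df el2[OF that]])
    have pl2: "p e \<in> l2 Z" for e
      unfolding p_def by (rule kernel_apply_l2(1)[OF M dG' yl2])
    have eq: "l2_inner M e (P e) = l2_inner Z (p e) (q e)" if e: "e \<in> E0" for e
    proof -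
      have "l2_inner M e (P e) = l2_inner M (y e) (T e)" unfolding y_def by (rule wz(5)[OF e])
      also have "\<dots> = l2_inner M (y e) (kernel_apply Z G (q e))"
        unfolding l2_inner_def T_def K_def q_def
        by (intro Bochner_Integration.integral_cong) (auto simp: kernel_apply_comp[OF M Z G F el2[OF e]])
      also have "\<dots> = l2_inner Z (p e) (q e)"
        unfolding p_def by (rule kernel_apply_adjoint[OF M Z G yl2 ql2[OF e]])
      finally show ?thesis .
    qed
    have Re_le: "Re (l2_inner M e (P e)) \<le> (LINT s|Z. cmod (p e s) * cmod (q e s))" if e: "e \<in> E0" for e
    proof -
      have "Re (l2_inner M e (P e)) \<le> cmod (LINT s|Z. cnj (p e s) * q e s)"
        using complex_Re_le_cmod[of "l2_inner Z (p e) (q e)"] unfolding eq[OF e] by (simp add: l2_inner_def)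
      also have "\<dots> \<le> (LINT s|Z. cmod (cnj (p e s) * q e s))" by (rule integral_norm_bound)
      finally show ?thesis by (simp add: norm_mult)
    qed
    have "(\<Sum>e\<in>E0. Re (l2_inner M e (P e))) \<le> (\<Sum>e\<in>E0. LINT s|Z. cmod (p e s) * cmod (q e s))"
      by (intro sum_mono Re_le)
    also have "\<dots> = (LINT s|Z. (\<Sum>e\<in>E0. cmod (p e s) * cmod (q e s)))"
      by (rule Bochner_Integration.integral_sum[symmetric]) (intro l2_norm_mult_integrable pl2 ql2)
    also have "\<dots> \<le> (LINT s|Z. B s)"
    proof (rule integral_mono)
      show "integrable Z (\<lambda>s. \<Sum>e\<in>E0. cmod (p e s) * cmod (q e s))"
        by (intro Bochner_Integration.integrable_sum l2_norm_mult_integrable pl2 ql2)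
      show "integrable Z B" by (rule Bint)
      fix s assume s: "s \<in> space Z"
      have Fs: "(\<lambda>x. cnj (F s x)) \<in> l2 M" by (rule kernel_section_l2(1)[OF F s])
      have Gs: "(\<lambda>x. G x s) \<in> l2 M" using kernel_section_l2(1)[OF G' s] by simp
      have q2: "(\<Sum>e\<in>E0. (cmod (q e s))\<^sup>2) \<le> (f s)\<^sup>2 * (LINT y|M. (f' y)\<^sup>2)"
      proof -
        have "cmod (q e s) = cmod (l2_inner M e (\<lambda>x. cnj (F s x)))" for e
        proof -
          have "q e s = l2_inner M (\<lambda>x. cnj (F s x)) e" by (simp add: q_def kernel_apply_def l2_inner_def)
          then show ?thesis using l2_inner_cnj[of M e "\<lambda>x. cnj (F s x)"] by (metis complex_mod_cnj)
        qed
        then have "(\<Sum>e\<in>E0. (cmod (q e s))\<^sup>2) = (\<Sum>e\<in>E0. (cmod (l2_inner M e (\<lambda>x. cnj (F s x))))\<^sup>2)" by simp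
        also have "\<dots> \<le> (l2_norm M (\<lambda>x. cnj (F s x)))\<^sup>2"
          using l2_bessel[of E0 "\<lambda>e. e" M, OF E(1) el2 Fs on] by simp
        also have "\<dots> \<le> (f s)\<^sup>2 * (LINT y|M. (f' y)\<^sup>2)" unfolding l2_norm_cnj by (rule secF[OF s])
        finally show ?thesis .
      qed
      \<comment> \<open>The vectors \<open>y e\<close> need not be orthonormal, so Bessel's
        inequality does not apply to them directly. But \<open>p e s\<close> has the modulus of
        \<langle>e, v\<rangle>, where \<open>v\<close> is the section of G at s projected to the
        \<open>zs\<close> and carried back to the \<open>ws\<close>. Bessel's inequality is used for
        \<langle>e, v\<rangle> and again for the projection.\<close>
      have p2: "(\<Sum>e\<in>E0. (cmod (p e s))\<^sup>2) \<le> (g' s)\<^sup>2 * (LINT y|M. (g y)\<^sup>2)"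
      proof -
        define v where "v = (\<lambda>x. \<Sum>k<n. cnj (l2_inner M (\<lambda>x. G x s) (zs k)) * ws k x)"
        have vl2: "v \<in> l2 M" unfolding v_def using wz(1) by (intro l2_sum) auto
        have pe: "cmod (p e s) = cmod (l2_inner M e v)" if e: "e \<in> E0" for e
        proof -
          have "p e s = l2_inner M (\<lambda>x. G x s) (y e)" by (simp add: p_def kernel_apply_def l2_inner_def)
          also have "\<dots> = (\<Sum>k<n. l2_inner M (ws k) e * l2_inner M (\<lambda>x. G x s) (zs k))"
            unfolding y_def by (rule l2_inner_sum_right) (use wz Gs in auto)
          also have "\<dots> = l2_inner M v e"
            unfolding v_def using l2_inner_sum_left[of "{..<n}" ws M e "\<lambda>k. cnj (l2_inner M (\<lambda>x. G x s) (zs k))"] wz(1) el2[OF e]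
            by (simp add: mult.commute)
          finally show ?thesis using l2_inner_cnj[of M e v] by (metis complex_mod_cnj)
        qed
        then have "(\<Sum>e\<in>E0. (cmod (p e s))\<^sup>2) = (\<Sum>e\<in>E0. (cmod (l2_inner M e v))\<^sup>2)" by simp
        also have "\<dots> \<le> (l2_norm M v)\<^sup>2"
          using l2_bessel[of E0 "\<lambda>e. e" M, OF E(1) el2 vl2 on] by simp
        also have "\<dots> = (\<Sum>k<n. (cmod (cnj (l2_inner M (\<lambda>x. G x s) (zs k))))\<^sup>2)"
          unfolding v_def by (rule l2_norm_orthonormal_sum) (use wz in auto)
        also have "\<dots> = (\<Sum>k<n. (cmod (l2_inner M (zs k) (\<lambda>x. G x s)))\<^sup>2)"
          unfolding l2_inner_cnj ..
        also have "\<dots> \<le> (l2_norm M (\<lambda>x. G x s))\<^sup>2"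
          by (rule l2_bessel) (use wz Gs in auto)
        also have "\<dots> \<le> (g' s)\<^sup>2 * (LINT y|M. (g y)\<^sup>2)" by (rule secG[OF s])
        finally show ?thesis .
      qed
      have "(\<Sum>e\<in>E0. cmod (p e s) * cmod (q e s)) \<le> (\<Sum>e\<in>E0. ((cmod (p e s))\<^sup>2 + (cmod (q e s))\<^sup>2) / 2)"
      proof (intro sum_mono)
        fix e
        show "cmod (p e s) * cmod (q e s) \<le> ((cmod (p e s))\<^sup>2 + (cmod (q e s))\<^sup>2) / 2"
          using sum_squares_bound[of "cmod (p e s)" "cmod (q e s)"] by simp
      qed
      also have "\<dots> = ((\<Sum>e\<in>E0. (cmod (p e s))\<^sup>2) + (\<Sum>e\<in>E0. (cmod (q e s))\<^sup>2)) / 2"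
        by (simp add: sum.distrib flip: sum_divide_distrib)
      also have "\<dots> \<le> B s" unfolding B_def using p2 q2 by (intro divide_right_mono add_mono) auto
      finally show "(\<Sum>e\<in>E0. cmod (p e s) * cmod (q e s)) \<le> B s" .
    qed
    finally show ?thesis .
  qed
  have "(\<lambda>e. Re (l2_inner M e (P e))) summable_on E" if "l2_orthonormal_basis M E" for E
  proof (rule nonneg_bdd_above_summable_on)
    show "0 \<le> Re (l2_inner M e (P e))" if "e \<in> E" for e
      using that \<open>l2_orthonormal_basis M E\<close> P
      unfolding l2_orthonormal_basis_def l2_absolute_value_def l2_positive_operator_def by blast
    show "bdd_above (sum (\<lambda>e. Re (l2_inner M e (P e))) ` {F. F \<subseteq> E \<and> finite F})"
    proof (rule bdd_aboveI2)
      fix E0 assume E0: "E0 \<in> {F. F \<subseteq> E \<and> finite F}"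
      have "E \<subseteq> l2 M" "\<And>e e'. e \<in> E \<Longrightarrow> e' \<in> E \<Longrightarrow> l2_inner M e e' = (if e = e' then 1 else 0)"
        using that unfolding l2_orthonormal_basis_def by blast+
      with E0 show "(\<Sum>e\<in>E0. Re (l2_inner M e (P e))) \<le> (LINT s|Z. B s)"
        by (intro bound) blast+
    qed
  qed
  then show ?thesis unfolding l2_trace_class_def K_def[symmetric] T_def[symmetric] using T P by blast
qed

section \<open>Fredholm determinants of antidiagonal kernels\<close>

text \<open>Boxes determine the product measure, and relabelling only permutes the factors of their
  measure. It serves for permutations of {..<n} and for the shift that brings the coordinates {m..<m
  + m} back to {..<m}.\<close>

lemma distr_PiM_reindex_bij:
  assumes M: "sigma_finite_measure M" and I: "finite I" and p: "bij_betw p I J"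
  shows "distr (Pi\<^sub>M J (\<lambda>_. M)) (Pi\<^sub>M I (\<lambda>_. M)) (\<lambda>x. \<lambda>i\<in>I. x (p i)) = Pi\<^sub>M I (\<lambda>_. M)"
proof -
  interpret PI: product_sigma_finite "\<lambda>_::'b. M" by (simp add: product_sigma_finite_def M)
  interpret PJ: product_sigma_finite "\<lambda>_::'c. M" by (simp add: product_sigma_finite_def M)
  have J: "finite J" using I p by (metis bij_betw_finite)
  have m: "(\<lambda>x. \<lambda>i\<in>I. x (p i)) \<in> measurable (Pi\<^sub>M J (\<lambda>_. M)) (Pi\<^sub>M I (\<lambda>_. M))"
    using p by (intro measurable_restrict measurable_component_singleton) (auto simp: bij_betw_def)
  show ?thesis
  proof (rule PI.PiM_eqI[OF I])
    fix A assume A: "\<And>i. i \<in> I \<Longrightarrow> A i \<in> sets M"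
    define q where "q = inv_into I p"
    have q: "q j \<in> I" "p (q j) = j" if "j \<in> J" for j
      using that p unfolding q_def bij_betw_def by (auto simp: inv_into_into f_inv_into_f)
    have qp: "q (p i) = i" "p i \<in> J" if "i \<in> I" for i
      using that p unfolding q_def bij_betw_def by auto
    have "(\<lambda>x. \<lambda>i\<in>I. x (p i)) -` (Pi\<^sub>E I A) \<inter> space (Pi\<^sub>M J (\<lambda>_. M)) = Pi\<^sub>E J (\<lambda>j. A (q j))"
    proof (intro equalityI subsetI)
      fix x assume x: "x \<in> (\<lambda>x. \<lambda>i\<in>I. x (p i)) -` (Pi\<^sub>E I A) \<inter> space (Pi\<^sub>M J (\<lambda>_. M))"
      then have "x (p i) \<in> A i" if "i \<in> I" for i using that by (auto simp: PiE_iff)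
      then have "x j \<in> A (q j)" if "j \<in> J" for j using q[OF that] by metis
      then show "x \<in> Pi\<^sub>E J (\<lambda>j. A (q j))" using x by (auto simp: space_PiM PiE_iff)
    next
      fix x assume x: "x \<in> Pi\<^sub>E J (\<lambda>j. A (q j))"
      then have "x (p i) \<in> A i" if "i \<in> I" for i using qp[OF that] by (metis PiE_mem)
      moreover have "x \<in> space (Pi\<^sub>M J (\<lambda>_. M))"
        using x A q sets.sets_into_space by (fastforce simp: space_PiM PiE_iff)
      ultimately show "x \<in> (\<lambda>x. \<lambda>i\<in>I. x (p i)) -` (Pi\<^sub>E I A) \<inter> space (Pi\<^sub>M J (\<lambda>_. M))" by auto
    qed
    then have "emeasure (distr (Pi\<^sub>M J (\<lambda>_. M)) (Pi\<^sub>M I (\<lambda>_. M)) (\<lambda>x. \<lambda>i\<in>I. x (p i))) (Pi\<^sub>E I A)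
        = emeasure (Pi\<^sub>M J (\<lambda>_. M)) (Pi\<^sub>E J (\<lambda>j. A (q j)))"
      using A I by (subst emeasure_distr[OF m]) (auto intro: sets_PiM_I_finite)
    also have "\<dots> = (\<Prod>j\<in>J. emeasure M (A (q j)))" using A q by (intro PJ.emeasure_PiM J) auto
    also have "\<dots> = (\<Prod>i\<in>I. emeasure M (A i))"
      using qp by (intro prod.reindex_bij_betw[OF p, symmetric, THEN trans]) (auto intro!: prod.cong)
    finally show "emeasure (distr (Pi\<^sub>M J (\<lambda>_. M)) (Pi\<^sub>M I (\<lambda>_. M)) (\<lambda>x. \<lambda>i\<in>I. x (p i))) (Pi\<^sub>E I A)
        = (\<Prod>i\<in>I. emeasure M (A i))" .
  qed simp
qed

lemma integral_PiM_reindex_bij: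
  fixes F :: "('i \<Rightarrow> 'a) \<Rightarrow> complex"
  assumes M: "sigma_finite_measure M" and I: "finite I" and p: "bij_betw p I J"
    and F: "F \<in> borel_measurable (Pi\<^sub>M I (\<lambda>_. M))"
  shows "(LINT x|Pi\<^sub>M J (\<lambda>_. M). F (\<lambda>i\<in>I. x (p i))) = (LINT x|Pi\<^sub>M I (\<lambda>_. M). F x)"
proof -
  have m: "(\<lambda>x. \<lambda>i\<in>I. x (p i)) \<in> measurable (Pi\<^sub>M J (\<lambda>_. M)) (Pi\<^sub>M I (\<lambda>_. M))"
    using p by (intro measurable_restrict measurable_component_singleton) (auto simp: bij_betw_def)
  have "(LINT x|Pi\<^sub>M I (\<lambda>_. M). F x)
      = (LINT x|distr (Pi\<^sub>M J (\<lambda>_. M)) (Pi\<^sub>M I (\<lambda>_. M)) (\<lambda>x. \<lambda>i\<in>I. x (p i)). F x)"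
    unfolding distr_PiM_reindex_bij[OF M I p] ..
  also have "\<dots> = (LINT x|Pi\<^sub>M J (\<lambda>_. M). F (\<lambda>i\<in>I. x (p i)))" by (rule integral_distr[OF m F])
  finally show ?thesis ..
qed

lemma permutation_onto_subset:
  assumes S: "S \<subseteq> {..<n::nat}" and m: "card S = m"
  obtains p where "p permutes {..<n}" "p ` {..<m} = S"
proof -
  have fS: "finite S" using S finite_subset by blast
  have mn: "m \<le> n" using card_mono[OF _ S] m by simp
  obtain f where f: "bij_betw f {..<m} S"
    using finite_same_card_bij[of "{..<m}" S] fS m by auto
  have "card ({..<n} - {..<m}) = card ({..<n} - S)"
    using S fS m mn by (simp add: card_Diff_subset)
  then obtain g where g: "bij_betw g ({..<n} - {..<m}) ({..<n} - S)"
    using finite_same_card_bij[of "{..<n} - {..<m}" "{..<n} - S"] by auto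
  define p where "p i = (if i < m then f i else if i < n then g i else i)" for i
  have p1: "bij_betw p {..<m} S" using f by (rule bij_betw_cong[THEN iffD1, rotated]) (auto simp: p_def)
  have p2: "bij_betw p ({..<n} - {..<m}) ({..<n} - S)"
    using g by (rule bij_betw_cong[THEN iffD1, rotated]) (auto simp: p_def)
  have "bij_betw p ({..<m} \<union> ({..<n} - {..<m})) (S \<union> ({..<n} - S))"
    by (rule bij_betw_combine[OF p1 p2]) auto
  moreover have "{..<m} \<union> ({..<n} - {..<m}) = {..<n}" "S \<union> ({..<n} - S) = {..<n}" using mn S by auto
  ultimately have "bij_betw p {..<n} {..<n}" by simp
  then have "p permutes {..<n}" using mn by (intro bij_imp_permutes) (auto simp: p_def)
  moreover have "p ` {..<m} = S" using p1 by (simp add: bij_betw_def)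
  ultimately show ?thesis by (rule that)
qed

text \<open>The product space is decomposed according to the set \<open>S\<close> of the indices whose coordinates lie
  in \<open>R\<close>. The integral over such a part vanishes unless exactly half of the indices belong to \<open>S\<close>,
  and by symmetry it is the same for all these \<open>S\<close>.\<close>

lemma fredholm_coeff_antidiagonal:
  assumes M: "sigma_finite_measure M" and K: "dominated_kernel M M K" and R: "R \<in> sets M"
    and K0: "\<And>x y. x \<in> space M \<Longrightarrow> y \<in> space M \<Longrightarrow> (x \<in> R \<longleftrightarrow> y \<in> R) \<Longrightarrow> K x y = 0"
  shows "odd n \<Longrightarrow> fredholm_coeff M K n = 0"
    "fredholm_coeff M K (2 * m) = fredholm_coeff M (kernel_comp M (\<lambda>x y. indicator R x * K x y) K) m"
proof -
  interpret P: product_sigma_finite "\<lambda>_::nat. M" by (simp add: product_sigma_finite_def M)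
  define A where "A x y = indicator R x * K x y" for x y
  have A: "dominated_kernel M M A" unfolding A_def by (rule dominated_kernel_indicator[OF K R])
  define r :: "'a \<Rightarrow> complex" where "r = indicator R"
  have rm[measurable]: "r \<in> borel_measurable M" unfolding r_def using R by measurable
  \<comment> \<open>The indicator of the tuples whose coordinates in R are exactly those with index
    in S. In product form these functions sum to 1, by expanding the product of the factors r + (1 -
    r).\<close>
  define e where "e n S x = (\<Prod>i\<in>S. r (x i)) * (\<Prod>i\<in>{..<n} - S. 1 - r (x i))" for n :: nat and S and x :: "nat \<Rightarrow> 'a"
  define J where "J n S = (LINT x|Pi\<^sub>M {..<n} (\<lambda>_. M). e n S x * fredholm_minor K n x)" for n S
  have r_comp: "(\<lambda>x. r (x i)) \<in> borel_measurable (Pi\<^sub>M {..<n} (\<lambda>_. M))" if "i < n" for i n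
    using measurable_compose[OF measurable_component_singleton[of i "{..<n}" "\<lambda>_. M"] rm] that by simp
  have e_meas: "e n S \<in> borel_measurable (Pi\<^sub>M {..<n} (\<lambda>_. M))" if "S \<subseteq> {..<n}" for n S
    unfolding e_def using that
    by (intro borel_measurable_times borel_measurable_prod borel_measurable_diff borel_measurable_const r_comp) auto
  have mint: "integrable (Pi\<^sub>M {..<n} (\<lambda>_. M)) (fredholm_minor K n)" for n
    using fredholm_det_exists_dominated[OF M K] unfolding fredholm_det_exists_def by blast
  have e_le: "cmod (e n S x) \<le> 1" for n S x
  proof -
    have "(\<Prod>i\<in>S. cmod (r (x i))) \<le> 1" "(\<Prod>i\<in>{..<n} - S. cmod (1 - r (x i))) \<le> 1"
      by (intro prod_le_1; simp add: r_def split: split_indicator)+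
    then show ?thesis unfolding e_def norm_mult prod_norm[symmetric]
      by (intro mult_le_one) (auto intro: prod_nonneg)
  qed
  have e_int: "integrable (Pi\<^sub>M {..<n} (\<lambda>_. M)) (\<lambda>x. e n S x * fredholm_minor K n x)" if "S \<subseteq> {..<n}" for n S
  proof (rule Bochner_Integration.integrable_bound[OF mint[of n]])
    show "(\<lambda>x. e n S x * fredholm_minor K n x) \<in> borel_measurable (Pi\<^sub>M {..<n} (\<lambda>_. M))"
      using e_meas[OF that] borel_measurable_integrable[OF mint[of n]] by (rule borel_measurable_times)
    show "AE x in Pi\<^sub>M {..<n} (\<lambda>_. M). norm (e n S x * fredholm_minor K n x) \<le> norm (fredholm_minor K n x)"
      using e_le by (auto simp: norm_mult intro!: mult_left_le_one_le)
  qed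
  have split: "(LINT x|Pi\<^sub>M {..<n} (\<lambda>_. M). fredholm_minor K n x) = (\<Sum>S\<in>Pow {..<n}. J n S)" for n
  proof -
    have "fredholm_minor K n x = (\<Sum>S\<in>Pow {..<n}. e n S x * fredholm_minor K n x)" for x
    proof -
      have "(\<Sum>S\<in>Pow {..<n}. e n S x) = (\<Prod>i<n. r (x i) + (1 - r (x i)))"
        unfolding e_def by (rule prod_add[symmetric]) simp
      then show ?thesis by (simp flip: sum_distrib_right)
    qed
    then have "(LINT x|Pi\<^sub>M {..<n} (\<lambda>_. M). fredholm_minor K n x)
        = (LINT x|Pi\<^sub>M {..<n} (\<lambda>_. M). (\<Sum>S\<in>Pow {..<n}. e n S x * fredholm_minor K n x))" by simp
    also have "\<dots> = (\<Sum>S\<in>Pow {..<n}. J n S)"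
      unfolding J_def by (rule Bochner_Integration.integral_sum) (use e_int in auto)
    finally show ?thesis .
  qed
  have J0: "J n S = 0" if S: "S \<subseteq> {..<n}" "n \<noteq> 2 * card S" for n S
  proof -
    have "e n S x * fredholm_minor K n x = 0" if x: "x \<in> space (Pi\<^sub>M {..<n} (\<lambda>_. M))" for x
    proof (rule ccontr)
      assume "e n S x * fredholm_minor K n x \<noteq> 0"
      then have en: "e n S x \<noteq> 0" and fn: "fredholm_minor K n x \<noteq> 0" by auto
      have fS: "finite S" using S(1) finite_subset by blast
      have "r (x i) \<noteq> 0" if "i \<in> S" for i using en that fS unfolding e_def by auto
      moreover have "1 - r (x i) \<noteq> 0" if "i < n" "i \<notin> S" for i using en that unfolding e_def by auto
      ultimately have iff: "i \<in> S \<longleftrightarrow> x i \<in> R" if "i < n" for i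
        using that by (auto simp: r_def indicator_def split: if_splits)
      have "fredholm_minor K n x = 0" unfolding fredholm_minor_mdet
        by (rule mdet_unbalanced_block[OF S]) (use x iff in \<open>auto simp: space_PiM PiE_iff intro!: K0\<close>)
      with fn show False by simp
    qed
    then show ?thesis unfolding J_def by (intro integral_eq_zero_AE AE_I2) auto
  qed
  show "fredholm_coeff M K n = 0" if "odd n" for n
  proof -
    have "(\<Sum>S\<in>Pow {..<n}. J n S) = 0" using that by (intro sum.neutral) (auto intro: J0)
    then show ?thesis unfolding fredholm_coeff_def split by simp
  qed
  have Jsym: "J n S = J n {..<card S}" if S: "S \<subseteq> {..<n}" for n S
  proof -
    obtain p where p: "p permutes {..<n}" "p ` {..<card S} = S" using permutation_onto_subset[OF S refl] .
    have bij: "bij_betw p {..<n} {..<n}" by (rule permutes_imp_bij[OF p(1)])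
    have inj: "inj p" by (rule permutes_inj[OF p(1)])
    have inj_on: "inj_on p X" for X by (rule inj_on_subset[OF inj]) simp
    have cS: "{..<card S} \<subseteq> {..<n}" using card_mono[OF _ S] by auto
    have "J n {..<card S} = (LINT x|Pi\<^sub>M {..<n} (\<lambda>_. M). e n {..<card S} (\<lambda>i\<in>{..<n}. x (p i)) * fredholm_minor K n (\<lambda>i\<in>{..<n}. x (p i)))"
      unfolding J_def
      by (rule integral_PiM_reindex_bij[OF M finite_lessThan bij, symmetric]) (rule borel_measurable_integrable[OF e_int[OF cS]])
    also have "\<dots> = J n S" unfolding J_def
    proof (intro Bochner_Integration.integral_cong refl arg_cong2[where f="(*)"])
      fix x :: "nat \<Rightarrow> 'a"
      have "fredholm_minor K n (\<lambda>i\<in>{..<n}. x (p i)) = mdet n (\<lambda>i j. K (x (p i)) (x (p j)))"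
        unfolding fredholm_minor_mdet by (intro mdet_cong) auto
      also have "\<dots> = fredholm_minor K n x"
        unfolding fredholm_minor_mdet by (rule mdet_permute_both[OF p(1)])
      finally show "fredholm_minor K n (\<lambda>i\<in>{..<n}. x (p i)) = fredholm_minor K n x" .
      have "(\<Prod>i<card S. r ((\<lambda>i\<in>{..<n}. x (p i)) i)) = (\<Prod>i<card S. r (x (p i)))"
        using cS by (intro prod.cong) auto
      also have "\<dots> = (\<Prod>i\<in>S. r (x i))"
        using prod.reindex[OF inj_on[of "{..<card S}"], of "\<lambda>i. r (x i)"] p(2) by simp
      finally have 1: "(\<Prod>i<card S. r ((\<lambda>i\<in>{..<n}. x (p i)) i)) = (\<Prod>i\<in>S. r (x i))" .
      have im: "p ` ({..<n} - {..<card S}) = {..<n} - S"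
        unfolding image_set_diff[OF inj] by (simp only: p(2) permutes_image[OF p(1)])
      have "(\<Prod>i\<in>{..<n} - {..<card S}. 1 - r ((\<lambda>i\<in>{..<n}. x (p i)) i)) = (\<Prod>i\<in>{..<n} - {..<card S}. 1 - r (x (p i)))"
        by (intro prod.cong) auto
      also have "\<dots> = (\<Prod>i\<in>{..<n} - S. 1 - r (x i))"
        using prod.reindex[OF inj_on[of "{..<n} - {..<card S}"], of "\<lambda>i. 1 - r (x i)"]
        unfolding im o_def by (rule sym)
      finally show "e n {..<card S} (\<lambda>i\<in>{..<n}. x (p i)) = e n S x" unfolding e_def 1 by simp
    qed
    finally show ?thesis ..
  qed
  \<comment> \<open>The first m coordinates lie in R, the others outside. The minor is then an
    antidiagonal block determinant, and integrating out the second half by Andreief's formula gives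
    the minor of A K, with the indicator carried by \<open>A\<close>.\<close>
  have Jmid: "J (m + m) {..<m} = (-1) ^ m * fact m * (LINT x|Pi\<^sub>M {..<m} (\<lambda>_. M). fredholm_minor (kernel_comp M A K) m x)"
  proof -
    let ?I = "{..<m}" and ?J = "{m..<m + m}"
    have IJ: "?I \<union> ?J = {..<m + m}" "?I \<inter> ?J = {}" by auto
    let ?h = "\<lambda>x y. mdet m (\<lambda>i k. A (x i) (y k)) * mdet m (\<lambda>k j. K (y k) (x j))"
    have bij: "bij_betw (\<lambda>k. m + k) ?I ?J"
      by (rule bij_betwI[of _ _ _ "\<lambda>k. k - m"]) auto
    have "J (m + m) {..<m} = (LINT x|Pi\<^sub>M ?I (\<lambda>_. M). LINT y|Pi\<^sub>M ?J (\<lambda>_. M).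
        e (m + m) {..<m} (merge ?I ?J (x, y)) * fredholm_minor K (m + m) (merge ?I ?J (x, y)))"
      unfolding J_def using P.product_integral_fold[OF IJ(2), of "\<lambda>x. e (m + m) {..<m} x * fredholm_minor K (m + m) x"]
        e_int[of "{..<m}" "m + m"] unfolding IJ(1) by simp
    also have "\<dots> = (LINT x|Pi\<^sub>M ?I (\<lambda>_. M). LINT y|Pi\<^sub>M ?J (\<lambda>_. M). (-1) ^ m * ?h x (\<lambda>k\<in>{..<m}. y (m + k)))"
    proof (intro Bochner_Integration.integral_cong refl)
      fix x y assume x: "x \<in> space (Pi\<^sub>M ?I (\<lambda>_. M))" and y: "y \<in> space (Pi\<^sub>M ?J (\<lambda>_. M))"
      define w where "w = merge ?I ?J (x, y)"
      have w1: "w i = x i" if "i < m" for i using that by (simp add: w_def merge_def)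
      have w2: "w (m + k) = y (m + k)" if "k < m" for k using that by (simp add: w_def merge_def)
      have xs: "x i \<in> space M" if "i < m" for i using x that by (auto simp: space_PiM PiE_iff)
      have ys: "y (m + k) \<in> space M" if "k < m" for k using y that by (auto simp: space_PiM PiE_iff)
      have h: "?h x (\<lambda>k\<in>{..<m}. y (m + k)) = mdet m (\<lambda>i k. A (x i) (y (m + k))) * mdet m (\<lambda>k j. K (y (m + k)) (x j))"
        by (intro arg_cong2[where f="(*)"] mdet_cong) auto
      have e: "e (m + m) {..<m} w = (\<Prod>i<m. r (x i)) * (\<Prod>k<m. 1 - r (y (m + k)))"
      proof -
        have "{..<m + m} - {..<m} = ?J" by auto
        moreover have "(\<Prod>i\<in>?J. 1 - r (w i)) = (\<Prod>k<m. 1 - r (w (m + k)))"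
          using prod.reindex_bij_betw[OF bij, of "\<lambda>i. 1 - r (w i)"] by simp
        ultimately show ?thesis unfolding e_def using w1 w2 by simp
      qed
      \<comment> \<open>If some coordinate is on the wrong side, the left side vanishes by a factor
        of \<open>e\<close> and the right side by a zero row or column of the values of
        \<open>A\<close>.\<close>
      consider (x) i where "i < m" "x i \<notin> R" | (y) k where "k < m" "y (m + k) \<in> R"
        | (good) "\<And>i. i < m \<Longrightarrow> x i \<in> R" "\<And>k. k < m \<Longrightarrow> y (m + k) \<notin> R" by blast
      then show "e (m + m) {..<m} (merge ?I ?J (x, y)) * fredholm_minor K (m + m) (merge ?I ?J (x, y))
          = (-1) ^ m * ?h x (\<lambda>k\<in>{..<m}. y (m + k))"
        unfolding h w_def[symmetric] e
      proof cases
        case x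
        then have "(\<Prod>i<m. r (x i)) = 0" by (intro prod_zero) (auto simp: r_def intro!: bexI[of _ i])
        moreover have "mdet m (\<lambda>i k. A (x i) (y (m + k))) = 0"
          by (rule mdet_zero_row[OF x(1)]) (simp add: A_def x(2))
        ultimately show "(\<Prod>i<m. r (x i)) * (\<Prod>k<m. 1 - r (y (m + k))) * fredholm_minor K (m + m) w =
          (-1) ^ m * (mdet m (\<lambda>i k. A (x i) (y (m + k))) * mdet m (\<lambda>k j. K (y (m + k)) (x j)))" by simp
      next
        case y
        then have "(\<Prod>k<m. 1 - r (y (m + k))) = 0" by (intro prod_zero) (auto simp: r_def intro!: bexI[of _ k])
        moreover have "mdet m (\<lambda>i k. A (x i) (y (m + k))) = 0"
          unfolding mdet_transpose[of m "\<lambda>i k. A (x i) (y (m + k))", symmetric]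
          by (rule mdet_zero_row[OF y(1)]) (use y K0 xs ys in \<open>auto simp: A_def split: split_indicator\<close>)
        ultimately show "(\<Prod>i<m. r (x i)) * (\<Prod>k<m. 1 - r (y (m + k))) * fredholm_minor K (m + m) w =
          (-1) ^ m * (mdet m (\<lambda>i k. A (x i) (y (m + k))) * mdet m (\<lambda>k j. K (y (m + k)) (x j)))" by simp
      next
        case good
        have "fredholm_minor K (m + m) w
            = (-1) ^ m * (mdet m (\<lambda>i k. K (w i) (w (m + k))) * mdet m (\<lambda>k j. K (w (m + k)) (w j)))"
          unfolding fredholm_minor_mdet
          by (rule mdet_antidiagonal_block) (use good w1 w2 xs ys in \<open>auto intro!: K0\<close>)
        also have "mdet m (\<lambda>i k. K (w i) (w (m + k))) = mdet m (\<lambda>i k. A (x i) (y (m + k)))"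
          using good w1 w2 by (intro mdet_cong) (auto simp: A_def)
        also have "mdet m (\<lambda>k j. K (w (m + k)) (w j)) = mdet m (\<lambda>k j. K (y (m + k)) (x j))"
          using w1 w2 by (intro mdet_cong) auto
        finally show "(\<Prod>i<m. r (x i)) * (\<Prod>k<m. 1 - r (y (m + k))) * fredholm_minor K (m + m) w =
          (-1) ^ m * (mdet m (\<lambda>i k. A (x i) (y (m + k))) * mdet m (\<lambda>k j. K (y (m + k)) (x j)))"
          using good by (simp add: r_def)
      qed
    qed
    also have "\<dots> = (LINT x|Pi\<^sub>M ?I (\<lambda>_. M). (-1) ^ m * (fact m * fredholm_minor (kernel_comp M A K) m x))"
    proof (intro Bochner_Integration.integral_cong refl)
      fix x assume x: "x \<in> space (Pi\<^sub>M ?I (\<lambda>_. M))"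
      have xs: "x i \<in> space M" if "i < m" for i using x that by (auto simp: space_PiM PiE_iff)
      have sec: "(\<lambda>y. A (x i) (y k)) \<in> borel_measurable (Pi\<^sub>M ?I (\<lambda>_. M))"
        "(\<lambda>y. K (y k) (x i)) \<in> borel_measurable (Pi\<^sub>M ?I (\<lambda>_. M))" if "i < m" "k < m" for i k
      proof -
        have a: "A (x i) \<in> borel_measurable M" and k: "(\<lambda>y. K y (x i)) \<in> borel_measurable M"
          using measurable_compose[OF measurable_Pair1'[OF xs[OF that(1)]] dominated_kernel_measurable[OF A]]
            measurable_compose[OF measurable_Pair2'[OF xs[OF that(1)]] dominated_kernel_measurable[OF K]] by simp_all
        have c: "(\<lambda>y. y k) \<in> measurable (Pi\<^sub>M ?I (\<lambda>_. M)) M"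
          using measurable_component_singleton[of k ?I "\<lambda>_. M"] that by simp
        show "(\<lambda>y. A (x i) (y k)) \<in> borel_measurable (Pi\<^sub>M ?I (\<lambda>_. M))"
          by (rule measurable_compose[OF c a])
        show "(\<lambda>y. K (y k) (x i)) \<in> borel_measurable (Pi\<^sub>M ?I (\<lambda>_. M))"
          by (rule measurable_compose[OF c k])
      qed
      have "?h x \<in> borel_measurable (Pi\<^sub>M ?I (\<lambda>_. M))"
        by (intro borel_measurable_times mdet_measurable sec)
      then have "(LINT y|Pi\<^sub>M ?J (\<lambda>_. M). ?h x (\<lambda>k\<in>{..<m}. y (m + k))) = (LINT y|Pi\<^sub>M ?I (\<lambda>_. M). ?h x y)"
        using integral_PiM_reindex_bij[OF M finite_lessThan bij] by blast
      also have "\<dots> = fact m * fredholm_minor (kernel_comp M A K) m x"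
        unfolding fredholm_minor_mdet kernel_comp_def
        by (rule andreief[OF M], rule kernel_comp_integrable[OF A K]) (use xs in auto)
      finally show "(LINT y|Pi\<^sub>M ?J (\<lambda>_. M). (-1) ^ m * ?h x (\<lambda>k\<in>{..<m}. y (m + k)))
          = (-1) ^ m * (fact m * fredholm_minor (kernel_comp M A K) m x)" by simp
    qed
    finally show ?thesis by simp
  qed
  have "(\<Sum>S\<in>Pow {..<m + m}. J (m + m) S) = (\<Sum>S | S \<subseteq> {..<m + m} \<and> card S = m. J (m + m) S)"
    by (rule sum.mono_neutral_right) (auto intro!: J0)
  also have "\<dots> = (\<Sum>S | S \<subseteq> {..<m + m} \<and> card S = m. J (m + m) {..<m})"
  proof (intro sum.cong refl)
    fix S assume "S \<in> {S. S \<subseteq> {..<m + m} \<and> card S = m}"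
    then have S: "S \<subseteq> {..<m + m}" "card S = m" by auto
    show "J (m + m) S = J (m + m) {..<m}" using Jsym[OF S(1)] unfolding S(2) .
  qed
  also have "\<dots> = of_nat ((m + m) choose m) * J (m + m) {..<m}"
    using n_subsets[of "{..<m + m}" m] by simp
  finally have tot: "(\<Sum>S\<in>Pow {..<m + m}. J (m + m) S) = of_nat ((m + m) choose m) * J (m + m) {..<m}" .
  \<comment> \<open>The count of index sets, times the m! of Andreief's formula and divided by (2
    m)!, leaves the factor 1 / m! of the m-th coefficient.\<close>
  have ch: "of_nat ((m + m) choose m) = (fact (m + m) / (fact m * fact m) :: complex)"
    using binomial_fact[of m "m + m", where 'a=complex] by simp
  have "fredholm_coeff M K (m + m) = (-1) ^ m / fact m * (LINT x|Pi\<^sub>M {..<m} (\<lambda>_. M). fredholm_minor (kernel_comp M A K) m x)"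
    unfolding fredholm_coeff_def split tot Jmid ch by (simp add: power_add[symmetric] field_simps flip: mult_2)
  then show "fredholm_coeff M K (2 * m) = fredholm_coeff M (kernel_comp M (\<lambda>x y. indicator R x * K x y) K) m"
    unfolding A_def[abs_def] by (simp add: fredholm_coeff_def mult_2)
qed

section \<open>The contours\<close>

text \<open>Such r are at least 1, hence r^2 \<ge> r \<ge> 6 (c + 1); multiply by r / 6.\<close>

lemma cubic_decay:
  fixes c r :: real
  assumes "r \<ge> 6 * (\<bar>c\<bar> + 1)"
  shows "- (r ^ 3) / 6 + c * r \<le> - r"
proof -
  have "1 * r \<le> r * r" using assms by (intro mult_right_mono) auto
  then have "6 * (\<bar>c\<bar> + 1) \<le> r * r" using assms by linarith
  moreover have "6 * (c + 1) \<le> 6 * (\<bar>c\<bar> + 1)" by simp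
  ultimately have "6 * (c + 1) \<le> r * r" by (rule order_trans[rotated])
  then have "6 * (c + 1) * r \<le> r * r * r" using assms by (intro mult_right_mono) auto
  then show ?thesis by (simp add: power3_eq_cube algebra_simps)
qed

text \<open>Since u^3 = -1, far out the real part of \<beta>^3 is at most - |\<beta>|^3 / 2, and
  this beats the linear term. What remains is exp (- |\<beta>|) |\<beta>'|. The tangent condition
  bounds |\<beta>'| by 4 Re \<beta>', since Re u = 1/2 > 1/4, so the arc length can be integrated
  through Re \<beta>.\<close>

lemma contour_end_integrable:
  fixes \<beta> \<beta>' :: "real \<Rightarrow> complex" and c :: real
  assumes der: "\<And>t. (\<beta> has_vector_derivative \<beta>' t) (at t)" and cont: "continuous_on UNIV \<beta>'"
    and inf: "filterlim \<beta> at_infinity at_top"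
    and dir: "((\<lambda>t. sgn (\<beta> t)) \<longlongrightarrow> u) at_top" and tan: "((\<lambda>t. sgn (\<beta>' t)) \<longlongrightarrow> u) at_top"
    and u: "Re u = 1 / 2" "u ^ 3 = - 1"
  obtains t0 where "integrable lborel (\<lambda>t. indicator {t0..} t * (exp (Re (\<beta> t ^ 3) / 3 + c * cmod (\<beta> t)) * cmod (\<beta>' t)))"
proof -
  let ?W = "\<lambda>t. exp (Re (\<beta> t ^ 3) / 3 + c * cmod (\<beta> t)) * cmod (\<beta>' t)"
  have sg: "of_real (cmod z) * sgn z = z" for z :: complex by (simp add: sgn_eq)
  have norm_inf: "filterlim (\<lambda>t. cmod (\<beta> t)) at_top at_top"
    using inf by (simp add: filterlim_at_infinity_conv_norm_at_top)
  have "((\<lambda>t. Re (sgn (\<beta> t) ^ 3)) \<longlongrightarrow> Re (u ^ 3)) at_top" by (intro tendsto_intros dir)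
  then have e1: "eventually (\<lambda>t. Re (sgn (\<beta> t) ^ 3) < - 1 / 2) at_top"
    by (rule order_tendstoD) (simp add: u)
  have "((\<lambda>t. Re (sgn (\<beta> t))) \<longlongrightarrow> Re u) at_top" by (intro tendsto_intros dir)
  then have e2: "eventually (\<lambda>t. Re (sgn (\<beta> t)) > 1 / 4) at_top" by (rule order_tendstoD) (simp add: u)
  have "((\<lambda>t. Re (sgn (\<beta>' t))) \<longlongrightarrow> Re u) at_top" by (intro tendsto_intros tan)
  then have e3: "eventually (\<lambda>t. Re (sgn (\<beta>' t)) > 1 / 4) at_top" by (rule order_tendstoD) (simp add: u)
  have e4: "eventually (\<lambda>t. cmod (\<beta> t) \<ge> 6 * (\<bar>c\<bar> + 1)) at_top"
    using norm_inf unfolding filterlim_at_top by blast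
  from e1 e2 e3 e4 have "eventually (\<lambda>t. Re (sgn (\<beta> t) ^ 3) < - 1 / 2 \<and> Re (sgn (\<beta> t)) > 1 / 4 \<and>
      Re (sgn (\<beta>' t)) > 1 / 4 \<and> cmod (\<beta> t) \<ge> 6 * (\<bar>c\<bar> + 1)) at_top"
    by eventually_elim auto
  then obtain t0 where t0: "\<And>t. t \<ge> t0 \<Longrightarrow> Re (sgn (\<beta> t) ^ 3) < - 1 / 2"
    "\<And>t. t \<ge> t0 \<Longrightarrow> Re (sgn (\<beta> t)) > 1 / 4" "\<And>t. t \<ge> t0 \<Longrightarrow> Re (sgn (\<beta>' t)) > 1 / 4"
    "\<And>t. t \<ge> t0 \<Longrightarrow> cmod (\<beta> t) \<ge> 6 * (\<bar>c\<bar> + 1)"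
    unfolding eventually_at_top_linorder by blast
  \<comment> \<open>The derivative of - 4 exp (- Re (\<beta> t)), hence a majorant with explicit
    integral.\<close>
  define f where "f t = 4 * exp (- Re (\<beta> t)) * Re (\<beta>' t)" for t
  have contb: "continuous_on UNIV \<beta>"
    using der by (meson continuous_at_imp_continuous_on has_vector_derivative_continuous)
  have [measurable]: "\<beta> \<in> borel_measurable borel" "\<beta>' \<in> borel_measurable borel"
    using contb cont by (auto intro: borel_measurable_continuous_onI)
  have fm: "f \<in> borel_measurable borel" unfolding f_def by measurable
  have tan_le: "cmod (\<beta>' t) \<le> 4 * Re (\<beta>' t)" if "t \<ge> t0" for t
  proof -
    have "cmod (\<beta>' t) * (1 / 4) \<le> cmod (\<beta>' t) * Re (sgn (\<beta>' t))"
      using t0(3)[OF that] by (intro mult_left_mono) auto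
    also have "\<dots> = Re (of_real (cmod (\<beta>' t)) * sgn (\<beta>' t))" by simp
    finally show ?thesis unfolding sg by simp
  qed
  have re_ge: "cmod (\<beta> t) \<le> 4 * Re (\<beta> t)" if "t \<ge> t0" for t
  proof -
    have "cmod (\<beta> t) * (1 / 4) \<le> cmod (\<beta> t) * Re (sgn (\<beta> t))"
      using t0(2)[OF that] by (intro mult_left_mono) auto
    also have "\<dots> = Re (of_real (cmod (\<beta> t)) * sgn (\<beta> t))" by simp
    finally show ?thesis unfolding sg by simp
  qed
  have re_inf: "filterlim (\<lambda>t. Re (\<beta> t)) at_top at_top"
  proof (rule filterlim_at_top_mono)
    have "filterlim (\<lambda>t. (1 / 4) * cmod (\<beta> t)) at_top at_top"
      by (rule filterlim_tendsto_pos_mult_at_top[OF tendsto_const _ norm_inf]) simp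
    then show "filterlim (\<lambda>t. cmod (\<beta> t) / 4) at_top at_top" by simp
    show "eventually (\<lambda>t. cmod (\<beta> t) / 4 \<le> Re (\<beta> t)) at_top"
      using eventually_ge_at_top[of t0] by eventually_elim (use re_ge in force)
  qed
  have fF: "(\<integral>\<^sup>+t. ennreal (f t) * indicator {t0..} t \<partial>lborel) = ennreal (0 - (- 4 * exp (- Re (\<beta> t0))))"
  proof (rule nn_integral_FTC_atLeast[OF fm])
    fix t assume t: "t0 \<le> t"
    have "((\<lambda>t. Re (\<beta> t)) has_real_derivative Re (\<beta>' t)) (at t)"
      by (rule has_field_derivative_Re[OF der])
    then have "((\<lambda>t. - 4 * exp (- Re (\<beta> t))) has_real_derivative - 4 * (exp (- Re (\<beta> t)) * - Re (\<beta>' t))) (at t)"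
      by (intro DERIV_cmult DERIV_fun_exp DERIV_minus)
    then show "((\<lambda>t. - 4 * exp (- Re (\<beta> t))) has_real_derivative f t) (at t)" by (simp add: f_def mult_ac)
    have "0 \<le> Re (\<beta>' t)" using tan_le[OF t] norm_ge_zero[of "\<beta>' t"] by linarith
    then show "0 \<le> f t" by (simp add: f_def)
  next
    have "((\<lambda>t. exp (- Re (\<beta> t))) \<longlongrightarrow> 0) at_top"
      by (rule filterlim_compose[OF exp_at_bot filterlim_uminus_at_top[THEN iffD1, OF re_inf]])
    from tendsto_mult[OF tendsto_const[of "- 4"] this]
    show "((\<lambda>t. - 4 * exp (- Re (\<beta> t))) \<longlongrightarrow> 0) at_top" by simp
  qed
  have "integrable lborel (\<lambda>t. indicator {t0..} t * ?W t)"
  proof (rule integrableI_bounded)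
    have "(\<integral>\<^sup>+t. ennreal (norm (indicator {t0..} t * ?W t)) \<partial>lborel)
        \<le> (\<integral>\<^sup>+t. ennreal (f t) * indicator {t0..} t \<partial>lborel)"
    proof (rule nn_integral_mono)
      fix t :: real
      show "ennreal (norm (indicator {t0..} t * ?W t))
          \<le> ennreal (f t) * indicator {t0..} t"
      proof (cases "t \<ge> t0")
        case True
        have "Re (\<beta> t ^ 3) = Re ((of_real (cmod (\<beta> t)) * sgn (\<beta> t)) ^ 3)" unfolding sg ..
        also have "\<dots> = cmod (\<beta> t) ^ 3 * Re (sgn (\<beta> t) ^ 3)" unfolding power_mult_distrib of_real_power[symmetric] by simp
        also have "\<dots> \<le> cmod (\<beta> t) ^ 3 * (- 1 / 2)" using t0(1)[OF True] by (intro mult_left_mono) auto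
        finally have "Re (\<beta> t ^ 3) / 3 + c * cmod (\<beta> t) \<le> - (cmod (\<beta> t) ^ 3) / 6 + c * cmod (\<beta> t)" by simp
        also have "\<dots> \<le> - cmod (\<beta> t)" by (rule cubic_decay[OF t0(4)[OF True]])
        also have "\<dots> \<le> - Re (\<beta> t)" by (simp add: complex_Re_le_cmod)
        finally have "exp (Re (\<beta> t ^ 3) / 3 + c * cmod (\<beta> t)) * cmod (\<beta>' t) \<le> exp (- Re (\<beta> t)) * (4 * Re (\<beta>' t))"
          using tan_le[OF True] by (intro mult_mono) auto
        then show ?thesis using True by (simp add: f_def ennreal_leI mult_ac)
      qed simp
    qed
    also have "\<dots> < \<infinity>" unfolding fF by simp
    finally show "(\<integral>\<^sup>+t. ennreal (norm (indicator {t0..} t * ?W t)) \<partial>lborel) < \<infinity>" .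
  qed measurable
  then show ?thesis by (rule that)
qed

section \<open>The arc length measure and square-integrable weights on the contours\<close>

locale right_half_plane_contour =
  fixes \<gamma> :: "real \<Rightarrow> complex"
  assumes contour: "right_contour \<gamma>"
begin

definition D :: "real \<Rightarrow> complex" where "D t = vector_derivative \<gamma> (at t)"

abbreviation arc :: "complex measure" where "arc \<equiv> arc_length_measure \<gamma>"

abbreviation \<tau> :: "complex \<Rightarrow> complex" where "\<tau> \<equiv> unit_tangent \<gamma>"

lemma contour_measurable [measurable]: "\<gamma> \<in> borel_measurable borel" "D \<in> borel_measurable borel"
  "\<tau> \<in> borel_measurable borel" "range \<gamma> \<in> sets borel"
  using right_contour_continuous[OF contour] unit_tangent_measurable[OF contour] measurable_the_inv_contour(1)
  by (auto intro: borel_measurable_continuous_onI simp: D_def)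

lemma has_D: "(\<gamma> has_vector_derivative D t) (at t)"
  using contour unfolding D_def right_contour_def C1_differentiable_on_eq
  by (simp add: vector_derivative_works[symmetric])

lemma contour_distance:
  obtains \<delta> where "\<delta> > 0" "\<And>t. \<delta> \<le> Re (\<gamma> t)"
  using contour that unfolding right_contour_def by blast

lemma Re_pos: "Re (\<gamma> t) > 0"
proof -
  obtain \<delta> where \<delta>: "\<delta> > 0" "\<And>t. \<delta> \<le> Re (\<gamma> t)" using contour_distance by blast
  show ?thesis by (rule order_less_le_trans[OF \<delta>])
qed

lemma Re_range_pos: "z \<in> range \<gamma> \<Longrightarrow> Re z > 0"
  using Re_pos by auto

lemma range_disjoint: "z \<in> range \<gamma> \<Longrightarrow> - z \<notin> range \<gamma>"
  using Re_range_pos[of z] Re_range_pos[of "- z"] by auto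

text \<open>Both ends of the contour are ends in the sense of \<open>contour_end_integrable\<close>:
  the cubes of cis (\<plusminus>\<pi>/3) are -1, and the reversal t \<mapsto> - t changes the sign
  of the tangent, in agreement with the minus sign in the condition at \<open>at_bot\<close>. The
  rest is a compact interval.\<close>

lemma contour_weight_integrable:
  "integrable lborel (\<lambda>t. exp (Re (\<gamma> t ^ 3) / 3 + c * cmod (\<gamma> t)) * cmod (D t))" (is "integrable lborel ?W")
proof -
  have rc: "filterlim \<gamma> at_infinity at_bot" "filterlim \<gamma> at_infinity at_top"
     "((\<lambda>t. sgn (\<gamma> t)) \<longlongrightarrow> cis (- pi / 3)) at_bot" "((\<lambda>t. sgn (\<gamma> t)) \<longlongrightarrow> cis (pi / 3)) at_top"
     "((\<lambda>t. sgn (D t)) \<longlongrightarrow> - cis (- pi / 3)) at_bot" "((\<lambda>t. sgn (D t)) \<longlongrightarrow> cis (pi / 3)) at_top"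
    using contour unfolding right_contour_def D_def by auto
  have contD: "continuous_on UNIV D" using right_contour_continuous(2)[OF contour] by (simp add: D_def[abs_def])
  have cont\<gamma>: "continuous_on UNIV \<gamma>" by (rule right_contour_continuous(1)[OF contour])
  have cis3: "cis (pi / 3) ^ 3 = - 1" "cis (- pi / 3) ^ 3 = - 1"
    unfolding Complex.DeMoivre by (simp_all add: cis_pi complex_eq_iff)
  obtain t1 where t1: "integrable lborel (\<lambda>t. indicator {t1..} t * ?W t)"
    by (rule contour_end_integrable[OF has_D contD rc(2,4,6), of c])
       (use cis3 in \<open>auto simp: cos_60\<close>)
  have m: "filterlim (uminus :: real \<Rightarrow> real) at_bot at_top" by (rule filterlim_uminus_at_bot_at_top)
  have d': "((\<lambda>t. \<gamma> (- t)) has_vector_derivative - D (- t)) (at t)" for t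
  proof -
    have "(uminus has_vector_derivative (- 1)) (at t)" by (auto intro!: derivative_eq_intros)
    from vector_diff_chain_at[OF this has_D[of "- t"]] show ?thesis by (simp add: o_def)
  qed
  obtain t2 where t2: "integrable lborel (\<lambda>t. indicator {t2..} t * (exp (Re (\<gamma> (- t) ^ 3) / 3 + c * cmod (\<gamma> (- t))) * cmod (- D (- t))))"
  proof (rule contour_end_integrable[of "\<lambda>t. \<gamma> (- t)" "\<lambda>t. - D (- t)" "cis (- pi / 3)" c])
    show "continuous_on UNIV (\<lambda>t. - D (- t))"
      by (intro continuous_intros continuous_on_compose2[OF contD]) auto
    show "filterlim (\<lambda>t. \<gamma> (- t)) at_infinity at_top" by (rule filterlim_compose[OF rc(1) m])
    show "((\<lambda>t. sgn (\<gamma> (- t))) \<longlongrightarrow> cis (- pi / 3)) at_top" by (rule filterlim_compose[OF rc(3) m])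
    have "((\<lambda>t. - sgn (D (- t))) \<longlongrightarrow> - (- cis (- pi / 3))) at_top"
      by (intro tendsto_minus filterlim_compose[OF rc(5) m])
    then show "((\<lambda>t. sgn (- D (- t))) \<longlongrightarrow> cis (- pi / 3)) at_top" by (simp add: sgn_minus)
  qed (use d' cis3 in \<open>auto simp: cos_60\<close>)
  have "integrable lborel (\<lambda>t. (\<lambda>t. indicator {t2..} t * ?W (- t)) (0 + (- 1) * t))"
    using t2 by (intro lborel_integrable_real_affine) auto
  then have t2': "integrable lborel (\<lambda>t. indicator {t2..} (- t) * ?W t)" by simp
  have "continuous_on {- t2..t1} ?W"
    by (intro continuous_intros continuous_on_subset[OF contD] continuous_on_subset[OF cont\<gamma>]) auto
  then have mid: "integrable lborel (\<lambda>t. indicator {- t2..t1} t *\<^sub>R ?W t)"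
    using borel_integrable_atLeastAtMost'[of "- t2" t1 ?W] unfolding set_integrable_def by blast
  have sum: "integrable lborel (\<lambda>t. indicator {t1..} t * ?W t + indicator {t2..} (- t) * ?W t + indicator {- t2..t1} t *\<^sub>R ?W t)"
    by (intro Bochner_Integration.integrable_add t1 t2' mid)
  show ?thesis
  proof (rule Bochner_Integration.integrable_bound[OF sum])
    show "?W \<in> borel_measurable lborel" by measurable
    have "norm (?W t) \<le> norm (indicator {t1..} t * ?W t + indicator {t2..} (- t) * ?W t + indicator {- t2..t1} t *\<^sub>R ?W t)" for t
    \<comment> \<open>The three sets cover the line, possibly with overlap, and the middle one may
      be empty; it is enough that their indicators add up to at least 1.\<close>
    proof -
      have "t1 \<le> t \<or> t2 \<le> - t \<or> t \<in> {- t2..t1}" by auto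
      then have "1 \<le> indicator {t1..} t + indicator {t2..} (- t) + (indicator {- t2..t1} t :: real)"
        by (auto split: split_indicator)
      from mult_right_mono[OF this, of "?W t"] show ?thesis by (simp add: distrib_right)
    qed
    then show "AE t in lborel. norm (?W t) \<le> norm (indicator {t1..} t * ?W t + indicator {t2..} (- t) * ?W t + indicator {- t2..t1} t *\<^sub>R ?W t)"
      by simp
  qed
qed

lemma sets_arc [simp, measurable_cong]: "sets arc = sets borel"
  by (simp add: arc_length_measure_def)

lemma space_arc [simp]: "space arc = UNIV"
  by (simp add: arc_length_measure_def)

lemma nn_integral_arc:
  assumes [measurable]: "f \<in> borel_measurable borel"
  shows "(\<integral>\<^sup>+z. f z \<partial>arc) = (\<integral>\<^sup>+t. f (\<gamma> t) * ennreal (cmod (D t)) \<partial>lborel) + (\<integral>\<^sup>+t. f (- \<gamma> t) * ennreal (cmod (D t)) \<partial>lborel)"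
proof -
  let ?C = "count_space {1, -1 :: complex}"
  have fs: "(\<lambda>x. fst x) \<in> borel_measurable (?C \<Otimes>\<^sub>M lborel)"
    by (rule measurable_compose[OF measurable_fst]) simp
  note [measurable] = fs
  have pm: "(\<lambda>(s, t). s * \<gamma> t) \<in> borel_measurable (?C \<Otimes>\<^sub>M lborel)"
    unfolding split_def by measurable
  have nm: "(\<lambda>(s, t). ennreal (cmod (D t))) \<in> borel_measurable (?C \<Otimes>\<^sub>M lborel)" by measurable
  have fm: "(\<lambda>x. f (case x of (s, t) \<Rightarrow> s * \<gamma> t)) \<in> borel_measurable (?C \<Otimes>\<^sub>M lborel)"
    by (rule measurable_compose[OF pm assms])
  have "(\<integral>\<^sup>+z. f z \<partial>arc) = (\<integral>\<^sup>+x. f (case x of (s, t) \<Rightarrow> s * \<gamma> t) \<partial>density (?C \<Otimes>\<^sub>M lborel) (\<lambda>(s, t). ennreal (cmod (D t))))"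
    unfolding arc_length_measure_def D_def[symmetric] using pm by (subst nn_integral_distr) auto
  also have "\<dots> = (\<integral>\<^sup>+x. (case x of (s, t) \<Rightarrow> ennreal (cmod (D t))) * f (case x of (s, t) \<Rightarrow> s * \<gamma> t) \<partial>(?C \<Otimes>\<^sub>M lborel))"
    by (rule nn_integral_density[OF nm fm])
  also have "\<dots> = (\<integral>\<^sup>+s. \<integral>\<^sup>+t. ennreal (cmod (D t)) * f (s * \<gamma> t) \<partial>lborel \<partial>?C)"
    using borel_measurable_times_ennreal[OF nm fm] by (subst lborel.nn_integral_fst[symmetric]) auto
  also have "\<dots> = (\<integral>\<^sup>+t. f (\<gamma> t) * ennreal (cmod (D t)) \<partial>lborel) + (\<integral>\<^sup>+t. f (- \<gamma> t) * ennreal (cmod (D t)) \<partial>lborel)"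
    by (subst nn_integral_count_space_finite) (auto simp: mult.commute)
  finally show ?thesis .
qed

lemma integrable_arc_iff:
  fixes h :: "complex \<Rightarrow> 'b::{banach, second_countable_topology}"
  assumes [measurable]: "h \<in> borel_measurable borel"
  shows "integrable arc h \<longleftrightarrow> integrable lborel (\<lambda>t. cmod (D t) *\<^sub>R h (\<gamma> t)) \<and> integrable lborel (\<lambda>t. cmod (D t) *\<^sub>R h (- \<gamma> t))"
proof -
  have "integrable arc h \<longleftrightarrow> (\<integral>\<^sup>+z. ennreal (norm (h z)) \<partial>arc) < \<infinity>"
    unfolding integrable_iff_bounded by simp
  also have "\<dots> \<longleftrightarrow> (\<integral>\<^sup>+t. ennreal (norm (h (\<gamma> t))) * ennreal (cmod (D t)) \<partial>lborel) < \<infinity> \<and>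
      (\<integral>\<^sup>+t. ennreal (norm (h (- \<gamma> t))) * ennreal (cmod (D t)) \<partial>lborel) < \<infinity>"
    by (subst nn_integral_arc) auto
  also have "\<dots> \<longleftrightarrow> integrable lborel (\<lambda>t. cmod (D t) *\<^sub>R h (\<gamma> t)) \<and> integrable lborel (\<lambda>t. cmod (D t) *\<^sub>R h (- \<gamma> t))"
    unfolding integrable_iff_bounded by (simp add: ennreal_mult mult.commute)
  finally show ?thesis .
qed

text \<open>The modulus of exp (\<lambda>^3/6) on \<gamma>R and of exp (- \<lambda>^3/6) on
  \<gamma>L, enlarged by a linear exponent that accommodates the parameters a j. The sign of Re z
  makes it an even function.\<close>

definition \<Phi> :: "real \<Rightarrow> complex \<Rightarrow> real" where
  "\<Phi> c z = exp (sgn (Re z) * Re (z ^ 3) / 6 + c * cmod z)"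

lemma \<Phi>_measurable [measurable]: "\<Phi> c \<in> borel_measurable borel"
  unfolding \<Phi>_def by measurable

lemma \<Phi>_pos: "\<Phi> c z > 0"
  by (simp add: \<Phi>_def)

lemma \<Phi>_minus: "\<Phi> c (- z) = \<Phi> c z"
proof -
  have "(- z) ^ 3 = - (z ^ 3)" by simp
  then show ?thesis by (simp add: \<Phi>_def sgn_minus)
qed

lemma \<Phi>_square_integrable: "integrable arc (\<lambda>z. (\<Phi> c z)\<^sup>2)"
proof -
  have "(\<Phi> c (\<gamma> t))\<^sup>2 = exp (Re (\<gamma> t ^ 3) / 3 + 2 * c * cmod (\<gamma> t))" for t
    using Re_pos[of t] by (simp add: \<Phi>_def power2_eq_square field_simps flip: exp_add)
  then show ?thesis
    using contour_weight_integrable[of "2 * c"]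
    by (subst integrable_arc_iff) (auto simp: \<Phi>_minus mult.commute)
qed

text \<open>The square of \<open>\<Phi> 0\<close> is integrable and positive on the whole plane, so
  its superlevel sets exhaust the plane and have finite measure by Markov's inequality.\<close>

lemma sigma_finite_arc: "sigma_finite_measure arc"
proof
  define f where "f z = (\<Phi> 0 z)\<^sup>2" for z
  have f: "f z > 0" for z using \<Phi>_pos[of 0 z] by (simp add: f_def)
  have [measurable]: "f \<in> borel_measurable borel" unfolding f_def by measurable
  define A where "A n = {z. 1 \<le> ennreal (real (Suc n)) * ennreal (f z)}" for n :: nat
  have fin: "(\<integral>\<^sup>+z. ennreal (f z) \<partial>arc) < \<infinity>"
    using \<Phi>_square_integrable[of 0] unfolding integrable_iff_bounded f_def by simp
  have "emeasure arc (A n) \<noteq> \<infinity>" for n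
  proof -
    have "emeasure arc (A n) \<le> ennreal (real (Suc n)) * (\<integral>\<^sup>+z. ennreal (f z) * indicator UNIV z \<partial>arc)"
      unfolding A_def using nn_integral_Markov_inequality[of "\<lambda>z. ennreal (f z)" UNIV arc "ennreal (real (Suc n))"] by simp
    also have "\<dots> < \<infinity>" using fin by (simp add: ennreal_mult_less_top)
    finally show ?thesis by simp
  qed
  moreover have "(\<Union>n. A n) = UNIV"
  proof -
    have "\<exists>n. z \<in> A n" for z
    proof -
      obtain n where "inverse (real (Suc n)) < f z" using reals_Archimedean[OF f] by blast
      then have "1 \<le> real (Suc n) * f z" by (simp add: field_simps)
      then have "ennreal 1 \<le> ennreal (real (Suc n) * f z)" by (rule ennreal_leI)
      then show ?thesis using f[of z] by (auto simp: A_def ennreal_mult less_imp_le intro!: exI[of _ n])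
    qed
    then show ?thesis by auto
  qed
  moreover have "A n \<in> sets arc" for n unfolding A_def by simp
  ultimately show "\<exists>A. countable A \<and> A \<subseteq> sets arc \<and> \<Union> A = space arc \<and> (\<forall>a\<in>A. emeasure arc a \<noteq> \<infinity>)"
    by (intro exI[of _ "range A"]) auto
qed

lemma integral_arc_line_integral:
  assumes F: "F \<in> borel_measurable borel" and int: "integrable arc (\<lambda>z. F z * \<tau> z)"
  shows "(LINT z|arc. F z * \<tau> z) = line_integral \<gamma> F + line_integral (\<lambda>t. - \<gamma> t) F"
proof -
  have sg: "of_real (cmod z) * sgn z = z" for z :: complex by (simp add: sgn_eq)
  have inj: "inj \<gamma>" by (rule right_contour_continuous(3)[OF contour])
  have "cmod (D t) *\<^sub>R (F (\<gamma> t) * \<tau> (\<gamma> t)) = F (\<gamma> t) * vector_derivative \<gamma> (at t)" for t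
    using sg[of "D t"] inj by (simp add: unit_tangent_def D_def the_inv_f_f scaleR_conv_of_real mult.left_commute)
  moreover have "cmod (D t) *\<^sub>R (F (- \<gamma> t) * \<tau> (- \<gamma> t)) = - (F (- \<gamma> t) * vector_derivative \<gamma> (at t))" for t
    using sg[of "D t"] inj range_disjoint[of "\<gamma> t"]
    by (simp add: unit_tangent_def D_def the_inv_f_f scaleR_conv_of_real mult.left_commute)
  ultimately show ?thesis
    using int F by (intro line_integral_conv_arc_length[OF contour F]) (auto simp: integrable_arc_iff)
qed

lemma \<tau>_bounded: "cmod (\<tau> z) \<le> 1"
  by (auto simp: unit_tangent_def norm_sgn)

end

section \<open>Integrals of exponentials\<close>

text \<open>Absolute integrability comes first, from the primitive of exp (s Re z); it then permits
  evaluation with the complex primitive exp (s z) / z, which vanishes at infinity.\<close>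

lemma exp_halfline:
  fixes z :: complex and a :: real
  assumes z: "Re z < 0"
  shows "integrable lborel (\<lambda>s. indicator {a<..} s * exp (of_real s * z))"
    "(LINT s|lborel. indicator {a<..} s * exp (of_real s * z)) = - exp (of_real a * z) / z"
proof -
  have z0: "z \<noteq> 0" using z by auto
  have tend: "((\<lambda>s. exp (s * Re z)) \<longlongrightarrow> 0) at_top"
  proof -
    have "filterlim (\<lambda>s. s * Re z) at_bot at_top"
      using filterlim_tendsto_neg_mult_at_bot[OF tendsto_const z filterlim_ident] by (simp add: mult.commute)
    then show ?thesis by (rule filterlim_compose[OF exp_at_bot])
  qed
  have nn: "(\<integral>\<^sup>+s. ennreal (exp (s * Re z)) * indicator {a..} s \<partial>lborel) = ennreal (0 - exp (a * Re z) / Re z)"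
  proof (rule nn_integral_FTC_atLeast)
    show "((\<lambda>s. exp (s * Re z) / Re z) has_real_derivative exp (s * Re z)) (at s)" for s
      using z by (auto intro!: derivative_eq_intros)
    show "((\<lambda>s. exp (s * Re z) / Re z) \<longlongrightarrow> 0) at_top"
      using tendsto_divide[OF tend tendsto_const, of "Re z"] z by simp
  qed auto
  show int: "integrable lborel (\<lambda>s. indicator {a<..} s * exp (of_real s * z))"
  proof (rule integrableI_bounded)
    have "(\<integral>\<^sup>+s. ennreal (norm (indicator {a<..} s * exp (of_real s * z))) \<partial>lborel)
        \<le> (\<integral>\<^sup>+s. ennreal (exp (s * Re z)) * indicator {a..} s \<partial>lborel)"
      by (intro nn_integral_mono) (auto simp: norm_mult split: split_indicator)
    also have "\<dots> < \<infinity>" unfolding nn by simp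
    finally show "(\<integral>\<^sup>+s. ennreal (norm (indicator {a<..} s * exp (of_real s * z))) \<partial>lborel) < \<infinity>" .
  qed measurable
  have ei: "einterval (ereal a) \<infinity> = {a<..}" by (auto simp: einterval_def)
  have sc: "indicator {a<..} s *\<^sub>R exp (of_real s * z) = indicator {a<..} s * exp (of_real s * z)" for s
    by (auto split: split_indicator)
  have "(LBINT s=ereal a..\<infinity>. exp (of_real s * z)) = 0 - exp (of_real a * z) / z"
  proof (rule interval_integral_FTC_integrable)
    fix s :: real
    have "((\<lambda>w. exp (w * z) / z) has_field_derivative exp (of_real s * z)) (at (of_real s))"
      using z0 by (auto intro!: derivative_eq_intros)
    then show "((\<lambda>s. exp (of_real s * z) / z) has_vector_derivative exp (of_real s * z)) (at s)"
      by (rule has_vector_derivative_real_field)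
    show "isCont (\<lambda>s. exp (of_real s * z)) s" by (intro continuous_intros)
  next
    show "set_integrable lborel (einterval (ereal a) \<infinity>) (\<lambda>s. exp (of_real s * z))"
      unfolding ei set_integrable_def sc by (rule int)
    have "((\<lambda>s. exp (of_real s * z) / z) \<longlongrightarrow> exp (of_real a * z) / z) (at_right a)"
      by (intro tendsto_intros) (simp_all add: z0)
    then show "(((\<lambda>s. exp (of_real s * z) / z) \<circ> real_of_ereal) \<longlongrightarrow> exp (of_real a * z) / z) (at_right (ereal a))"
      by (simp add: ereal_tendsto_simps)
    have "((\<lambda>s. cmod (exp (of_real s * z))) \<longlongrightarrow> 0) at_top" using tend by simp
    then have "((\<lambda>s. exp (of_real s * z)) \<longlongrightarrow> 0) at_top" by (rule tendsto_norm_zero_cancel)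
    from tendsto_divide[OF this tendsto_const z0]
    have "((\<lambda>s. exp (of_real s * z) / z) \<longlongrightarrow> 0) at_top" by simp
    then show "(((\<lambda>s. exp (of_real s * z) / z) \<circ> real_of_ereal) \<longlongrightarrow> 0) (at_left \<infinity>)"
      by (simp add: ereal_tendsto_simps)
  qed simp
  then show "(LINT s|lborel. indicator {a<..} s * exp (of_real s * z)) = - exp (of_real a * z) / z"
    by (simp add: interval_lebesgue_integral_def ei set_lebesgue_integral_def sc)
qed

lemma exp_halfline_left:
  fixes z :: complex and a :: real
  assumes z: "Re z > 0"
  shows "(LINT s|lborel. indicator {..<a} s * exp (of_real (s - a) * z)) = 1 / z"
proof -
  have "(LINT s|lborel. indicator {..<a} s * exp (of_real (s - a) * z))
      = \<bar>-1\<bar> *\<^sub>R (LINT s|lborel. indicator {..<a} (a + -1 * s) * exp (of_real ((a + -1 * s) - a) * z))"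
    by (rule lborel_integral_real_affine) simp
  also have "\<dots> = (LINT s|lborel. indicator {0<..} s * exp (of_real s * (- z)))"
    by (auto intro!: Bochner_Integration.integral_cong split: split_indicator)
  also have "\<dots> = 1 / z" using exp_halfline(2)[of "- z" 0] z by simp
  finally show ?thesis .
qed

lemma exp_abs_integrable:
  fixes c a :: real
  assumes "c > 0"
  shows "integrable lborel (\<lambda>s. exp (- (c * \<bar>s - a\<bar>)))"
proof -
  have "integrable lborel (\<lambda>s. indicator {0<..} s * exp (of_real s * of_real (- c) :: complex))"
    using assms by (intro exp_halfline(1)) simp
  moreover have "cmod (indicator {0<..} s * exp (of_real s * of_real (- c))) = indicator {0<..} s * exp (- (c * s))" for s :: real
    by (auto simp: norm_mult mult.commute split: split_indicator)
  ultimately have h: "integrable lborel (\<lambda>s. indicator {0<..} s * exp (- (c * s)))"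
    using integrable_norm by fastforce
  have h': "integrable lborel (\<lambda>s. (\<lambda>s. indicator {0<..} s * exp (- (c * s))) (0 + (- 1) * s))"
    using h by (intro lborel_integrable_real_affine) auto
  have "integrable lborel (\<lambda>s. exp (- (c * \<bar>s\<bar>)))"
  proof (rule integrable_cong_AE[THEN iffD1, OF _ _ _ Bochner_Integration.integrable_add[OF h h']])
    have "AE s in lborel. s \<noteq> (0::real)" by (rule AE_lborel_singleton)
    then show "AE s in lborel. indicator {0<..} s * exp (- (c * s)) + (\<lambda>s. indicator {0<..} s * exp (- (c * s))) (0 + (- 1) * s)
        = exp (- (c * \<bar>s\<bar>))"
      by eventually_elim (auto split: split_indicator)
  qed measurable
  then have "integrable lborel (\<lambda>s. exp (- (c * \<bar>- a + 1 * s\<bar>)))"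
    by (intro lborel_integrable_real_affine[of "\<lambda>s. exp (- (c * \<bar>s\<bar>))"]) auto
  then show ?thesis by simp
qed

section \<open>The alternating sum over the endpoints as an integral over the interval union\<close>

lemma increasing_steps:
  fixes a :: "nat \<Rightarrow> real"
  assumes a: "\<forall>j\<in>{1..<N}. a j < a (Suc j)" and "1 \<le> i" "i \<le> j" "j \<le> N"
  shows "a i \<le> a j"
  using assms(3,4)
proof (induction j rule: dec_induct)
  case (step j)
  then have "a j < a (Suc j)" using a assms(2) by auto
  then show ?case using step by auto
qed simp

lemma interval_union_borel [measurable]: "interval_union N a \<in> sets borel"
  unfolding interval_union_def by (intro sets.Un sets.finite_UN) auto

lemma interval_union_ge:
  assumes "\<forall>j\<in>{1..<N}. a j < a (Suc j)" "s \<in> interval_union N a"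
  shows "a 1 \<le> s"
proof -
  from assms(2) consider k where "k \<in> {1..N div 2}" "a (2 * k - 1) \<le> s" | "odd N" "a N \<le> s"
    unfolding interval_union_def by (auto split: if_splits)
  then show ?thesis
  proof cases
    case 1
    then have "a 1 \<le> a (2 * k - 1)" by (intro increasing_steps[OF assms(1)]) auto
    with 1 show ?thesis by simp
  next
    case 2
    then have "a 1 \<le> a N" by (intro increasing_steps[OF assms(1)]) (auto elim: oddE)
    with 2 show ?thesis by simp
  qed
qed

text \<open>Off the endpoints each interval contributes the difference of the indicators of two
  half-lines, and for odd N the last half-line stays unpaired. Endpoints are excluded because the
  intervals are closed and the half-lines open.\<close>

lemma indicator_interval_union:
  fixes a :: "nat \<Rightarrow> real"
  assumes a: "\<forall>j\<in>{1..<N}. a j < a (Suc j)" and s: "\<And>j. j \<in> {1..N} \<Longrightarrow> s \<noteq> a j"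
  shows "indicator (interval_union N a) s = (\<Sum>j=1..N. (-1) ^ (j + 1) * indicator {a j<..} s :: complex)"
proof -
  define U where "U m = (\<Union>k\<in>{1..m}. {a (2 * k - 1)..a (2 * k)})" for m
  have U: "indicator (U m) s = (\<Sum>j=1..2 * m. (-1) ^ (j + 1) * indicator {a j<..} s :: complex)" if "2 * m \<le> N" for m
    using that
  proof (induction m)
    case (Suc m)
    have lt: "a (2 * m + 1) < a (2 * m + 2)" using a Suc.prems by auto
    have ne: "s \<noteq> a (2 * m + 1)" "s \<noteq> a (2 * m + 2)" using s Suc.prems by auto
    have US: "U (Suc m) = U m \<union> {a (2 * m + 1)..a (2 * m + 2)}"
      unfolding U_def by (simp add: atLeastAtMostSuc_conv Un_commute)
    have disj: "s \<notin> U m" if "s > a (2 * m + 1)"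
    proof
      assume "s \<in> U m"
      then obtain k where k: "k \<in> {1..m}" "s \<le> a (2 * k)" by (auto simp: U_def)
      then have "a (2 * k) \<le> a (2 * m + 1)" using Suc.prems by (intro increasing_steps[OF a]) auto
      with k that show False by simp
    qed
    have "indicator (U (Suc m)) s = indicator (U m) s + (indicator {a (2 * m + 1)<..} s - indicator {a (2 * m + 2)<..} s :: complex)"
      using disj ne lt unfolding US by (auto split: split_indicator)
    also have "\<dots> = (\<Sum>j=1..2 * Suc m. (-1) ^ (j + 1) * indicator {a j<..} s :: complex)"
      using Suc by simp
    finally show ?case .
  qed (simp add: U_def)
  show ?thesis
  proof (cases "even N")
    case True
    then have "interval_union N a = U (N div 2)" "2 * (N div 2) = N" by (auto simp: interval_union_def U_def)
    then show ?thesis using U[of "N div 2"] by simp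
  next
    case False
    then obtain m where m: "N = 2 * m + 1" by (elim oddE)
    have IU: "interval_union N a = U m \<union> {a N..}" using m by (auto simp: interval_union_def U_def)
    have disj: "s \<notin> U m" if "s > a N"
    proof
      assume "s \<in> U m"
      then obtain k where k: "k \<in> {1..m}" "s \<le> a (2 * k)" by (auto simp: U_def)
      then have "a (2 * k) \<le> a N" using m by (intro increasing_steps[OF a]) auto
      with k that show False by simp
    qed
    have "s \<noteq> a N" using s m by auto
    then have "indicator (interval_union N a) s = indicator (U m) s + (indicator {a N<..} s :: complex)"
      using disj unfolding IU by (auto split: split_indicator)
    also have "\<dots> = (\<Sum>j=1..N. (-1) ^ (j + 1) * indicator {a j<..} s :: complex)"
      using U[of m] m by simp
    finally show ?thesis .
  qed
qed

text \<open>The origin of the set I: the alternating exponential sum in the block from \<gamma>R to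
  \<gamma>L is, up to sign, z times an integral transform of its indicator. The endpoints form a
  null set.\<close>

lemma exp_interval_union_integral:
  fixes a :: "nat \<Rightarrow> real"
  assumes a: "\<forall>j\<in>{1..<N}. a j < a (Suc j)" and z: "Re z < 0"
  shows "(LINT s|lborel. indicator (interval_union N a) s * exp (of_real s * z))
      = - (\<Sum>j=1..N. (-1) ^ (j + 1) * exp (of_real (a j) * z)) / z"
proof -
  have "(LINT s|lborel. indicator (interval_union N a) s * exp (of_real s * z))
      = (LINT s|lborel. (\<Sum>j=1..N. (-1) ^ (j + 1) * (indicator {a j<..} s * exp (of_real s * z))))"
  proof (rule integral_cong_AE)
    have "AE s in lborel. \<forall>j\<in>{1..N}. s \<noteq> a j"
      by (intro AE_finite_allI AE_lborel_singleton) auto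
    then show "AE s in lborel. indicator (interval_union N a) s * exp (of_real s * z)
        = (\<Sum>j=1..N. (-1) ^ (j + 1) * (indicator {a j<..} s * exp (of_real s * z)))"
    proof eventually_elim
      case (elim s)
      then show ?case by (subst indicator_interval_union[OF a]) (auto simp: sum_distrib_left sum_distrib_right mult_ac)
    qed
  qed measurable
  also have "\<dots> = (\<Sum>j=1..N. (-1) ^ (j + 1) * (- exp (of_real (a j) * z) / z))"
    using exp_halfline[OF z] by (subst Bochner_Integration.integral_sum) auto
  also have "\<dots> = - (\<Sum>j=1..N. (-1) ^ (j + 1) * exp (of_real (a j) * z)) / z"
    by (simp add: sum_divide_distrib sum_negf)
  finally show ?thesis .
qed

section \<open>The factorisation of the kernel\<close>

lemma dominated_kernel_restrict_left:
  assumes K: "dominated_kernel M N K" and A: "A \<in> sets M"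
  shows "dominated_kernel (restrict_space M A) N K"
proof -
  obtain f g where "dominates M N f g K" using K unfolding dominated_kernel_def by blast
  note d = dominatesD[OF this]
  have AM: "A \<inter> space M \<in> sets M" using A by auto
  have "(\<lambda>w. (fst w, snd w)) \<in> measurable (restrict_space M A \<Otimes>\<^sub>M N) (M \<Otimes>\<^sub>M N)"
    by (intro measurable_Pair measurable_snd
        measurable_compose[OF measurable_fst measurable_restrict_space1[OF measurable_ident_sets[OF refl]]])
  from measurable_compose[OF this d(7)]
  have m: "(\<lambda>(x, y). K x y) \<in> borel_measurable (restrict_space M A \<Otimes>\<^sub>M N)" by simp
  have i: "integrable (restrict_space M A) (\<lambda>x. (f x)\<^sup>2)"
    unfolding integrable_restrict_space[OF AM] by (rule integrable_mult_indicator[OF A d(3)])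
  show ?thesis
    by (rule dominated_kernelI[of f _ g]) (use d m i in \<open>auto simp: space_restrict_space intro: measurable_restrict_space1\<close>)
qed

lemma dominated_kernel_restrict_right:
  assumes K: "dominated_kernel M N K" and A: "A \<in> sets N"
  shows "dominated_kernel M (restrict_space N A) K"
proof -
  obtain f g where "dominates M N f g K" using K unfolding dominated_kernel_def by blast
  note d = dominatesD[OF this]
  have AM: "A \<inter> space N \<in> sets N" using A by auto
  have "(\<lambda>w. (fst w, snd w)) \<in> measurable (M \<Otimes>\<^sub>M restrict_space N A) (M \<Otimes>\<^sub>M N)"
    by (intro measurable_Pair measurable_fst
        measurable_compose[OF measurable_snd measurable_restrict_space1[OF measurable_ident_sets[OF refl]]])
  from measurable_compose[OF this d(7)]
  have m: "(\<lambda>(x, y). K x y) \<in> borel_measurable (M \<Otimes>\<^sub>M restrict_space N A)" by simp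
  have i: "integrable (restrict_space N A) (\<lambda>x. (g x)\<^sup>2)"
    unfolding integrable_restrict_space[OF AM] by (rule integrable_mult_indicator[OF A d(4)])
  show ?thesis
    by (rule dominated_kernelI[of f _ g]) (use d m i in \<open>auto simp: space_restrict_space intro: measurable_restrict_space1\<close>)
qed

lemma kernel_section_l2_right:
  assumes "dominated_kernel M N K" "y \<in> space N"
  shows "(\<lambda>x. K x y) \<in> l2 M"
proof -
  obtain f g where "dominates M N f g K" using assms(1) unfolding dominated_kernel_def by blast
  then have "dominated_kernel N M (\<lambda>y x. cnj (K x y))"
    using dominates_adjoint unfolding dominated_kernel_def by blast
  from kernel_section_l2(1)[OF this assms(2)] show ?thesis by simp
qed

lemma kernel_comp_assoc:
  assumes M: "sigma_finite_measure M" and Z: "sigma_finite_measure Z"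
    and A: "dominated_kernel X M A" and G: "dominated_kernel M Z G" and F: "dominated_kernel Z Y F"
    and x: "x \<in> space X" and y: "y \<in> space Y"
  shows "kernel_comp Z (kernel_comp M A G) F x y = kernel_comp M A (kernel_comp Z G F) x y"
  using kernel_apply_comp[OF Z M A G kernel_section_l2_right[OF F y] x]
  by (simp add: kernel_apply_def kernel_comp_def)

lemma fredholm_coeff_cong:
  assumes "\<And>x y. x \<in> space M \<Longrightarrow> y \<in> space M \<Longrightarrow> K x y = K' x y"
  shows "fredholm_coeff M K n = fredholm_coeff M K' n"
  unfolding fredholm_coeff_def
  by (intro arg_cong2[where f="(*)"] refl Bochner_Integration.integral_cong)
     (auto simp: fredholm_minor_mdet space_PiM PiE_iff intro!: mdet_cong assms)

locale airy_intervals = right_half_plane_contour +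
  fixes N :: nat and a :: "nat \<Rightarrow> real"
  assumes increasing: "\<forall>j\<in>{1..<N}. a j < a (Suc j)"
begin

abbreviation I :: "real set" where "I \<equiv> interval_union N a"

lemma I_ge: "s \<in> I \<Longrightarrow> a 1 \<le> s"
  by (rule interval_union_ge[OF increasing])

text \<open>Since \<open>I\<close> lies to the right of \<open>a 1\<close>, the half-line to the left of \<open>a 1\<close> is free to factorise
  the block of the kernel that maps \<open>\<gamma>\<^sub>L\<close> to \<open>\<gamma>\<^sub>R\<close>, while \<open>I\<close> itself factorises the other block.\<close>

definition E :: "complex \<Rightarrow> real \<Rightarrow> complex" where
  "E z s = (if z \<in> range \<gamma> \<and> s < a 1 then exp (z ^ 3 / 6 + of_real (s - a 1) * z)
            else if - z \<in> range \<gamma> \<and> s \<in> I then exp (- (z ^ 3) / 6 + of_real s * z) else 0)"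

text \<open>The sign on I cancels the minus sign in \<open>exp_interval_union_integral\<close>; the
  prefactor 1 / (2 \<pi> i) of \<open>f_vec\<close> is placed entirely here.\<close>

definition G :: "complex \<Rightarrow> real \<Rightarrow> complex" where
  "G z s = (if s \<in> I then - 1 else 1) * E z s / (2 * of_real pi * \<i>)"

text \<open>The second argument of the kernel lies on the contour opposite to the first, and
  reflection turns its exponentials into those of \<open>E\<close>. The unit tangent accounts for
  the complex line element.\<close>

definition F :: "real \<Rightarrow> complex \<Rightarrow> complex" where
  "F s z = E (- z) s * \<tau> z"

definition K :: "complex \<Rightarrow> complex \<Rightarrow> complex" where
  "K = line_element_kernel \<gamma> (K_tilde \<gamma> N a)"

lemma E_zero: "\<not> (z \<in> range \<gamma> \<and> s < a 1) \<Longrightarrow> \<not> (- z \<in> range \<gamma> \<and> s \<in> I) \<Longrightarrow> E z s = 0"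
  unfolding E_def by (simp only: if_False)

lemma E_measurable [measurable]: "(\<lambda>w. E (fst w) (snd w)) \<in> borel_measurable (borel \<Otimes>\<^sub>M borel)"
  unfolding E_def by measurable

text \<open>The contours keep distance \<delta> from the imaginary axis, with Re z \<ge> \<delta>
  where s < a 1 and Re z \<le> - \<delta> where s \<ge> a 1; in both cases exp ((s - a 1) z) has
  modulus at most exp (- \<delta> |s - a 1|). On the left contour a factor exp (a 1 z) is left over,
  whence the parameter |a 1| of \<open>\<Phi>\<close>.\<close>

lemma E_bound:
  obtains \<delta> where "\<delta> > 0" "\<And>z s. cmod (E z s) \<le> \<Phi> \<bar>a 1\<bar> z * exp (- (\<delta> * \<bar>s - a 1\<bar>))"
proof -
  obtain \<delta> where \<delta>: "\<delta> > 0" "\<And>t. \<delta> \<le> Re (\<gamma> t)" using contour_distance by blast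
  have "cmod (E z s) \<le> \<Phi> \<bar>a 1\<bar> z * exp (- (\<delta> * \<bar>s - a 1\<bar>))" for z s
  proof -
    consider (R) "z \<in> range \<gamma>" "s < a 1" | (L) "- z \<in> range \<gamma>" "s \<in> I" "\<not> (z \<in> range \<gamma> \<and> s < a 1)"
      | (Z) "E z s = 0" using E_zero by blast
    then show ?thesis
    proof cases
      case R
      have "\<delta> \<le> Re z" using R \<delta>(2) by auto
      then have "(s - a 1) * Re z \<le> (s - a 1) * \<delta>" using R by (intro mult_left_mono_neg) auto
      moreover have "0 \<le> \<bar>a 1\<bar> * cmod z" by simp
      moreover have "- (\<delta> * \<bar>s - a 1\<bar>) = (s - a 1) * \<delta>" using R by (simp add: algebra_simps)
      ultimately have "Re (z ^ 3) / 6 + (s - a 1) * Re z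
          \<le> (Re (z ^ 3) / 6 + \<bar>a 1\<bar> * cmod z) + - (\<delta> * \<bar>s - a 1\<bar>)" by linarith
      moreover have "cmod (E z s) = exp (Re (z ^ 3) / 6 + (s - a 1) * Re z)"
        using R by (simp add: E_def norm_exp_eq_Re)
      moreover have "\<Phi> \<bar>a 1\<bar> z = exp (Re (z ^ 3) / 6 + \<bar>a 1\<bar> * cmod z)"
        using Re_range_pos[OF R(1)] by (simp add: \<Phi>_def)
      ultimately show ?thesis by (simp flip: exp_add)
    next
      case L
      have z: "\<delta> \<le> - Re z" using L(1) \<delta>(2) by (metis imageE uminus_complex.sel(1))
      have s: "a 1 \<le> s" by (rule I_ge[OF L(2)])
      have "(s - a 1) * Re z \<le> (s - a 1) * (- \<delta>)" using s z by (intro mult_left_mono) auto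
      moreover have "- (\<delta> * \<bar>s - a 1\<bar>) = (s - a 1) * (- \<delta>)" using s by (simp add: algebra_simps)
      moreover have "a 1 * Re z \<le> \<bar>a 1\<bar> * cmod z"
        using abs_ge_self[of "a 1 * Re z"] mult_left_mono[OF abs_Re_le_cmod[of z], of "\<bar>a 1\<bar>"] by (simp add: abs_mult)
      moreover have "s * Re z = (s - a 1) * Re z + a 1 * Re z" by (simp add: algebra_simps)
      ultimately have "- Re (z ^ 3) / 6 + s * Re z
          \<le> (- Re (z ^ 3) / 6 + \<bar>a 1\<bar> * cmod z) + - (\<delta> * \<bar>s - a 1\<bar>)" by linarith
      moreover have "cmod (E z s) = exp (- Re (z ^ 3) / 6 + s * Re z)"
      proof -
        have "E z s = exp (- (z ^ 3) / 6 + of_real s * z)" unfolding E_def using L by (simp only: if_False if_True simp_thms)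
        then show ?thesis by (simp add: norm_exp_eq_Re)
      qed
      moreover have "\<Phi> \<bar>a 1\<bar> z = exp (- Re (z ^ 3) / 6 + \<bar>a 1\<bar> * cmod z)"
        using z \<delta>(1) by (simp add: \<Phi>_def)
      ultimately show ?thesis by (simp flip: exp_add)
    next
      case Z
      then show ?thesis using \<Phi>_pos[of "\<bar>a 1\<bar>" z] by simp
    qed
  qed
  with \<delta>(1) show ?thesis by (rule that)
qed

lemma G_dominated: "dominated_kernel arc lborel G" and F_dominated: "dominated_kernel lborel arc F"
proof -
  obtain \<delta> where \<delta>: "\<delta> > 0" "\<And>z s. cmod (E z s) \<le> \<Phi> \<bar>a 1\<bar> z * exp (- (\<delta> * \<bar>s - a 1\<bar>))"
    using E_bound by blast
  have v: "integrable lborel (\<lambda>s. (exp (- (\<delta> * \<bar>s - a 1\<bar>)))\<^sup>2)"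
    using exp_abs_integrable[of "2 * \<delta>" "a 1"] \<delta>(1) by (simp add: power2_eq_square mult.assoc flip: exp_add)
  have sb: "sets (borel \<Otimes>\<^sub>M borel :: (complex \<times> real) measure) = sets (arc \<Otimes>\<^sub>M lborel)"
    by (intro sets_pair_measure_cong) simp_all
  have sb': "sets (borel \<Otimes>\<^sub>M borel :: (real \<times> complex) measure) = sets (lborel \<Otimes>\<^sub>M arc)"
    by (intro sets_pair_measure_cong) simp_all
  have Gm: "(\<lambda>w. G (fst w) (snd w)) \<in> borel_measurable (borel \<Otimes>\<^sub>M borel)"
    unfolding G_def by measurable
  have "(\<lambda>w. (- snd w, fst w)) \<in> measurable (borel \<Otimes>\<^sub>M borel) (borel \<Otimes>\<^sub>M borel :: (complex \<times> real) measure)" by measurable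
  from measurable_compose[OF this E_measurable]
  have "(\<lambda>w. E (- snd w) (fst w)) \<in> borel_measurable (borel \<Otimes>\<^sub>M borel)" by simp
  then have Fm: "(\<lambda>w. F (fst w) (snd w)) \<in> borel_measurable (borel \<Otimes>\<^sub>M borel)"
    unfolding F_def by measurable
  show "dominated_kernel arc lborel G"
  proof (rule dominated_kernelI[of "\<Phi> \<bar>a 1\<bar>" _ "\<lambda>s. exp (- (\<delta> * \<bar>s - a 1\<bar>))"])
    show "(\<lambda>(x, y). G x y) \<in> borel_measurable (arc \<Otimes>\<^sub>M lborel)"
      using Gm measurable_cong_sets[OF sb refl] by (simp add: split_def)
    fix z s
    have "cmod (G z s) \<le> cmod (E z s)"
    proof -
      have "cmod (G z s) = cmod (E z s) / (2 * pi)" by (simp add: G_def norm_mult norm_divide)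
      also have "\<dots> \<le> cmod (E z s)" using pi_gt3 by (simp add: divide_le_eq mult_left_le mult_le_cancel_left1)
      finally show ?thesis .
    qed
    then show "cmod (G z s) \<le> \<Phi> \<bar>a 1\<bar> z * exp (- (\<delta> * \<bar>s - a 1\<bar>))" using \<delta>(2)[of z s] by simp
  qed (use \<Phi>_square_integrable v in \<open>auto simp: \<Phi>_pos less_imp_le\<close>)
  show "dominated_kernel lborel arc F"
  proof (rule dominated_kernelI[of "\<lambda>s. exp (- (\<delta> * \<bar>s - a 1\<bar>))" _ "\<Phi> \<bar>a 1\<bar>"])
    show "(\<lambda>(x, y). F x y) \<in> borel_measurable (lborel \<Otimes>\<^sub>M arc)"
      using Fm measurable_cong_sets[OF sb' refl] by (simp add: split_def)
    fix s z
    have "cmod (F s z) \<le> cmod (E (- z) s) * 1"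
      unfolding F_def norm_mult by (intro mult_left_mono \<tau>_bounded) simp
    then show "cmod (F s z) \<le> exp (- (\<delta> * \<bar>s - a 1\<bar>)) * \<Phi> \<bar>a 1\<bar> z"
      using \<delta>(2)[of "- z" s] by (simp add: \<Phi>_minus mult.commute)
  qed (use \<Phi>_square_integrable v in \<open>auto simp: \<Phi>_pos less_imp_le\<close>)
qed

lemma range_uminus: "z \<in> range (\<lambda>t. - \<gamma> t) \<longleftrightarrow> - z \<in> range \<gamma>"
proof
  assume "z \<in> range (\<lambda>t. - \<gamma> t)"
  then obtain t where "z = - \<gamma> t" by blast
  then have "- z = \<gamma> t" by simp
  then show "- z \<in> range \<gamma>" by simp
next
  assume "- z \<in> range \<gamma>"
  then obtain t where "- z = \<gamma> t" by blast
  then have "z = - \<gamma> t" by (metis minus_minus)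
  then show "z \<in> range (\<lambda>t. - \<gamma> t)" by blast
qed

lemma K_tilde_RL:
  assumes "z \<in> range \<gamma>" "- w \<in> range \<gamma>"
  shows "K_tilde \<gamma> N a z w = exp (z ^ 3 / 6 - w ^ 3 / 6) / (2 * of_real pi * \<i> * (z - w))"
proof -
  have z: "- z \<notin> range \<gamma>" using range_disjoint[OF assms(1)] .
  have "(\<Sum>j\<le>N. f_vec \<gamma> a z j * g_vec \<gamma> a w j) = (\<Sum>j\<in>{0}. f_vec \<gamma> a z j * g_vec \<gamma> a w j)"
    by (rule sum.mono_neutral_right) (use z in \<open>auto simp: f_vec_def range_uminus\<close>)
  then have "K_tilde \<gamma> N a z w = f_vec \<gamma> a z 0 * g_vec \<gamma> a w 0 / (z - w)"
    unfolding K_tilde_def by simp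
  moreover have "f_vec \<gamma> a z 0 = exp (z ^ 3 / 6) / (2 * of_real pi * \<i>)" "g_vec \<gamma> a w 0 = exp (- (w ^ 3) / 6)"
    using assms by (simp_all add: f_vec_def g_vec_def range_uminus)
  moreover have "exp (z ^ 3 / 6 - w ^ 3 / 6) = exp (z ^ 3 / 6) * exp (- (w ^ 3) / 6)"
    by (simp flip: exp_add)
  ultimately show ?thesis by simp
qed

lemma K_tilde_LR:
  assumes "- z \<in> range \<gamma>" "w \<in> range \<gamma>"
  shows "K_tilde \<gamma> N a z w = exp (w ^ 3 / 6 - z ^ 3 / 6) / (2 * of_real pi * \<i>) *
    ((\<Sum>j=1..N. (-1) ^ (j + 1) * exp (of_real (a j) * (z - w))) / (z - w))"
proof -
  have z: "z \<notin> range \<gamma>" using range_disjoint[of z] assms(1) by auto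
  have "(\<Sum>j\<le>N. f_vec \<gamma> a z j * g_vec \<gamma> a w j) = (\<Sum>j=1..N. f_vec \<gamma> a z j * g_vec \<gamma> a w j)"
  proof (rule sum.mono_neutral_right)
    show "\<forall>j\<in>{..N} - {1..N}. f_vec \<gamma> a z j * g_vec \<gamma> a w j = 0"
    proof
      fix j assume "j \<in> {..N} - {1..N}"
      then have "j = 0" by auto
      then show "f_vec \<gamma> a z j * g_vec \<gamma> a w j = 0" using z by (simp add: f_vec_def)
    qed
  qed auto
  also have "\<dots> = (\<Sum>j=1..N. exp (w ^ 3 / 6 - z ^ 3 / 6) / (2 * of_real pi * \<i>) * ((-1) ^ (j + 1) * exp (of_real (a j) * (z - w))))"
  proof (intro sum.cong refl)
    fix j assume "j \<in> {1..N}"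
    then have j: "j \<noteq> 0" by auto
    have "exp (- (z ^ 3) / 6 + of_real (a j) * z) * exp (w ^ 3 / 6 - of_real (a j) * w)
        = exp (w ^ 3 / 6 - z ^ 3 / 6) * exp (of_real (a j) * (z - w))"
      by (simp add: algebra_simps flip: exp_add)
    then show "f_vec \<gamma> a z j * g_vec \<gamma> a w j
        = exp (w ^ 3 / 6 - z ^ 3 / 6) / (2 * of_real pi * \<i>) * ((-1) ^ (j + 1) * exp (of_real (a j) * (z - w)))"
      using assms j by (simp add: f_vec_def g_vec_def range_uminus mult_ac)
  qed
  finally show ?thesis unfolding K_tilde_def by (simp add: sum_distrib_left)
qed

lemma K_tilde_zero:
  assumes "\<not> (z \<in> range \<gamma> \<and> - w \<in> range \<gamma>)" "\<not> (- z \<in> range \<gamma> \<and> w \<in> range \<gamma>)"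
  shows "K_tilde \<gamma> N a z w = 0"
proof -
  have "f_vec \<gamma> a z j * g_vec \<gamma> a w j = 0" for j
    using assms by (auto simp: f_vec_def g_vec_def range_uminus indicator_def)
  then show ?thesis by (simp add: K_tilde_def)
qed

text \<open>For z on \<gamma>R and w on \<gamma>L only s < a 1 contributes and produces 1 / (z - w);
  with the contours exchanged only s in I contributes and produces the alternating sum.\<close>

lemma K_factorisation: "kernel_comp lborel G F = K"
proof (intro ext)
  fix z w
  let ?c = "1 / (2 * of_real pi * \<i>) :: complex"
  consider (RL) "z \<in> range \<gamma>" "- w \<in> range \<gamma>" | (LR) "- z \<in> range \<gamma>" "w \<in> range \<gamma>"
    | (no) "\<not> (z \<in> range \<gamma> \<and> - w \<in> range \<gamma>)" "\<not> (- z \<in> range \<gamma> \<and> w \<in> range \<gamma>)" by blast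
  then show "kernel_comp lborel G F z w = K z w"
  proof cases
    case RL
    have n: "- z \<notin> range \<gamma>" "w \<notin> range \<gamma>" using range_disjoint[OF RL(1)] range_disjoint[of w] RL by auto
    have re: "Re (z - w) > 0" using Re_range_pos[OF RL(1)] Re_range_pos[OF RL(2)] by simp
    have "G z s * F s w = (?c * exp (z ^ 3 / 6 - w ^ 3 / 6) * \<tau> w) * (indicator {..<a 1} s * exp (of_real (s - a 1) * (z - w)))" for s
    proof -
      have "exp (z ^ 3 / 6 + of_real (s - a 1) * z) * exp ((- w) ^ 3 / 6 + of_real (s - a 1) * (- w))
          = exp (z ^ 3 / 6 - w ^ 3 / 6) * exp (of_real (s - a 1) * (z - w))"
        by (simp add: algebra_simps flip: exp_add)
      moreover have "s \<notin> I" if "s < a 1" using I_ge[of s] that by auto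
      ultimately show ?thesis using RL n by (auto simp: G_def F_def E_def split: split_indicator)
    qed
    then have "kernel_comp lborel G F z w = (?c * exp (z ^ 3 / 6 - w ^ 3 / 6) * \<tau> w) * (1 / (z - w))"
      unfolding kernel_comp_def using exp_halfline_left[OF re, of "a 1"] by simp
    then show ?thesis by (simp add: K_def line_element_kernel_def K_tilde_RL[OF RL])
  next
    case LR
    have n: "z \<notin> range \<gamma>" "- w \<notin> range \<gamma>" using range_disjoint[OF LR(2)] range_disjoint[of z] LR by auto
    have re: "Re (z - w) < 0" using Re_range_pos[OF LR(1)] Re_range_pos[OF LR(2)] by simp
    have "G z s * F s w = (- ?c * exp (w ^ 3 / 6 - z ^ 3 / 6) * \<tau> w) * (indicator I s * exp (of_real s * (z - w)))" for s
    proof -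
      have "exp (- (z ^ 3) / 6 + of_real s * z) * exp (- ((- w) ^ 3) / 6 + of_real s * (- w))
          = exp (w ^ 3 / 6 - z ^ 3 / 6) * exp (of_real s * (z - w))"
        by (simp add: algebra_simps flip: exp_add)
      then show ?thesis using LR n by (auto simp: G_def F_def E_def split: split_indicator)
    qed
    then have "kernel_comp lborel G F z w = (- ?c * exp (w ^ 3 / 6 - z ^ 3 / 6) * \<tau> w)
        * (- (\<Sum>j=1..N. (-1) ^ (j + 1) * exp (of_real (a j) * (z - w))) / (z - w))"
      unfolding kernel_comp_def using exp_interval_union_integral[OF increasing re] by simp
    then show ?thesis unfolding K_def line_element_kernel_def K_tilde_LR[OF LR] by simp
  next
    case no
    \<comment> \<open>A nonzero product would require s to lie both to the left of a 1 and in
      I.\<close>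
    have "G z s * F s w = 0" for s
      using no range_disjoint[of z] I_ge[of s] by (auto simp: G_def F_def E_def)
    then show ?thesis
      unfolding kernel_comp_def by (simp only: K_def line_element_kernel_def K_tilde_zero[OF no]) simp
  qed
qed

lemma K_dominated: "dominated_kernel arc arc K"
  unfolding K_factorisation[symmetric]
  by (rule dominated_kernel_comp[OF G_dominated F_dominated]) (rule sigma_finite_lborel)

lemma K_trace_class: "l2_trace_class arc (integral_operator arc K)"
  unfolding integral_operator_kernel_apply K_factorisation[symmetric]
  by (rule l2_trace_class_comp[OF sigma_finite_arc sigma_finite_lborel G_dominated F_dominated])

section \<open>From the contour kernel to the Airy kernel on the interval union\<close>

abbreviation onI :: "real measure" where "onI \<equiv> restrict_space lborel I"

lemma sigma_finite_onI: "sigma_finite_measure onI"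
  by (rule sigma_finite_measure_restrict_space[OF sigma_finite_lborel]) simp

lemma space_onI [simp]: "space onI = I"
  by (simp add: space_restrict_space)

text \<open>The block of K that maps functions on \<gamma>L to functions on \<gamma>R.\<close>

definition A :: "complex \<Rightarrow> complex \<Rightarrow> complex" where
  "A z w = indicator (range \<gamma>) z * K z w"

lemma A_dominated: "dominated_kernel arc arc A"
  unfolding A_def by (rule dominated_kernel_indicator[OF K_dominated]) simp

lemma G_dominated_I: "dominated_kernel arc onI G" and F_dominated_I: "dominated_kernel onI arc F"
  by (rule dominated_kernel_restrict_right[OF G_dominated], simp,
      rule dominated_kernel_restrict_left[OF F_dominated], simp)

text \<open>For z on \<gamma>L the function \<open>G z\<close> vanishes outside I, so the
  factorisation through the whole line is already one through I.\<close>

lemma K_factorisation_I: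
  assumes "- z \<in> range \<gamma>"
  shows "kernel_comp onI G F z w = K z w"
proof -
  have z: "z \<notin> range \<gamma>" using range_disjoint[of z] assms by auto
  have "kernel_comp onI G F z w = (LINT s|lborel. indicator I s *\<^sub>R (G z s * F s w))"
    unfolding kernel_comp_def by (rule integral_restrict_space) simp
  also have "\<dots> = kernel_comp lborel G F z w"
    unfolding kernel_comp_def using z
    by (intro Bochner_Integration.integral_cong) (auto simp: G_def E_def split: split_indicator)
  finally show ?thesis unfolding K_factorisation .
qed

lemma K_zero: "(z \<in> range \<gamma> \<longleftrightarrow> w \<in> range \<gamma>) \<Longrightarrow> K z w = 0"
  unfolding K_def line_element_kernel_def
  using range_disjoint[of z] range_disjoint[of w] by (subst K_tilde_zero) auto

text \<open>\<open>A z v\<close> vanishes unless v lies on \<gamma>L, which is where K factors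
  through I; associativity does the rest.\<close>

lemma A_comp_K: "kernel_comp arc A K z w = kernel_comp onI (kernel_comp arc A G) F z w"
proof -
  have "kernel_comp arc A K z w = kernel_comp arc A (kernel_comp onI G F) z w"
    unfolding kernel_comp_def[of arc]
  proof (intro Bochner_Integration.integral_cong refl)
    fix v
    show "A z v * K v w = A z v * kernel_comp onI G F v w"
    proof (cases "- v \<in> range \<gamma>")
      case True
      then show ?thesis by (simp add: K_factorisation_I)
    next
      case False
      then have "A z v = 0" using range_disjoint[of z]
        by (auto simp: A_def K_def line_element_kernel_def indicator_def intro!: disjI1 K_tilde_zero)
      then show ?thesis by simp
    qed
  qed
  also have "\<dots> = kernel_comp onI (kernel_comp arc A G) F z w"
    by (rule kernel_comp_assoc[OF sigma_finite_arc sigma_finite_onI A_dominated G_dominated_I F_dominated_I, symmetric]) simp_all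
  finally show ?thesis .
qed

lemma A_comp_G_dominated: "dominated_kernel arc onI (kernel_comp arc A G)"
  by (rule dominated_kernel_comp[OF A_dominated G_dominated_I sigma_finite_arc])

text \<open>Here z on \<gamma>R plays the role of \<mu> and w on \<gamma>L that of \<lambda>. The
  cube z^3/6 occurs once in \<open>F\<close> and once in \<open>K_tilde\<close>, the cube w^3/6 once
  in \<open>K_tilde\<close> and once in \<open>G\<close>, and together they make up the thirds of
  the Airy phases; the two prefactors 1 / (2 \<pi> i) come from \<open>K_tilde\<close> and
  \<open>G\<close>.\<close>

lemma airy_kernel_factorisation:
  assumes s: "s \<in> I" and t: "t \<in> I"
  shows "kernel_comp arc F (kernel_comp arc A G) s t = airy_kernel \<gamma> s t"
proof -
  let ?c = "1 / (2 * of_real pi * \<i>) :: complex"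
  define Q where "Q z = kernel_comp arc A G z t" for z
  have G_meas: "(\<lambda>w. G w t) \<in> borel_measurable borel"
    using measurable_compose[OF measurable_Pair2'[of t lborel arc] dominated_kernel_measurable[OF G_dominated]] by simp
  have Q_meas: "Q \<in> borel_measurable borel"
    using measurable_compose[OF measurable_Pair2'[of t onI arc] dominated_kernel_measurable[OF A_comp_G_dominated]] t
    by (simp add: Q_def[abs_def])
  have E_meas: "(\<lambda>z. E (- z) s) \<in> borel_measurable borel"
    using measurable_compose[of "\<lambda>z. (- z, s)" borel "borel \<Otimes>\<^sub>M borel" "\<lambda>w. E (fst w) (snd w)" borel] E_measurable by simp
  have K_meas: "(\<lambda>w. K_tilde \<gamma> N a z w) \<in> borel_measurable borel" for z
  proof -
    have [measurable]: "range (\<lambda>t. - \<gamma> t) \<in> sets borel"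
    proof -
      have "range (\<lambda>t. - \<gamma> t) = uminus -` range \<gamma> \<inter> space borel" using range_uminus by auto
      also have "\<dots> \<in> sets borel" by (rule measurable_sets[of uminus borel borel]) auto
      finally show ?thesis .
    qed
    show ?thesis unfolding K_tilde_def g_vec_def by measurable
  qed
  \<comment> \<open>The tangent contained in \<open>A\<close> turns the arc length integral into
    contour integrals, and the part over \<gamma>R vanishes since K has no block from \<gamma>R to
    itself.\<close>
  have Q: "Q z = line_integral (\<lambda>u. - \<gamma> u) (\<lambda>w. K_tilde \<gamma> N a z w * G w t)" if z: "z \<in> range \<gamma>" for z
  proof -
    have AG: "A z w * G w t = (K_tilde \<gamma> N a z w * G w t) * \<tau> w" for w
      using z by (simp add: A_def K_def line_element_kernel_def)
    have "integrable arc (\<lambda>w. A z w * G w t)"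
      by (rule kernel_comp_integrable[OF A_dominated G_dominated_I]) (use t in auto)
    then have "Q z = line_integral \<gamma> (\<lambda>w. K_tilde \<gamma> N a z w * G w t) + line_integral (\<lambda>u. - \<gamma> u) (\<lambda>w. K_tilde \<gamma> N a z w * G w t)"
      unfolding Q_def kernel_comp_def AG using K_meas G_meas by (intro integral_arc_line_integral) auto
    moreover have "K_tilde \<gamma> N a z (\<gamma> u) = 0" for u
      using z range_disjoint[of z] range_disjoint[of "\<gamma> u"] by (intro K_tilde_zero) auto
    ultimately show ?thesis by (simp add: line_integral_def)
  qed
  have FQ: "F s z * Q z = (E (- z) s * Q z) * \<tau> z" for z by (simp add: F_def)
  have s': "\<not> s < a 1" using I_ge[OF s] by simp
  have "integrable arc (\<lambda>z. F s z * Q z)"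
    unfolding Q_def by (rule kernel_comp_integrable[OF F_dominated_I A_comp_G_dominated]) (use s t in auto)
  then have "kernel_comp arc F (kernel_comp arc A G) s t
      = line_integral \<gamma> (\<lambda>z. E (- z) s * Q z) + line_integral (\<lambda>u. - \<gamma> u) (\<lambda>z. E (- z) s * Q z)"
    unfolding kernel_comp_def[of arc F] Q_def[symmetric] FQ
    using E_meas Q_meas by (intro integral_arc_line_integral) auto
  \<comment> \<open>On \<gamma>L the value \<open>E (- z) s\<close> could be nonzero only for s < a
    1, which s in I excludes.\<close>
  also have "line_integral (\<lambda>u. - \<gamma> u) (\<lambda>z. E (- z) s * Q z) = 0"
    using s' range_disjoint by (simp add: line_integral_def E_def)
  also have "line_integral \<gamma> (\<lambda>z. E (- z) s * Q z)
      = line_integral \<gamma> (\<lambda>\<mu>. ?c\<^sup>2 * line_integral (\<lambda>t. - \<gamma> t) (\<lambda>\<zeta>. exp (airy_phase s \<mu> - airy_phase t \<zeta>) / (\<zeta> - \<mu>)))"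
    unfolding line_integral_def[of \<gamma>]
  proof (rule Bochner_Integration.integral_cong[OF refl], rule arg_cong2[where f="(*)", OF _ refl])
    fix u
    define z where "z = \<gamma> u"
    have z: "z \<in> range \<gamma>" by (simp add: z_def)
    have Es: "E (- z) s = exp (z ^ 3 / 6 - of_real s * z)"
      using range_disjoint[OF z] z s s' by (simp add: E_def)
    have "exp (z ^ 3 / 6 - of_real s * z) * (K_tilde \<gamma> N a z w * G w t)
        = ?c\<^sup>2 * (exp (airy_phase s z - airy_phase t w) / (w - z))" if w: "- w \<in> range \<gamma>" for w
    proof -
      have wn: "w \<notin> range \<gamma>" using range_disjoint[of w] w by auto
      have Gw: "G w t = - (exp (- (w ^ 3) / 6 + of_real t * w) * ?c)"
        using w wn t by (simp add: G_def E_def)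
      have ex: "exp (z ^ 3 / 6 - of_real s * z) * exp (z ^ 3 / 6 - w ^ 3 / 6) * exp (- (w ^ 3) / 6 + of_real t * w)
          = exp (airy_phase s z - airy_phase t w)"
        by (simp add: airy_phase_def algebra_simps flip: exp_add)
      have ne: "z - w \<noteq> 0" "w - z \<noteq> 0" using z wn by auto
      \<comment> \<open>The sign of \<open>G\<close> on I turns the denominator z - w of
        \<open>K_tilde\<close> into the w - z of the Airy kernel.\<close>
      have "exp (z ^ 3 / 6 - of_real s * z) * (K_tilde \<gamma> N a z w * G w t)
          = - (?c\<^sup>2 * ((exp (z ^ 3 / 6 - of_real s * z) * exp (z ^ 3 / 6 - w ^ 3 / 6) * exp (- (w ^ 3) / 6 + of_real t * w)) / (z - w)))"
        unfolding K_tilde_RL[OF z w] Gw by (simp add: power2_eq_square mult_ac)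
      also have "\<dots> = ?c\<^sup>2 * (exp (airy_phase s z - airy_phase t w) / (w - z))"
        unfolding ex minus_divide_right mult_minus_right[symmetric] by (metis minus_diff_eq minus_divide_right)
      finally show ?thesis .
    qed
    then have "exp (z ^ 3 / 6 - of_real s * z) * line_integral (\<lambda>u. - \<gamma> u) (\<lambda>w. K_tilde \<gamma> N a z w * G w t)
        = ?c\<^sup>2 * line_integral (\<lambda>t. - \<gamma> t) (\<lambda>\<zeta>. exp (airy_phase s z - airy_phase t \<zeta>) / (\<zeta> - z))"
      unfolding line_integral_def integral_mult_right_zero[symmetric] mult.assoc[symmetric]
      by (intro Bochner_Integration.integral_cong refl) simp
    then show "E (- \<gamma> u) s * Q (\<gamma> u)
        = ?c\<^sup>2 * line_integral (\<lambda>t. - \<gamma> t) (\<lambda>\<zeta>. exp (airy_phase s (\<gamma> u) - airy_phase t \<zeta>) / (\<zeta> - \<gamma> u))"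
      unfolding z_def[symmetric] Es Q[OF z] .
  qed
  also have "\<dots> = airy_kernel \<gamma> s t"
    unfolding airy_kernel_def line_integral_def[of \<gamma>] by (simp add: power_divide mult.assoc)
  finally show ?thesis by simp
qed

text \<open>The majorant is inherited from the factorisation, so the double contour integral itself
  need not be estimated.\<close>

lemma airy_dominated: "dominated_kernel onI onI (airy_kernel \<gamma>)"
  by (rule dominated_kernel_cong[OF dominated_kernel_comp[OF F_dominated_I A_comp_G_dominated sigma_finite_arc]])
     (simp add: airy_kernel_factorisation)

lemma coeff_even: "fredholm_coeff arc K (2 * m) = fredholm_coeff onI (airy_kernel \<gamma>) m"
proof -
  have "fredholm_coeff arc K (2 * m) = fredholm_coeff arc (kernel_comp arc A K) m"
    unfolding A_def[abs_def]
    by (rule fredholm_coeff_antidiagonal(2)[OF sigma_finite_arc K_dominated]) (use K_zero in auto)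
  also have "\<dots> = fredholm_coeff arc (kernel_comp onI (kernel_comp arc A G) F) m"
    by (rule fredholm_coeff_cong) (rule A_comp_K)
  also have "\<dots> = fredholm_coeff onI (kernel_comp arc F (kernel_comp arc A G)) m"
    by (rule fredholm_coeff_swap[OF sigma_finite_arc sigma_finite_onI A_comp_G_dominated F_dominated_I])
  also have "\<dots> = fredholm_coeff onI (airy_kernel \<gamma>) m"
    by (rule fredholm_coeff_cong) (simp add: airy_kernel_factorisation)
  finally show ?thesis .
qed

lemma coeff_odd: "odd n \<Longrightarrow> fredholm_coeff arc K n = 0"
  by (rule fredholm_coeff_antidiagonal(1)[OF sigma_finite_arc K_dominated, of "range \<gamma>"]) (use K_zero in auto)

text \<open>The coefficients of K of odd order vanish, so its expansion is the Airy expansion spread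
  over the even indices.\<close>

lemma fredholm_det_eq: "fredholm_det arc K = fredholm_det onI (airy_kernel \<gamma>)"
proof -
  have "(\<Sum>m. fredholm_coeff arc K (2 * m)) = (\<Sum>n. fredholm_coeff arc K n)"
  proof (rule suminf_mono_reindex)
    show "strict_mono (\<lambda>m::nat. 2 * m)" by (simp add: strict_mono_def)
    fix n :: nat assume "n \<notin> range (\<lambda>m. 2 * m)"
    then have "odd n" by (auto elim!: evenE)
    then show "fredholm_coeff arc K n = 0" by (rule coeff_odd)
  qed
  then show ?thesis by (simp add: fredholm_det_def coeff_even)
qed

end

theorem theorem3p1:
  fixes \<gamma> :: "real \<Rightarrow> complex" and N :: nat and a :: "nat \<Rightarrow> real"
  assumes "right_contour \<gamma>"
    and "N \<ge> 1"
    and "\<forall>j\<in>{1..<N}. a j < a (Suc j)"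
  shows "l2_trace_class (arc_length_measure \<gamma>)
           (integral_operator (arc_length_measure \<gamma>) (line_element_kernel \<gamma> (K_tilde \<gamma> N a))) \<and>
         fredholm_det_exists (arc_length_measure \<gamma>) (line_element_kernel \<gamma> (K_tilde \<gamma> N a)) \<and>
         fredholm_det_exists (restrict_space lborel (interval_union N a)) (airy_kernel \<gamma>) \<and>
         fredholm_det (arc_length_measure \<gamma>) (line_element_kernel \<gamma> (K_tilde \<gamma> N a)) =
         fredholm_det (restrict_space lborel (interval_union N a)) (airy_kernel \<gamma>)"
proof -
  interpret airy_intervals \<gamma> N a by unfold_locales (use assms in auto)
  show ?thesis
    using K_trace_class fredholm_det_exists_dominated[OF sigma_finite_arc K_dominated]
      fredholm_det_exists_dominated[OF sigma_finite_onI airy_dominated] fredholm_det_eq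
    unfolding K_def by blast
qed

end
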